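(* The Yokonuma-Hecke algebra $\mathcal{Y}_{r,n}(q)$ is isomorphic to the associative $R$-algebra generated by $\{g_i\mid i=1,\dots,n-1\}$ and $\{f_{\mathfrak{s}}\mid\mathfrak{s}\in\mathrm{Std}^1_{n,r}\}$ subject to the relations \begin{align*} g_ig_j&=g_jg_i &&\text{for }|i-j|>1,\\ g_ig_{i+1}g_i&=g_{i+1}g_ig_{i+1} &&\text{for }i=1,\dots,n-2,\\ f_{\mathfrak{s}}g_i&=g_if_{\mathfrak{s}s_i} &&\text{for all }\mathfrak{s},i,\\ g_i^2&=1+(q-q^{-1})\sum_{\mathfrak{s}\in\mathrm{Std}^1_{n,r}}\delta_{i,i+1}(\mathfrak{s})\,f_{\mathfrak{s}}g_i &&\text{for all }i,\\ \sum_{\mathfrak{s}\in\mathrm{Std}^1_{n,r}}f_{\mathfrak{s}}&=1,\\ f_{\mathfrak{s}}f_{\mathfrak{s}'}&=\delta_{\mathfrak{s},\mathfrak{s}'}f_{\mathfrak{s}} &&\text{for all }\mathfrak{s},\mathfrak{s}'\in\mathrm{Std}^1_{n,r}, \end{align*} where $\delta_{\mathfrak{s},\mathfrak{s}'}$ is the Kronecker delta, $\delta_{i,i+1}(\mathfrak{s})=1$ if $i$ and $i+1$ belong to the same component (column) of $\mathfrak{s}$ and $\delta_{i,i+1}(\mathfrak{s})=0$ otherwise, and where by convention $f_{\mathfrak{s}s_i}:=f_{\mathfrak{s}}$ if $\delta_{i,i+1}(\mathfrak{s})=1$.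
   Context: Let $n,r\ge 1$ be integers, $\xi=e^{2\pi i/r}\in\mathbb{C}$, $\Delta=\prod_{0\le i<j\le r-1}(\xi^i-\xi^j)$, $q$ an indeterminate and $R=\mathbb{Z}[q,q^{-1},\xi,r^{-1},\Delta^{-1}]$. The symmetric group $\mathfrak{S}_n$ acts on the right on $\{1,\dots,n\}$ and $s_i=(i,i+1)$. The Yokonuma-Hecke algebra $\mathcal{Y}_{r,n}(q)$ is the associative unital $R$-algebra generated by $g_1,\dots,g_{n-1},t_1,\dots,t_n$ with relations: $t_i^r=1$; $t_it_j=t_jt_i$; $t_jg_i=g_it_{js_i}$ for all $i,j$; $g_ig_j=g_jg_i$ for $|i-j|>1$; $g_ig_{i+1}g_i=g_{i+1}g_ig_{i+1}$; and $g_i^2=1+(q-q^{-1})e_ig_i$, where $e_i=\frac1r\sum_{s=0}^{r-1}t_i^st_{i+1}^{-s}$. A one-column $r$-multipartition of $n$ is an $r$-tuple $((1^{c_1}),\dots,(1^{c_r}))$ with $c_j\ge0$ and $c_1+\dots+c_r=n$. $\mathrm{Std}^1_{n,r}$ is the set of all standard multitableaux whose shape is such a one-column $r$-multipartition, i.e. fillings of the $r$ columns by $1,\dots,n$ (each used once) with entries increasing down each column. $\mathfrak{S}_n$ acts on the right on multitableaux by permuting the entries; $\mathfrak{s}s_i$ is $\mathfrak{s}$ with $i$ and $i+1$ interchanged, which lies again in $\mathrm{Std}^1_{n,r}$ when $i,i+1$ are in different components. *)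

theory Defs
  imports
    Complex_Main
    "HOL-Algebra.Algebra"
    "HOL-Algebra.Algebraic_Closure_Type"
    "HOL-Computational_Algebra.Polynomial"
    "HOL-Computational_Algebra.Fraction_Field"
    "HOL-Combinatorics.Transposition"
begin

section \<open>Associative algebras given by generators and relations\<close>

text \<open>
  Algebras over \<open>R\<close> are records of type \<^type>\<open>module\<close>, with the scalar action as
  \<^const>\<open>module.smult\<close>. The locale \<^locale>\<open>algebra\<close> is not used because it requires commutativity.
\<close>

text \<open>
  The free associative unital \<open>R\<close>-algebra on \<open>Gen\<close>: finitely supported functions from words over \<open>Gen\<close>
  to \<open>R\<close>, with convolution along the concatenation of words.
\<close>
definition free_algebra ::
    "('a, 'm) ring_scheme \<Rightarrow> 'x set \<Rightarrow> ('a, 'x list \<Rightarrow> 'a) module" where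
  "free_algebra R Gen =
    \<lparr>carrier = {p. (\<forall>w. p w \<in> carrier R) \<and> finite {w. p w \<noteq> \<zero>\<^bsub>R\<^esub>} \<and>
                   {w. p w \<noteq> \<zero>\<^bsub>R\<^esub>} \<subseteq> lists Gen},
     monoid.mult = (\<lambda>p p' w. \<Oplus>\<^bsub>R\<^esub>k\<in>{..length w}. p (take k w) \<otimes>\<^bsub>R\<^esub> p' (drop k w)),
     one = (\<lambda>w. if w = [] then \<one>\<^bsub>R\<^esub> else \<zero>\<^bsub>R\<^esub>),
     ring.zero = (\<lambda>w. \<zero>\<^bsub>R\<^esub>),
     add = (\<lambda>p p' w. p w \<oplus>\<^bsub>R\<^esub> p' w),
     module.smult = (\<lambda>a p w. a \<otimes>\<^bsub>R\<^esub> p w)\<rparr>"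

definition free_gen :: "('a, 'm) ring_scheme \<Rightarrow> 'x \<Rightarrow> 'x list \<Rightarrow> 'a" where
  "free_gen R x = (\<lambda>w. if w = [x] then \<one>\<^bsub>R\<^esub> else \<zero>\<^bsub>R\<^esub>)"

definition quotient_algebra :: "('a, 'b, 'm) module_scheme \<Rightarrow> 'b set \<Rightarrow> ('a, 'b set) module" where
  "quotient_algebra A I =
    ring.extend (A Quot I) (module.fields (\<lambda>a C. \<Union>x\<in>C. I +>\<^bsub>A\<^esub> (a \<odot>\<^bsub>A\<^esub> x)))"

text \<open>A pair \<open>(u, v)\<close> in \<open>Rel\<close> stands for the defining relation \<open>u = v\<close>.\<close>
definition presented_algebra ::
    "('a, 'm) ring_scheme \<Rightarrow> 'x set \<Rightarrow> (('x list \<Rightarrow> 'a) \<times> ('x list \<Rightarrow> 'a)) set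
      \<Rightarrow> ('a, ('x list \<Rightarrow> 'a) set) module" where
  "presented_algebra R Gen Rel =
    quotient_algebra (free_algebra R Gen)
      (Idl\<^bsub>free_algebra R Gen\<^esub> {u \<ominus>\<^bsub>free_algebra R Gen\<^esub> v | u v. (u, v) \<in> Rel})"

definition algebra_iso ::
    "('a, 'm) ring_scheme \<Rightarrow> ('a, 'b, 'k) module_scheme \<Rightarrow> ('a, 'c, 'l) module_scheme
      \<Rightarrow> ('b \<Rightarrow> 'c) set" where
  "algebra_iso R A B =
    {h \<in> ring_iso A B. \<forall>a\<in>carrier R. \<forall>x\<in>carrier A. h (a \<odot>\<^bsub>A\<^esub> x) = a \<odot>\<^bsub>B\<^esub> h x}"

definition algebra_isomorphic ::
    "('a, 'm) ring_scheme \<Rightarrow> ('a, 'b, 'k) module_scheme \<Rightarrow> ('a, 'c, 'l) module_scheme \<Rightarrow> bool" where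
  "algebra_isomorphic R A B \<longleftrightarrow> algebra_iso R A B \<noteq> {}"


section \<open>The base ring\<close>

text \<open>
  The ring \<open>\<int>[q, q\<^sup>-\<^sup>1, \<xi>, r\<^sup>-\<^sup>1, \<Delta>\<^sup>-\<^sup>1]\<close> is the subring generated by these elements in the field of
  rational functions \<open>\<complex>(q)\<close>.
\<close>

type_synonym ratfun = "complex poly fract"

definition ratfun_const :: "complex \<Rightarrow> ratfun" where
  "ratfun_const c = Fraction_Field.Fract [:c:] 1"

definition q_var :: ratfun where
  "q_var = Fraction_Field.Fract [:0, 1:] 1"

definition root_xi :: "nat \<Rightarrow> complex" where
  "root_xi r = exp (2 * complex_of_real pi * \<i> / of_nat r)"

definition Delta :: "nat \<Rightarrow> complex" where
  "Delta r = (\<Prod>(i, j)\<in>{(i, j). i < j \<and> j < r}. root_xi r ^ i - root_xi r ^ j)"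

definition base_ring :: "nat \<Rightarrow> ratfun ring" where
  "base_ring r = ring_of_type_algebra
    \<lparr>carrier := generate_ring ring_of_type_algebra
      {q_var, inverse q_var, ratfun_const (root_xi r), inverse (of_nat r),
       inverse (ratfun_const (Delta r))}\<rparr>"


section \<open>The Yokonuma-Hecke algebra\<close>

datatype yh_gen = YG nat | YT nat

definition yh_gens :: "nat \<Rightarrow> nat \<Rightarrow> yh_gen set" where
  "yh_gens r n = YG ` {1..n - 1} \<union> YT ` {1..n}"

definition yh_free :: "nat \<Rightarrow> nat \<Rightarrow> (ratfun, yh_gen list \<Rightarrow> ratfun) module" where
  "yh_free r n = free_algebra (base_ring r) (yh_gens r n)"

abbreviation yh_g :: "nat \<Rightarrow> nat \<Rightarrow> yh_gen list \<Rightarrow> ratfun" where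
  "yh_g r i \<equiv> free_gen (base_ring r) (YG i)"

abbreviation yh_t :: "nat \<Rightarrow> nat \<Rightarrow> yh_gen list \<Rightarrow> ratfun" where
  "yh_t r j \<equiv> free_gen (base_ring r) (YT j)"

text \<open>
  The element \<open>e\<^sub>i\<close> of the free algebra. Since \<open>t\<^sub>i\<^sub>+\<^sub>1\<^sup>r = 1\<close> is among the relations, \<open>t\<^sub>i\<^sub>+\<^sub>1\<close> to the
  power \<open>r - s\<close> represents \<open>t\<^sub>i\<^sub>+\<^sub>1\<close> to the power \<open>-s\<close>.
\<close>
definition yh_e :: "nat \<Rightarrow> nat \<Rightarrow> nat \<Rightarrow> yh_gen list \<Rightarrow> ratfun" where
  "yh_e r n i =
    inverse (of_nat r) \<odot>\<^bsub>yh_free r n\<^esub>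
      (\<Oplus>\<^bsub>yh_free r n\<^esub>s\<in>{..<r}.
        yh_t r i [^]\<^bsub>yh_free r n\<^esub> s \<otimes>\<^bsub>yh_free r n\<^esub> yh_t r (i + 1) [^]\<^bsub>yh_free r n\<^esub> (r - s))"

definition yh_rels ::
    "nat \<Rightarrow> nat \<Rightarrow> ((yh_gen list \<Rightarrow> ratfun) \<times> (yh_gen list \<Rightarrow> ratfun)) set" where
  "yh_rels r n = (let F = yh_free r n; g = yh_g r; t = yh_t r in
      {(t i [^]\<^bsub>F\<^esub> r, \<one>\<^bsub>F\<^esub>) | i. i \<in> {1..n}}
    \<union> {(t i \<otimes>\<^bsub>F\<^esub> t j, t j \<otimes>\<^bsub>F\<^esub> t i) | i j. i \<in> {1..n} \<and> j \<in> {1..n}}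
    \<union> {(t j \<otimes>\<^bsub>F\<^esub> g i, g i \<otimes>\<^bsub>F\<^esub> t (Transposition.transpose i (i + 1) j)) | i j.
         i \<in> {1..n - 1} \<and> j \<in> {1..n}}
    \<union> {(g i \<otimes>\<^bsub>F\<^esub> g j, g j \<otimes>\<^bsub>F\<^esub> g i) | i j.
         i \<in> {1..n - 1} \<and> j \<in> {1..n - 1} \<and> \<bar>int i - int j\<bar> > 1}
    \<union> {(g i \<otimes>\<^bsub>F\<^esub> g (i + 1) \<otimes>\<^bsub>F\<^esub> g i, g (i + 1) \<otimes>\<^bsub>F\<^esub> g i \<otimes>\<^bsub>F\<^esub> g (i + 1)) | i.
         i \<in> {1..n - 2}}
    \<union> {(g i [^]\<^bsub>F\<^esub> (2 :: nat),
         \<one>\<^bsub>F\<^esub> \<oplus>\<^bsub>F\<^esub> (q_var - inverse q_var) \<odot>\<^bsub>F\<^esub> (yh_e r n i \<otimes>\<^bsub>F\<^esub> g i)) | i.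
         i \<in> {1..n - 1}})"

definition yokonuma_hecke ::
    "nat \<Rightarrow> nat \<Rightarrow> (ratfun, (yh_gen list \<Rightarrow> ratfun) set) module" where
  "yokonuma_hecke r n = presented_algebra (base_ring r) (yh_gens r n) (yh_rels r n)"


section \<open>One-column standard multitableaux\<close>

text \<open>The list \<open>[c\<^sub>1, \<dots>, c\<^sub>r]\<close> encodes the \<open>r\<close>-multipartition \<open>((1\<^sup>c\<^sup>1), \<dots>, (1\<^sup>c\<^sup>r))\<close>.\<close>
definition one_column_multipartitions :: "nat \<Rightarrow> nat \<Rightarrow> nat list set" where
  "one_column_multipartitions n r = {c. length c = r \<and> sum_list c = n}"

text \<open>
  A one-column multitableau is the list of its \<open>r\<close> components, each component being the list of the
  entries of its column from top to bottom (empty if the component is empty).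
\<close>
type_synonym multitableau = "nat list list"

definition Std1 :: "nat \<Rightarrow> nat \<Rightarrow> multitableau set" where
  "Std1 n r = {s. map length s \<in> one_column_multipartitions n r \<and>
     distinct (concat s) \<and> set (concat s) = {1..n} \<and> (\<forall>c\<in>set s. sorted_wrt (<) c)}"

definition tab_swap :: "nat \<Rightarrow> multitableau \<Rightarrow> multitableau" where
  "tab_swap i s = map (map (Transposition.transpose i (i + 1))) s"

definition same_component :: "nat \<Rightarrow> multitableau \<Rightarrow> bool" where
  "same_component i s \<longleftrightarrow> (\<exists>c\<in>set s. i \<in> set c \<and> i + 1 \<in> set c)"


section \<open>The algebra presented by tableau idempotents\<close>

datatype tab_gen = TG nat | TF multitableau

definition tab_gens :: "nat \<Rightarrow> nat \<Rightarrow> tab_gen set" where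
  "tab_gens r n = TG ` {1..n - 1} \<union> TF ` Std1 n r"

definition tab_free :: "nat \<Rightarrow> nat \<Rightarrow> (ratfun, tab_gen list \<Rightarrow> ratfun) module" where
  "tab_free r n = free_algebra (base_ring r) (tab_gens r n)"

abbreviation tab_g :: "nat \<Rightarrow> nat \<Rightarrow> tab_gen list \<Rightarrow> ratfun" where
  "tab_g r i \<equiv> free_gen (base_ring r) (TG i)"

abbreviation tab_f :: "nat \<Rightarrow> multitableau \<Rightarrow> tab_gen list \<Rightarrow> ratfun" where
  "tab_f r s \<equiv> free_gen (base_ring r) (TF s)"

definition tab_rels ::
    "nat \<Rightarrow> nat \<Rightarrow> ((tab_gen list \<Rightarrow> ratfun) \<times> (tab_gen list \<Rightarrow> ratfun)) set" where
  "tab_rels r n = (let F = tab_free r n; g = tab_g r; f = tab_f r in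
      {(g i \<otimes>\<^bsub>F\<^esub> g j, g j \<otimes>\<^bsub>F\<^esub> g i) | i j.
         i \<in> {1..n - 1} \<and> j \<in> {1..n - 1} \<and> \<bar>int i - int j\<bar> > 1}
    \<union> {(g i \<otimes>\<^bsub>F\<^esub> g (i + 1) \<otimes>\<^bsub>F\<^esub> g i, g (i + 1) \<otimes>\<^bsub>F\<^esub> g i \<otimes>\<^bsub>F\<^esub> g (i + 1)) | i.
         i \<in> {1..n - 2}}
    \<union> {(f s \<otimes>\<^bsub>F\<^esub> g i, g i \<otimes>\<^bsub>F\<^esub> f (if same_component i s then s else tab_swap i s)) | s i.
         s \<in> Std1 n r \<and> i \<in> {1..n - 1}}
    \<union> {(g i [^]\<^bsub>F\<^esub> (2 :: nat),
         \<one>\<^bsub>F\<^esub> \<oplus>\<^bsub>F\<^esub> (q_var - inverse q_var) \<odot>\<^bsub>F\<^esub>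
           (\<Oplus>\<^bsub>F\<^esub>s\<in>Std1 n r. of_bool (same_component i s) \<odot>\<^bsub>F\<^esub> (f s \<otimes>\<^bsub>F\<^esub> g i))) | i.
         i \<in> {1..n - 1}}
    \<union> {(\<Oplus>\<^bsub>F\<^esub>s\<in>Std1 n r. f s, \<one>\<^bsub>F\<^esub>)}
    \<union> {(f s \<otimes>\<^bsub>F\<^esub> f s', of_bool (s = s') \<odot>\<^bsub>F\<^esub> f s) | s s'. s \<in> Std1 n r \<and> s' \<in> Std1 n r})"

definition tableau_algebra ::
    "nat \<Rightarrow> nat \<Rightarrow> (ratfun, (tab_gen list \<Rightarrow> ratfun) set) module" where
  "tableau_algebra r n = presented_algebra (base_ring r) (tab_gens r n) (tab_rels r n)"

end

theory Submission
  imports Defs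
begin

text \<open>
  Both algebras contain a family of joint eigenvectors: elements \<open>f\<^sub>s\<close> indexed by tableaux, with sum
  \<open>1\<close> and \<open>t\<^sub>j f\<^sub>s = f\<^sub>s t\<^sub>j = \<xi>\<^sup>k f\<^sub>s\<close>, where \<open>k\<close> is the column of \<open>j\<close> in \<open>s\<close>. From idempotents \<open>f\<^sub>s\<close> one
  recovers \<open>t\<^sub>j\<close> as the sum of all \<open>\<xi>\<^sup>k f\<^sub>s\<close>; from \<open>t\<^sub>j\<close> one recovers \<open>f\<^sub>s\<close> as a product of
  eigenprojections \<open>1/r \<Sum>\<^sub>a \<xi>\<^sup>-\<^sup>k\<^sup>a t\<^sub>j\<^sup>a\<close>. The key fact is that \<open>x t = \<xi>\<^sup>k x\<close> and \<open>t y = \<xi>\<^sup>l y\<close> with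
  \<open>k \<noteq> l\<close> below \<open>r\<close> force \<open>x y = 0\<close>, since \<open>x y = \<xi>\<^sup>(\<^sup>l\<^sup>-\<^sup>k\<^sup>)\<^sup>a x y\<close> for all \<open>a\<close> and one can average over \<open>a\<close>.
  It shows that the \<open>f\<^sub>s\<close> are orthogonal idempotents, that they are determined by the \<open>t\<^sub>j\<close>, and that
  the relations between \<open>f\<^sub>s\<close> and \<open>g\<^sub>i\<close> are equivalent to those between \<open>t\<^sub>j\<close> and \<open>g\<^sub>i\<close>. Hence each family
  of generators satisfies the defining relations of the other algebra.
\<close>

section \<open>Associative algebras over a commutative ring\<close>

text \<open>Neither presented algebra comes with a basis, and the \<open>f s\<close> could a priori
  vanish, so no dimension count is available. The isomorphism is therefore a pair of homomorphisms,
  obtained from universal properties and shown to be mutually inverse on generators. The index set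
  is natural: a standard one-column tableau is a colouring of \<open>{1..n}\<close> by
  \<open>r\<close> colours, that is, a character of the n-th power of the cyclic group of order
  \<open>r\<close>, and \<open>f s\<close> is the idempotent of that character. The average in
  \<open>e_i\<close> selects the characters whose coordinates \<open>i\<close> and
  \<open>i + 1\<close> agree, hence the tableaux with \<open>i\<close> and \<open>i + 1\<close> in
  one column; this matches the two quadratic relations. The convention for the action when they
  share a column is natural as well, since exchanging two equal colours changes nothing. To avoid
  computing with products of eigenprojections, the two systems of relations are compared once, in an
  arbitrary algebra with a family of joint eigenvectors. Existence of the family is used in one
  algebra and uniqueness in the other.\<close>

locale assoc_algebra = module R A + A: ring A
  for R (structure) and A (structure) +
  assumes smult_mult_left: "\<lbrakk>a \<in> carrier R; x \<in> carrier A; y \<in> carrier A\<rbrakk> \<Longrightarrow>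
      (a \<odot>\<^bsub>A\<^esub> x) \<otimes>\<^bsub>A\<^esub> y = a \<odot>\<^bsub>A\<^esub> (x \<otimes>\<^bsub>A\<^esub> y)"
    and smult_mult_right: "\<lbrakk>a \<in> carrier R; x \<in> carrier A; y \<in> carrier A\<rbrakk> \<Longrightarrow>
      x \<otimes>\<^bsub>A\<^esub> (a \<odot>\<^bsub>A\<^esub> y) = a \<odot>\<^bsub>A\<^esub> (x \<otimes>\<^bsub>A\<^esub> y)"

definition algebra_hom ::
    "('a, 'm) ring_scheme \<Rightarrow> ('a, 'b, 'k) module_scheme \<Rightarrow> ('a, 'c, 'l) module_scheme
      \<Rightarrow> ('b \<Rightarrow> 'c) set" where
  "algebra_hom R A B =
    {h \<in> ring_hom A B. \<forall>a\<in>carrier R. \<forall>x\<in>carrier A. h (a \<odot>\<^bsub>A\<^esub> x) = a \<odot>\<^bsub>B\<^esub> h x}"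

lemma algebra_homD:
  assumes "h \<in> algebra_hom R A B"
  shows "h \<in> ring_hom A B"
    and "x \<in> carrier A \<Longrightarrow> h x \<in> carrier B"
    and "x \<in> carrier A \<Longrightarrow> y \<in> carrier A \<Longrightarrow> h (x \<otimes>\<^bsub>A\<^esub> y) = h x \<otimes>\<^bsub>B\<^esub> h y"
    and "x \<in> carrier A \<Longrightarrow> y \<in> carrier A \<Longrightarrow> h (x \<oplus>\<^bsub>A\<^esub> y) = h x \<oplus>\<^bsub>B\<^esub> h y"
    and "h \<one>\<^bsub>A\<^esub> = \<one>\<^bsub>B\<^esub>"
    and "a \<in> carrier R \<Longrightarrow> x \<in> carrier A \<Longrightarrow> h (a \<odot>\<^bsub>A\<^esub> x) = a \<odot>\<^bsub>B\<^esub> h x"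
  using assms unfolding algebra_hom_def ring_hom_def by auto

lemma algebra_hom_comp:
  assumes "h \<in> algebra_hom R A B" "k \<in> algebra_hom R B C"
  shows "k \<circ> h \<in> algebra_hom R A C"
  using assms ring_hom_trans[of h A B k C] unfolding algebra_hom_def
  by (auto simp: ring_hom_closed)

lemma algebra_hom_id: "(\<lambda>x. x) \<in> algebra_hom R A A"
  unfolding algebra_hom_def ring_hom_def by auto

lemma algebra_iso_of_inverse_homs:
  assumes "h \<in> algebra_hom R A B" "k \<in> algebra_hom R B A"
    and "\<And>x. x \<in> carrier A \<Longrightarrow> k (h x) = x" "\<And>y. y \<in> carrier B \<Longrightarrow> h (k y) = y"
  shows "h \<in> algebra_iso R A B"
proof -
  have "bij_betw h (carrier A) (carrier B)"
    using algebra_homD(2)[OF assms(1)] algebra_homD(2)[OF assms(2)]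
    by (intro bij_betwI[where g = k]) (simp_all add: assms)
  then show ?thesis
    using assms(1) unfolding algebra_iso_def algebra_hom_def ring_iso_def by auto
qed

context
  fixes R A B h
  assumes A: "assoc_algebra R A" and B: "assoc_algebra R B" and h: "h \<in> algebra_hom R A B"
begin

interpretation A: assoc_algebra R A by (rule A)
interpretation B: assoc_algebra R B by (rule B)

lemma algebra_hom_ring_hom: "ring_hom_ring A B h"
  using A.A.ring_axioms B.A.ring_axioms algebra_homD(1)[OF h] by (rule ring_hom_ringI2)

interpretation ring_hom_ring A B h by (rule algebra_hom_ring_hom)

lemma algebra_hom_zero: "h \<zero>\<^bsub>A\<^esub> = \<zero>\<^bsub>B\<^esub>"
  by simp

lemma algebra_hom_minus:
  "x \<in> carrier A \<Longrightarrow> y \<in> carrier A \<Longrightarrow> h (x \<ominus>\<^bsub>A\<^esub> y) = h x \<ominus>\<^bsub>B\<^esub> h y"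
  by (simp add: a_minus_def)

lemma algebra_hom_finsum:
  assumes "\<And>i. i \<in> I \<Longrightarrow> f i \<in> carrier A"
  shows "h (\<Oplus>\<^bsub>A\<^esub>i\<in>I. f i) = (\<Oplus>\<^bsub>B\<^esub>i\<in>I. h (f i))"
  using assms hom_finsum[of f I] by (simp add: Pi_def comp_def)

lemma algebra_hom_nat_pow:
  "x \<in> carrier A \<Longrightarrow> h (x [^]\<^bsub>A\<^esub> (m::nat)) = h x [^]\<^bsub>B\<^esub> m"
  by (induction m) simp_all

end

subsection \<open>Quotients by ideals\<close>

text \<open>Scaling by \<open>a\<close> is multiplication by the element \<open>a\<close> times one,
  so every two-sided ring ideal is a submodule and scalars descend to the quotient.\<close>

lemma ideal_smult_closed:
  assumes A: "assoc_algebra R A" and I: "ideal I A" and a: "a \<in> carrier R" and x: "x \<in> I"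
  shows "a \<odot>\<^bsub>A\<^esub> x \<in> I"
proof -
  interpret A: assoc_algebra R A by (rule A)
  interpret I: ideal I A by (rule I)
  have "(a \<odot>\<^bsub>A\<^esub> \<one>\<^bsub>A\<^esub>) \<otimes>\<^bsub>A\<^esub> x \<in> I"
    using a x by (intro I.I_l_closed) auto
  then show ?thesis
    using a x by (simp add: A.smult_mult_left I.Icarr)
qed

lemma quotient_algebra_simps:
  "carrier (quotient_algebra A I) = carrier (A Quot I)"
  "x \<otimes>\<^bsub>quotient_algebra A I\<^esub> y = x \<otimes>\<^bsub>A Quot I\<^esub> y"
  "x \<oplus>\<^bsub>quotient_algebra A I\<^esub> y = x \<oplus>\<^bsub>A Quot I\<^esub> y"
  "\<one>\<^bsub>quotient_algebra A I\<^esub> = \<one>\<^bsub>A Quot I\<^esub>"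
  "\<zero>\<^bsub>quotient_algebra A I\<^esub> = \<zero>\<^bsub>A Quot I\<^esub>"
  "a \<odot>\<^bsub>quotient_algebra A I\<^esub> C = (\<Union>x\<in>C. I +>\<^bsub>A\<^esub> (a \<odot>\<^bsub>A\<^esub> x))"
  by (simp_all add: quotient_algebra_def ring.defs module.defs)

context
  fixes R A I
  assumes A: "assoc_algebra R A" and I: "ideal I A"
begin

interpretation A: assoc_algebra R A by (rule A)
interpretation I: ideal I A by (rule I)

lemma quotient_carrierE:
  assumes "C \<in> carrier (quotient_algebra A I)"
  obtains x where "x \<in> carrier A" "C = I +>\<^bsub>A\<^esub> x"
  using assms by (auto simp: quotient_algebra_simps FactRing_simps)

lemma quotient_class_simps:
  "x \<in> carrier A \<Longrightarrow> I +>\<^bsub>A\<^esub> x \<in> carrier (quotient_algebra A I)"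
  "x \<in> carrier A \<Longrightarrow> y \<in> carrier A \<Longrightarrow>
    (I +>\<^bsub>A\<^esub> x) \<otimes>\<^bsub>quotient_algebra A I\<^esub> (I +>\<^bsub>A\<^esub> y) = I +>\<^bsub>A\<^esub> (x \<otimes>\<^bsub>A\<^esub> y)"
  "x \<in> carrier A \<Longrightarrow> y \<in> carrier A \<Longrightarrow>
    (I +>\<^bsub>A\<^esub> x) \<oplus>\<^bsub>quotient_algebra A I\<^esub> (I +>\<^bsub>A\<^esub> y) = I +>\<^bsub>A\<^esub> (x \<oplus>\<^bsub>A\<^esub> y)"
  using I.rcos_ring_hom[THEN ring_hom_mult] I.rcos_ring_hom[THEN ring_hom_add]
    I.rcos_ring_hom[THEN ring_hom_closed]
  by (auto simp: quotient_algebra_simps)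

text \<open>The scalar action on a coset is a union over its representatives. Two representatives
  differ by an element of \<open>I\<close>, and so do their multiples, so all cosets in the union
  coincide.\<close>

lemma quotient_class_smult:
  assumes a: "a \<in> carrier R" and x: "x \<in> carrier A"
  shows "a \<odot>\<^bsub>quotient_algebra A I\<^esub> (I +>\<^bsub>A\<^esub> x) = I +>\<^bsub>A\<^esub> (a \<odot>\<^bsub>A\<^esub> x)"
proof -
  have "I +>\<^bsub>A\<^esub> (a \<odot>\<^bsub>A\<^esub> y) = I +>\<^bsub>A\<^esub> (a \<odot>\<^bsub>A\<^esub> x)" if y: "y \<in> I +>\<^bsub>A\<^esub> x" for y
  proof -
    obtain i where i: "i \<in> I" "y = i \<oplus>\<^bsub>A\<^esub> x"
      using y by (auto simp: a_r_coset_def r_coset_def)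
    have "a \<odot>\<^bsub>A\<^esub> y = (a \<odot>\<^bsub>A\<^esub> i) \<oplus>\<^bsub>A\<^esub> (a \<odot>\<^bsub>A\<^esub> x)"
      using i a x by (simp add: A.smult_r_distr I.Icarr)
    then have "a \<odot>\<^bsub>A\<^esub> y \<in> I +>\<^bsub>A\<^esub> (a \<odot>\<^bsub>A\<^esub> x)"
      using ideal_smult_closed[OF A I a i(1)] by (auto simp: a_r_coset_def r_coset_def)
    then show ?thesis
      using a x A.M.a_repr_independence[OF _ _ I.a_subgroup] by simp
  qed
  moreover have "x \<in> I +>\<^bsub>A\<^esub> x"
    using x by (rule I.a_rcos_self)
  ultimately show ?thesis
    unfolding quotient_algebra_simps by blast
qed

lemma quotient_assoc_algebra: "assoc_algebra R (quotient_algebra A I)"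
proof -
  let ?Q = "quotient_algebra A I"
  interpret Q: ring "A Quot I" by (rule I.quotient_is_ring)
  have ring: "ring ?Q"
    by (intro ringI abelian_groupI monoidI)
      (simp_all add: quotient_algebra_simps Q.a_ac Q.m_assoc Q.l_distr Q.r_distr
        Q.add.l_inv_ex)
  note cls = quotient_class_simps quotient_class_smult
  have mod: "module R ?Q"
    using ring.is_abelian_group[OF ring] A.R.cring_axioms
    by (intro moduleI)
      (auto elim!: quotient_carrierE
        simp: cls A.smult_l_distr A.smult_r_distr A.smult_assoc1)
  show ?thesis
    using mod ring
    by (intro assoc_algebra.intro assoc_algebra_axioms.intro)
      (auto elim!: quotient_carrierE simp: cls A.smult_mult_left A.smult_mult_right)
qed

lemma quotient_class_hom: "(+>\<^bsub>A\<^esub>) I \<in> algebra_hom R A (quotient_algebra A I)"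
  unfolding algebra_hom_def ring_hom_def
  by (simp add: Pi_iff quotient_class_simps quotient_class_smult)
     (simp add: quotient_algebra_simps FactRing_def)

lemma quotient_lift:
  assumes B: "assoc_algebra R B" and h: "h \<in> algebra_hom R A B"
    and ker: "\<And>x. x \<in> I \<Longrightarrow> h x = \<zero>\<^bsub>B\<^esub>"
  obtains H where "H \<in> algebra_hom R (quotient_algebra A I) B"
    and "\<And>x. x \<in> carrier A \<Longrightarrow> H (I +>\<^bsub>A\<^esub> x) = h x"
proof -
  interpret B: assoc_algebra R B by (rule B)
  \<comment> \<open>\<open>h\<close> is constant on each coset, so its image of a coset is a
    singleton and no representative has to be chosen.\<close>
  define H where "H C = the_elem (h ` C)" for C
  have H: "H (I +>\<^bsub>A\<^esub> x) = h x" if x: "x \<in> carrier A" for x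
  proof -
    have "h y = h x" if "y \<in> I +>\<^bsub>A\<^esub> x" for y
    proof -
      obtain i where i: "i \<in> I" "y = i \<oplus>\<^bsub>A\<^esub> x"
        using \<open>y \<in> I +>\<^bsub>A\<^esub> x\<close> by (auto simp: a_r_coset_def r_coset_def)
      then show ?thesis
        using x ker algebra_homD[OF h] by (simp add: I.Icarr)
    qed
    moreover have "x \<in> I +>\<^bsub>A\<^esub> x"
      using x by (rule I.a_rcos_self)
    ultimately have "h ` (I +>\<^bsub>A\<^esub> x) = {h x}"
      by blast
    then show ?thesis
      by (simp add: H_def)
  qed
  have "\<one>\<^bsub>quotient_algebra A I\<^esub> = I +>\<^bsub>A\<^esub> \<one>\<^bsub>A\<^esub>"
    by (simp add: quotient_algebra_simps FactRing_def)
  then have "H \<in> algebra_hom R (quotient_algebra A I) B"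
    unfolding algebra_hom_def ring_hom_def
    by (auto elim!: quotient_carrierE simp: H quotient_class_simps quotient_class_smult
        algebra_homD[OF h])
  then show thesis
    using H that by blast
qed

end

subsection \<open>The free algebra\<close>

definition monomial :: "('a, 'm) ring_scheme \<Rightarrow> 'a \<Rightarrow> 'x list \<Rightarrow> 'x list \<Rightarrow> 'a" where
  "monomial R a u = (\<lambda>w. if w = u then a else \<zero>\<^bsub>R\<^esub>)"

lemma free_gen_monomial: "free_gen R x = monomial R \<one>\<^bsub>R\<^esub> [x]"
  by (simp add: free_gen_def monomial_def)

lemma free_algebra_simps:
  "\<one>\<^bsub>free_algebra R Gen\<^esub> = monomial R \<one>\<^bsub>R\<^esub> []"
  "\<zero>\<^bsub>free_algebra R Gen\<^esub> = (\<lambda>w. \<zero>\<^bsub>R\<^esub>)"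
  "p \<oplus>\<^bsub>free_algebra R Gen\<^esub> p' = (\<lambda>w. p w \<oplus>\<^bsub>R\<^esub> p' w)"
  "a \<odot>\<^bsub>free_algebra R Gen\<^esub> p = (\<lambda>w. a \<otimes>\<^bsub>R\<^esub> p w)"
  by (simp_all add: free_algebra_def monomial_def)

lemma free_algebra_carrier:
  "p \<in> carrier (free_algebra R Gen) \<longleftrightarrow>
    (\<forall>w. p w \<in> carrier R) \<and> finite {w. p w \<noteq> \<zero>\<^bsub>R\<^esub>} \<and> {w. p w \<noteq> \<zero>\<^bsub>R\<^esub>} \<subseteq> lists Gen"
  by (simp add: free_algebra_def)

definition word_prod :: "('a, 'b, 'k) module_scheme \<Rightarrow> ('x \<Rightarrow> 'b) \<Rightarrow> 'x list \<Rightarrow> 'b" where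
  "word_prod B \<phi> w = foldr (\<lambda>x b. \<phi> x \<otimes>\<^bsub>B\<^esub> b) w \<one>\<^bsub>B\<^esub>"

section \<open>Convolution of coefficient functions on words\<close>

context cring
begin

definition conv :: "('x list \<Rightarrow> 'a) \<Rightarrow> ('x list \<Rightarrow> 'a) \<Rightarrow> 'x list \<Rightarrow> 'a" where
  "conv p p' w = (\<Oplus>k\<in>{..length w}. p (take k w) \<otimes> p' (drop k w))"

lemma free_algebra_mult: "p \<otimes>\<^bsub>free_algebra R Gen\<^esub> p' = conv p p'"
  by (simp add: free_algebra_def conv_def fun_eq_iff)

lemma conv_closed:
  "range p \<subseteq> carrier R \<Longrightarrow> range p' \<subseteq> carrier R \<Longrightarrow> conv p p' w \<in> carrier R"
  unfolding conv_def by (intro finsum_closed) (auto simp: image_subset_iff)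

lemma conv_Nil:
  assumes "range p \<subseteq> carrier R" "range p' \<subseteq> carrier R"
  shows "conv p p' [] = p [] \<otimes> p' []"
  using assms by (simp add: conv_def image_subset_iff)

text \<open>
  With its companion for the empty word, this turns the convolution into a recursion on the word:
  the left factor is replaced by its left derivative by the first letter.
\<close>
lemma conv_Cons:
  assumes "range p \<subseteq> carrier R" "range p' \<subseteq> carrier R"
  shows "conv p p' (x # w) = p [] \<otimes> p' (x # w) \<oplus> conv (\<lambda>v. p (x # v)) p' w"
proof -
  have "conv p p' (x # w) =
      conv (\<lambda>v. p (x # v)) p' w \<oplus> p [] \<otimes> p' (x # w)"
    using assms unfolding conv_def list.size(4) add_Suc_right add_0_right
    by (subst finsum_Suc2) (auto simp: image_subset_iff)
  also have "\<dots> = p [] \<otimes> p' (x # w) \<oplus> conv (\<lambda>v. p (x # v)) p' w"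
    using assms by (intro a_comm conv_closed) (auto simp: image_subset_iff)
  finally show ?thesis .
qed

lemma conv_add_left:
  assumes "range p \<subseteq> carrier R" "range q \<subseteq> carrier R" "range p' \<subseteq> carrier R"
  shows "conv (\<lambda>v. p v \<oplus> q v) p' w = conv p p' w \<oplus> conv q p' w"
proof -
  have "conv (\<lambda>v. p v \<oplus> q v) p' w =
      (\<Oplus>k\<in>{..length w}. p (take k w) \<otimes> p' (drop k w) \<oplus> q (take k w) \<otimes> p' (drop k w))"
    unfolding conv_def using assms by (intro finsum_cong' l_distr) (auto simp: image_subset_iff)
  then show ?thesis
    using assms unfolding conv_def by (subst (asm) finsum_addf) (auto simp: image_subset_iff)
qed

lemma conv_add_right:
  assumes "range p \<subseteq> carrier R" "range q \<subseteq> carrier R" "range p' \<subseteq> carrier R"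
  shows "conv p' (\<lambda>v. p v \<oplus> q v) w = conv p' p w \<oplus> conv p' q w"
proof -
  have "conv p' (\<lambda>v. p v \<oplus> q v) w =
      (\<Oplus>k\<in>{..length w}. p' (take k w) \<otimes> p (drop k w) \<oplus> p' (take k w) \<otimes> q (drop k w))"
    unfolding conv_def using assms by (intro finsum_cong' r_distr) (auto simp: image_subset_iff)
  then show ?thesis
    using assms unfolding conv_def by (subst (asm) finsum_addf) (auto simp: image_subset_iff)
qed

lemma conv_smult_left:
  assumes "range p \<subseteq> carrier R" "range p' \<subseteq> carrier R" "a \<in> carrier R"
  shows "conv (\<lambda>v. a \<otimes> p v) p' w = a \<otimes> conv p p' w"
proof -
  have "a \<otimes> conv p p' w = (\<Oplus>k\<in>{..length w}. a \<otimes> (p (take k w) \<otimes> p' (drop k w)))"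
    unfolding conv_def using assms by (intro finsum_rdistr) (auto simp: image_subset_iff)
  also have "\<dots> = conv (\<lambda>v. a \<otimes> p v) p' w"
    unfolding conv_def using assms by (intro finsum_cong') (auto simp: image_subset_iff m_assoc)
  finally show ?thesis ..
qed

lemma conv_smult_right:
  assumes "range p \<subseteq> carrier R" "range p' \<subseteq> carrier R" "a \<in> carrier R"
  shows "conv p (\<lambda>v. a \<otimes> p' v) w = a \<otimes> conv p p' w"
proof -
  have "a \<otimes> conv p p' w = (\<Oplus>k\<in>{..length w}. a \<otimes> (p (take k w) \<otimes> p' (drop k w)))"
    unfolding conv_def using assms by (intro finsum_rdistr) (auto simp: image_subset_iff)
  also have "\<dots> = conv p (\<lambda>v. a \<otimes> p' v) w"
    unfolding conv_def using assms by (intro finsum_cong') (auto simp: image_subset_iff m_lcomm)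
  finally show ?thesis ..
qed

lemma conv_monomial_Nil_left:
  assumes "range p \<subseteq> carrier R" "a \<in> carrier R"
  shows "conv (monomial R a []) p w = a \<otimes> p w"
proof -
  have zero: "conv (\<lambda>v. \<zero>) p w = \<zero>" for w
    unfolding conv_def using assms by (intro add.finprod_one_eqI) (auto simp: image_subset_iff)
  show ?thesis
  proof (cases w)
    case Nil
    then show ?thesis
      using assms by (subst Nil, subst conv_Nil) (auto simp: monomial_def image_subset_iff)
  next
    case (Cons x v)
    have "range (monomial R a []) \<subseteq> carrier R"
      using assms by (auto simp: monomial_def)
    then show ?thesis
      unfolding Cons using assms
      by (subst conv_Cons) (auto simp: zero monomial_def image_subset_iff)
  qed
qed

lemma conv_monomial_monomial:
  fixes u v w :: "'x list"
  assumes "a \<in> carrier R" "b \<in> carrier R"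
  shows "conv (monomial R a u) (monomial R b v) w = monomial R (a \<otimes> b) (u @ v) w"
proof (induction u arbitrary: w)
  case Nil
  then show ?case
    using assms by (subst conv_monomial_Nil_left) (auto simp: monomial_def)
next
  case (Cons x u)
  have ran: "range (monomial R c u) \<subseteq> carrier R" if "c \<in> carrier R" for c and u :: "'x list"
    using that by (auto simp: monomial_def)
  have zero: "conv (\<lambda>v. \<zero>) (monomial R b v) w = \<zero>" for w
    unfolding conv_def using assms ran[of b]
    by (intro add.finprod_one_eqI) (auto simp: image_subset_iff)
  show ?case
  proof (cases w)
    case Nil
    then show ?thesis
      unfolding Nil using assms by (subst conv_Nil) (auto simp: monomial_def)
  next
    case (Cons y v')
    \<comment> \<open>The left derivative of a monomial by \<open>y\<close> drops the first letter
      if that letter is \<open>y\<close>, and is zero otherwise.\<close>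
    have "(\<lambda>v. monomial R a (x # u) (y # v)) = (if y = x then monomial R a u else (\<lambda>v. \<zero>))"
      "monomial R a (x # u) [] = \<zero>"
      "monomial R (a \<otimes> b) ((x # u) @ v) (y # v') = (if y = x then monomial R (a \<otimes> b) (u @ v) v' else \<zero>)"
      by (auto simp: monomial_def)
    moreover have "monomial R b v w \<in> carrier R" "monomial R (a \<otimes> b) (u @ v) w \<in> carrier R" for w
      using ran assms by blast+
    ultimately show ?thesis
      unfolding Cons conv_Cons[OF ran[OF assms(1)] ran[OF assms(2)]]
      by (cases "y = x") (simp_all add: Cons.IH zero)
  qed
qed

lemma conv_one_right:
  assumes "range p \<subseteq> carrier R"
  shows "conv p (monomial R \<one> []) w = p w"
  using assms
proof (induction w arbitrary: p)
  case Nil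
  then show ?case
    by (subst conv_Nil) (auto simp: monomial_def image_subset_iff)
next
  case (Cons x w)
  have ran: "range (monomial R \<one> []) \<subseteq> carrier R" "range (\<lambda>v. p (x # v)) \<subseteq> carrier R"
    using Cons.prems by (auto simp: monomial_def)
  have "p [] \<in> carrier R" "p (x # w) \<in> carrier R"
    using Cons.prems by auto
  then show ?case
    unfolding conv_Cons[OF Cons.prems ran(1)] Cons.IH[OF ran(2)] by (simp add: monomial_def)
qed

text \<open>Write d for the left derivative by the letter \<open>x\<close>. Then d(p p') =
  \<open>p []\<close> d(p') + d(p) p', so both bracketings satisfy the same recursion on the word.
  The left factor stays arbitrary because the induction hypothesis is applied to d(p).\<close>

lemma conv_assoc:
  fixes p p' p'' :: "'x list \<Rightarrow> 'a"
  assumes "range p \<subseteq> carrier R" "range p' \<subseteq> carrier R" "range p'' \<subseteq> carrier R"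
  shows "conv (conv p p') p'' w = conv p (conv p' p'') w"
  using assms
proof (induction w arbitrary: p)
  case Nil
  have "range (conv p p') \<subseteq> carrier R" "range (conv p' p'') \<subseteq> carrier R"
    using Nil conv_closed by blast+
  moreover have "p [] \<in> carrier R" "p' [] \<in> carrier R" "p'' [] \<in> carrier R"
    using Nil by auto
  ultimately show ?case
    using Nil by (simp add: conv_Nil m_assoc)
next
  case (Cons x w)
  let ?d = "\<lambda>v. p (x # v)" and ?d' = "\<lambda>v. p' (x # v)"
  have ran: "range ?d \<subseteq> carrier R" "range ?d' \<subseteq> carrier R"
    using Cons.prems by auto
  have ranc: "range (conv q q') \<subseteq> carrier R"
    if "range q \<subseteq> carrier R" "range q' \<subseteq> carrier R" for q q' :: "'x list \<Rightarrow> 'a"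
    using conv_closed[OF that] by blast
  have p: "p u \<in> carrier R" "p' u \<in> carrier R" "p'' u \<in> carrier R" for u
    using Cons.prems by auto
  have "conv (conv p p') p'' (x # w) =
      conv p p' [] \<otimes> p'' (x # w) \<oplus> conv (\<lambda>v. conv p p' (x # v)) p'' w"
    using Cons.prems by (intro conv_Cons ranc)
  also have "(\<lambda>v. conv p p' (x # v)) = (\<lambda>v. p [] \<otimes> ?d' v \<oplus> conv ?d p' v)"
    using Cons.prems by (intro ext conv_Cons)
  also have "conv (\<lambda>v. p [] \<otimes> ?d' v \<oplus> conv ?d p' v) p'' w =
      conv (\<lambda>v. p [] \<otimes> ?d' v) p'' w \<oplus> conv (conv ?d p') p'' w"
    using Cons.prems ran p by (intro conv_add_left ranc) auto
  also have "conv (\<lambda>v. p [] \<otimes> ?d' v) p'' w = p [] \<otimes> conv ?d' p'' w"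
    using Cons.prems ran p by (intro conv_smult_left) auto
  also have "conv (conv ?d p') p'' w = conv ?d (conv p' p'') w"
    using Cons.prems ran by (intro Cons.IH)
  also have "conv p p' [] = p [] \<otimes> p' []"
    using Cons.prems by (intro conv_Nil)
  also have "(p [] \<otimes> p' []) \<otimes> p'' (x # w) \<oplus> (p [] \<otimes> conv ?d' p'' w \<oplus> conv ?d (conv p' p'') w) =
      p [] \<otimes> (p' [] \<otimes> p'' (x # w) \<oplus> conv ?d' p'' w) \<oplus> conv ?d (conv p' p'') w"
    using p conv_closed[OF ran(2) Cons.prems(3)]
      conv_closed[OF ran(1) ranc[OF Cons.prems(2,3)]]
    by (simp add: r_distr m_assoc a_assoc)
  also have "p' [] \<otimes> p'' (x # w) \<oplus> conv ?d' p'' w = conv p' p'' (x # w)"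
    using Cons.prems by (intro conv_Cons[symmetric])
  also have "p [] \<otimes> conv p' p'' (x # w) \<oplus> conv ?d (conv p' p'') w = conv p (conv p' p'') (x # w)"
    using Cons.prems ranc by (intro conv_Cons[symmetric])
  finally show ?case .
qed

text \<open>Each word in the support of a product is a concatenation of one word from each support;
  this gives finiteness and keeps the letters in \<open>Gen\<close>.\<close>

lemma free_algebra_mult_closed:
  assumes p: "p \<in> carrier (free_algebra R Gen)" and p': "p' \<in> carrier (free_algebra R Gen)"
  shows "conv p p' \<in> carrier (free_algebra R Gen)"
proof -
  let ?S = "{w. p w \<noteq> \<zero>}" and ?S' = "{w. p' w \<noteq> \<zero>}"
  have sub: "{w. conv p p' w \<noteq> \<zero>} \<subseteq> (\<lambda>(u, v). u @ v) ` (?S \<times> ?S')"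
  proof (rule subsetI, rule ccontr)
    fix w
    assume w: "w \<in> {w. conv p p' w \<noteq> \<zero>}" "w \<notin> (\<lambda>(u, v). u @ v) ` (?S \<times> ?S')"
    have "p (take k w) = \<zero> \<or> p' (drop k w) = \<zero>" for k
      using w(2) by (force simp: image_iff)
    then have "p (take k w) \<otimes> p' (drop k w) = \<zero>" for k
      using p p' unfolding free_algebra_carrier by (metis l_null r_null)
    then have "conv p p' w = \<zero>"
      unfolding conv_def by (intro add.finprod_one_eqI) auto
    then show False
      using w(1) by simp
  qed
  have "finite (?S \<times> ?S')"
    using p p' unfolding free_algebra_carrier by auto
  moreover have "u @ v \<in> lists Gen" if "u \<in> ?S" "v \<in> ?S'" for u v
    unfolding append_in_lists_conv using that p p' unfolding free_algebra_carrier by blast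
  then have "(\<lambda>(u, v). u @ v) ` (?S \<times> ?S') \<subseteq> lists Gen"
    by (intro image_subsetI) (simp only: split_beta mem_Times_iff)
  moreover have "conv p p' w \<in> carrier R" for w
    using p p' unfolding free_algebra_carrier by (intro conv_closed) auto
  ultimately show ?thesis
    unfolding free_algebra_carrier using sub by (meson finite_imageI finite_subset subset_trans)
qed

lemma free_algebra_add_closed:
  assumes "p \<in> carrier (free_algebra R Gen)" "p' \<in> carrier (free_algebra R Gen)"
  shows "(\<lambda>w. p w \<oplus> p' w) \<in> carrier (free_algebra R Gen)"
proof -
  have "{w. p w \<oplus> p' w \<noteq> \<zero>} \<subseteq> {w. p w \<noteq> \<zero>} \<union> {w. p' w \<noteq> \<zero>}"
    by auto
  then show ?thesis
    using assms unfolding free_algebra_carrier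
    by (meson a_closed finite_UnI finite_subset subset_trans Un_least)
qed

lemma free_algebra_smult_closed:
  assumes "a \<in> carrier R" "p \<in> carrier (free_algebra R Gen)"
  shows "(\<lambda>w. a \<otimes> p w) \<in> carrier (free_algebra R Gen)"
proof -
  have "{w. a \<otimes> p w \<noteq> \<zero>} \<subseteq> {w. p w \<noteq> \<zero>}"
    using assms by auto
  then show ?thesis
    using assms unfolding free_algebra_carrier by (meson finite_subset m_closed subset_trans)
qed

lemma monomial_closed:
  "a \<in> carrier R \<Longrightarrow> u \<in> lists Gen \<Longrightarrow> monomial R a u \<in> carrier (free_algebra R Gen)"
  by (auto simp: free_algebra_carrier monomial_def intro: finite_subset[of _ "{u}"])

lemma free_algebra_zero_closed: "(\<lambda>w. \<zero>) \<in> carrier (free_algebra R Gen)"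
  by (simp add: free_algebra_carrier)

lemma free_gen_closed: "x \<in> Gen \<Longrightarrow> free_gen R x \<in> carrier (free_algebra R Gen)"
  unfolding free_gen_monomial by (rule monomial_closed) auto

lemma free_algebra_coeff: "p \<in> carrier (free_algebra R Gen) \<Longrightarrow> p w \<in> carrier R"
  and free_algebra_range: "p \<in> carrier (free_algebra R Gen) \<Longrightarrow> range p \<subseteq> carrier R"
  by (auto simp: free_algebra_carrier)

lemma free_algebra_assoc_algebra: "assoc_algebra R (free_algebra R Gen)"
proof -
  let ?F = "free_algebra R Gen"
  note closed = free_algebra_mult_closed free_algebra_add_closed free_algebra_smult_closed
    free_algebra_zero_closed monomial_closed
  have inv: "\<exists>p'\<in>carrier ?F. p' \<oplus>\<^bsub>?F\<^esub> p = \<zero>\<^bsub>?F\<^esub>" if "p \<in> carrier ?F" for p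
  proof
    show "(\<lambda>w. \<ominus> \<one> \<otimes> p w) \<in> carrier ?F"
      using that by (intro closed) auto
    show "(\<lambda>w. \<ominus> \<one> \<otimes> p w) \<oplus>\<^bsub>?F\<^esub> p = \<zero>\<^bsub>?F\<^esub>"
      using that by (auto simp: free_algebra_simps free_algebra_coeff l_minus l_neg)
  qed
  have grp: "abelian_group ?F"
    using inv
    by (intro abelian_groupI)
      (auto simp: free_algebra_simps(2,3) closed free_algebra_coeff a_ac)
  have assoc: "(p \<otimes>\<^bsub>?F\<^esub> p') \<otimes>\<^bsub>?F\<^esub> p'' = p \<otimes>\<^bsub>?F\<^esub> (p' \<otimes>\<^bsub>?F\<^esub> p'')"
    if "p \<in> carrier ?F" "p' \<in> carrier ?F" "p'' \<in> carrier ?F" for p p' p''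
    unfolding free_algebra_mult using that by (intro ext conv_assoc free_algebra_range)
  have one: "\<one>\<^bsub>?F\<^esub> \<otimes>\<^bsub>?F\<^esub> p = p" "p \<otimes>\<^bsub>?F\<^esub> \<one>\<^bsub>?F\<^esub> = p" if "p \<in> carrier ?F" for p
    unfolding free_algebra_mult free_algebra_simps using that
    by (simp_all add: fun_eq_iff free_algebra_range conv_monomial_Nil_left conv_one_right
        free_algebra_coeff)
  have mon: "monoid ?F"
  proof (rule monoidI)
    show "p \<otimes>\<^bsub>?F\<^esub> p' \<in> carrier ?F" if "p \<in> carrier ?F" "p' \<in> carrier ?F" for p p'
      unfolding free_algebra_mult using that by (rule closed)
    show "\<one>\<^bsub>?F\<^esub> \<in> carrier ?F"
      unfolding free_algebra_simps by (intro closed) auto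
  qed (fact assoc one)+
  have ring: "ring ?F"
    using grp mon
    by (intro ringI)
      (simp_all add: fun_eq_iff
        free_algebra_mult free_algebra_simps(3) conv_add_left conv_add_right free_algebra_range)
  have mod: "module R ?F"
    using grp cring_axioms
    by (intro moduleI)
      (auto simp: free_algebra_simps(3,4) closed free_algebra_coeff l_distr r_distr m_assoc)
  show ?thesis
    using mod ring
    by (intro assoc_algebra.intro assoc_algebra_axioms.intro)
      (simp_all add: fun_eq_iff
        free_algebra_mult free_algebra_simps(4) conv_smult_left conv_smult_right free_algebra_range)
qed

section \<open>Induction on the support and the universal property\<close>

lemma free_algebra_induct [consumes 1, case_names zero monomial add]:
  assumes p: "p \<in> carrier (free_algebra R Gen)"
    and zero: "P \<zero>\<^bsub>free_algebra R Gen\<^esub>"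
    and monomial: "\<And>a u. a \<in> carrier R \<Longrightarrow> u \<in> lists Gen \<Longrightarrow> P (monomial R a u)"
    and add: "\<And>p p'. p \<in> carrier (free_algebra R Gen) \<Longrightarrow> p' \<in> carrier (free_algebra R Gen) \<Longrightarrow>
      P p \<Longrightarrow> P p' \<Longrightarrow> P (p \<oplus>\<^bsub>free_algebra R Gen\<^esub> p')"
  shows "P p"
proof -
  \<comment> \<open>The induction is on a finite superset \<open>W\<close> of the support: removing
    \<open>u\<close> from \<open>W\<close> corresponds to erasing the coefficient at
    \<open>u\<close>, also when that coefficient is already zero.\<close>
  have "finite W \<Longrightarrow> p \<in> carrier (free_algebra R Gen) \<Longrightarrow> {w. p w \<noteq> \<zero>} \<subseteq> W \<Longrightarrow> P p" for W p
  proof (induction W arbitrary: p rule: finite_induct)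
    case empty
    then have "p = \<zero>\<^bsub>free_algebra R Gen\<^esub>"
      by (auto simp: free_algebra_simps)
    then show ?case
      using zero by simp
  next
    case (insert u W)
    let ?p = "p(u := \<zero>)"
    have sub: "{w. ?p w \<noteq> \<zero>} \<subseteq> {w. p w \<noteq> \<zero>}"
      by auto
    have mem: "?p \<in> carrier (free_algebra R Gen)"
      using insert.prems(1) finite_subset[OF sub] sub unfolding free_algebra_carrier by auto
    have P1: "P ?p"
      using insert.prems(2) by (intro insert.IH mem) auto
    show ?case
    proof (cases "p u = \<zero>")
      case True
      then have "?p = p" by auto
      then show ?thesis using P1 by simp
    next
      case False
      then have u: "u \<in> lists Gen" and c: "p u \<in> carrier R"
        using insert.prems(1) unfolding free_algebra_carrier by auto
      have "p = ?p \<oplus>\<^bsub>free_algebra R Gen\<^esub> monomial R (p u) u"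
        using insert.prems(1) by (auto simp: free_algebra_simps monomial_def free_algebra_coeff)
      then show ?thesis
        using add[OF mem monomial_closed[OF c u] P1 monomial[OF c u]] by simp
    qed
  qed
  then show ?thesis
    using p unfolding free_algebra_carrier by auto
qed

text \<open>Together with \<open>monomial_Cons\<close>, this peels off generators while the
  coefficient stays with the remaining word, until a scalar multiple of one is left. Homomorphisms
  are thereby determined on monomials.\<close>

lemma monomial_Nil: "a \<in> carrier R \<Longrightarrow>
    monomial R a [] = a \<odot>\<^bsub>free_algebra R Gen\<^esub> \<one>\<^bsub>free_algebra R Gen\<^esub>"
  by (auto simp: free_algebra_simps monomial_def)

lemma monomial_Cons: "a \<in> carrier R \<Longrightarrow>
    monomial R a (x # u) = free_gen R x \<otimes>\<^bsub>free_algebra R Gen\<^esub> monomial R a u"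
  unfolding free_gen_monomial free_algebra_mult
  by (simp add: conv_monomial_monomial fun_eq_iff)

lemma free_algebra_hom_eqI:
  assumes B: "assoc_algebra R B"
    and h: "h \<in> algebra_hom R (free_algebra R Gen) B"
    and k: "k \<in> algebra_hom R (free_algebra R Gen) B"
    and gen: "\<And>x. x \<in> Gen \<Longrightarrow> h (free_gen R x) = k (free_gen R x)"
    and p: "p \<in> carrier (free_algebra R Gen)"
  shows "h p = k p"
  using p
proof (induction p rule: free_algebra_induct)
  case zero
  then show ?case
    using algebra_hom_zero[OF free_algebra_assoc_algebra B] h k by metis
next
  case (monomial a u)
  interpret F: assoc_algebra R "free_algebra R Gen" by (rule free_algebra_assoc_algebra)
  show ?case
    using monomial(2)
  proof (induction u)
    case Nil
    then show ?case
      using monomial(1) by (simp add: monomial_Nil[where Gen = Gen] algebra_homD[OF h] algebra_homD[OF k])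
  next
    case (Cons x u)
    then show ?case
      using monomial(1) by (simp add: monomial_Cons[where Gen = Gen] algebra_homD[OF h]
          algebra_homD[OF k] gen monomial_closed free_gen_closed)
  qed
next
  case (add p p')
  then show ?case
    by (simp add: algebra_homD[OF h] algebra_homD[OF k])
qed

lemma free_algebra_lift:
  assumes B: "assoc_algebra R B" and \<phi>: "\<And>x. x \<in> Gen \<Longrightarrow> \<phi> x \<in> carrier B"
  obtains h where "h \<in> algebra_hom R (free_algebra R Gen) B"
    and "\<And>x. x \<in> Gen \<Longrightarrow> h (free_gen R x) = \<phi> x"
proof -
  interpret B: assoc_algebra R B by (rule B)
  let ?F = "free_algebra R Gen"
  interpret F: assoc_algebra R ?F by (rule free_algebra_assoc_algebra)
  have wp_closed: "word_prod B \<phi> w \<in> carrier B" if "w \<in> lists Gen" for w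
    using that by (induction w) (auto simp: word_prod_def \<phi>)
  have wp_append: "word_prod B \<phi> (u @ v) = word_prod B \<phi> u \<otimes>\<^bsub>B\<^esub> word_prod B \<phi> v"
    if "u \<in> lists Gen" "v \<in> lists Gen" for u v
    using that(1)
  proof (induction u)
    case Nil
    then show ?case
      using wp_closed[OF that(2)] by (simp add: word_prod_def)
  next
    case (Cons x u)
    then show ?case
      using wp_closed[OF that(2)] wp_closed[of u] by (simp add: word_prod_def \<phi> B.A.m_assoc)
  qed
  \<comment> \<open>The linear extension of the word products. The sum runs over the support, which
    differs between \<open>p\<close>, \<open>p'\<close> and their sum; \<open>h_superset\<close>
    moves such sums to a common finite set of words.\<close>
  define h where "h p = (\<Oplus>\<^bsub>B\<^esub>w\<in>{w. p w \<noteq> \<zero>}. p w \<odot>\<^bsub>B\<^esub> word_prod B \<phi> w)" for p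
  have h_superset: "h p = (\<Oplus>\<^bsub>B\<^esub>w\<in>W. p w \<odot>\<^bsub>B\<^esub> word_prod B \<phi> w)"
    if "finite W" "{w. p w \<noteq> \<zero>} \<subseteq> W" "W \<subseteq> lists Gen" "p \<in> carrier ?F" for p W
  proof -
    have "word_prod B \<phi> w \<in> carrier B" if "w \<in> W" for w
      using that \<open>W \<subseteq> lists Gen\<close> wp_closed by blast
    then show ?thesis
      unfolding h_def using that
      by (intro B.M.add.finprod_mono_neutral_cong_left) (auto simp: free_algebra_coeff)
  qed
  have h_closed: "h p \<in> carrier B" if "p \<in> carrier ?F" for p
  proof -
    have "word_prod B \<phi> w \<in> carrier B" if "p w \<noteq> \<zero>" for w
      using that \<open>p \<in> carrier ?F\<close> wp_closed unfolding free_algebra_carrier by blast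
    then show ?thesis
      unfolding h_def using that by (intro B.M.finsum_closed) (auto simp: free_algebra_coeff)
  qed
  have h_add: "h (p \<oplus>\<^bsub>?F\<^esub> p') = h p \<oplus>\<^bsub>B\<^esub> h p'" if "p \<in> carrier ?F" "p' \<in> carrier ?F" for p p'
  proof -
    define W where "W = {w. p w \<noteq> \<zero>} \<union> {w. p' w \<noteq> \<zero>}"
    have W: "finite W" "W \<subseteq> lists Gen"
      using that unfolding W_def free_algebra_carrier by auto
    have sub: "{w. (p \<oplus>\<^bsub>?F\<^esub> p') w \<noteq> \<zero>} \<subseteq> W" "{w. p w \<noteq> \<zero>} \<subseteq> W" "{w. p' w \<noteq> \<zero>} \<subseteq> W"
      by (auto simp: free_algebra_simps W_def)
    have pc: "p w \<in> carrier R" "p' w \<in> carrier R" for w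
      using that by (simp_all add: free_algebra_coeff)
    have wpc: "word_prod B \<phi> w \<in> carrier B" if "w \<in> W" for w
      using that W(2) wp_closed by blast
    have "h (p \<oplus>\<^bsub>?F\<^esub> p') = (\<Oplus>\<^bsub>B\<^esub>w\<in>W. (p w \<oplus> p' w) \<odot>\<^bsub>B\<^esub> word_prod B \<phi> w)"
      using h_superset[OF W(1) sub(1) W(2) F.M.a_closed[OF that]] by (simp add: free_algebra_simps)
    also have "\<dots> = (\<Oplus>\<^bsub>B\<^esub>w\<in>W. p w \<odot>\<^bsub>B\<^esub> word_prod B \<phi> w \<oplus>\<^bsub>B\<^esub> p' w \<odot>\<^bsub>B\<^esub> word_prod B \<phi> w)"
      using pc wpc by (intro B.M.finsum_cong') (auto intro!: B.smult_l_distr)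
    also have "\<dots> = h p \<oplus>\<^bsub>B\<^esub> h p'"
      unfolding h_superset[OF W(1) sub(2) W(2) that(1)] h_superset[OF W(1) sub(3) W(2) that(2)]
      using pc wpc by (intro B.M.finsum_addf) auto
    finally show ?thesis .
  qed
  have h_zero: "h \<zero>\<^bsub>?F\<^esub> = \<zero>\<^bsub>B\<^esub>"
    by (simp add: h_def free_algebra_simps)
  have h_monomial: "h (monomial R a u) = a \<odot>\<^bsub>B\<^esub> word_prod B \<phi> u"
    if "a \<in> carrier R" "u \<in> lists Gen" for a u
  proof -
    have "h (monomial R a u) = (\<Oplus>\<^bsub>B\<^esub>w\<in>{u}. monomial R a u w \<odot>\<^bsub>B\<^esub> word_prod B \<phi> w)"
      using that by (intro h_superset monomial_closed) (auto simp: monomial_def)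
    then show ?thesis
      using that wp_closed[OF that(2)] by (simp add: monomial_def)
  qed
  have mono_mult: "monomial R a u \<otimes>\<^bsub>?F\<^esub> monomial R b v = monomial R (a \<otimes> b) (u @ v)"
    if "a \<in> carrier R" "b \<in> carrier R" for a b u v
    using that by (simp add: free_algebra_mult conv_monomial_monomial fun_eq_iff)
  \<comment> \<open>Multiplicativity by additivity in each factor: here the left factor is a
    monomial and the induction is on the right one, while \<open>h_mult\<close> does the induction
    on the left factor. Collecting the coefficients uses commutativity of \<open>R\<close>.\<close>
  have h_mult_monomial: "h (monomial R a u \<otimes>\<^bsub>?F\<^esub> p) = h (monomial R a u) \<otimes>\<^bsub>B\<^esub> h p"
    if a: "a \<in> carrier R" "u \<in> lists Gen" and "p \<in> carrier ?F" for a u p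
    using that(3)
  proof (induction p rule: free_algebra_induct)
    case zero
    then show ?case
      using a by (simp add: h_zero h_closed monomial_closed)
  next
    case (monomial b v)
    then show ?case
      using a by (simp add: mono_mult h_monomial wp_closed wp_append B.smult_mult_left
          B.smult_mult_right B.smult_assoc1[symmetric] m_comm)
  next
    case (add p p')
    then show ?case
      using a by (simp add: F.A.r_distr B.A.r_distr h_add h_closed monomial_closed)
  qed
  have h_mult: "h (p \<otimes>\<^bsub>?F\<^esub> p') = h p \<otimes>\<^bsub>B\<^esub> h p'"
    if "p \<in> carrier ?F" and p': "p' \<in> carrier ?F" for p p'
    using that(1)
  proof (induction p rule: free_algebra_induct)
    case zero
    then show ?case
      using p' by (simp add: h_zero h_closed)
  next
    case (monomial a u)
    then show ?case
      using p' by (rule h_mult_monomial)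
  next
    case (add q q')
    then show ?case
      using p' by (simp add: F.A.l_distr B.A.l_distr h_add h_closed)
  qed
  have h_smult: "h (a \<odot>\<^bsub>?F\<^esub> p) = a \<odot>\<^bsub>B\<^esub> h p" if a: "a \<in> carrier R" and "p \<in> carrier ?F" for a p
    using that(2)
  proof (induction p rule: free_algebra_induct)
    case zero
    then show ?case
      using a by (simp add: h_zero)
  next
    case (monomial b u)
    have "a \<odot>\<^bsub>?F\<^esub> monomial R b u = monomial R (a \<otimes> b) u"
      using a by (auto simp: free_algebra_simps monomial_def)
    then show ?case
      using monomial a by (simp add: h_monomial wp_closed B.smult_assoc1)
  next
    case (add p p')
    then show ?case
      using a by (simp add: F.smult_r_distr B.smult_r_distr h_add h_closed)
  qed
  have "h \<one>\<^bsub>?F\<^esub> = \<one>\<^bsub>B\<^esub>"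
    unfolding free_algebra_simps using h_monomial[of \<one> "[]"] by (simp add: word_prod_def)
  then have "h \<in> algebra_hom R ?F B"
    unfolding algebra_hom_def ring_hom_def using h_closed h_mult h_add h_smult by auto
  moreover have "h (free_gen R x) = \<phi> x" if "x \<in> Gen" for x
    using h_monomial[of \<one> "[x]"] that \<phi>[OF that] by (simp add: free_gen_monomial word_prod_def)
  ultimately show thesis
    using that by blast
qed

end

subsection \<open>Presented algebras\<close>

locale presentation = R: cring R
  for R :: "('a, 'm) ring_scheme" and Gen :: "'x set"
    and Rel :: "(('x list \<Rightarrow> 'a) \<times> ('x list \<Rightarrow> 'a)) set" +
  assumes Rel_closed: "Rel \<subseteq> carrier (free_algebra R Gen) \<times> carrier (free_algebra R Gen)"
begin

abbreviation "F \<equiv> free_algebra R Gen"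
abbreviation "relators \<equiv> {u \<ominus>\<^bsub>F\<^esub> v | u v. (u, v) \<in> Rel}"
abbreviation "P \<equiv> presented_algebra R Gen Rel"

definition cls :: "('x list \<Rightarrow> 'a) \<Rightarrow> ('x list \<Rightarrow> 'a) set" where
  "cls p = Idl\<^bsub>F\<^esub> relators +>\<^bsub>F\<^esub> p"

sublocale F: assoc_algebra R F by (rule R.free_algebra_assoc_algebra)

lemma relators_closed: "relators \<subseteq> carrier F"
  using Rel_closed by auto

lemma ideal_relators: "ideal (Idl\<^bsub>F\<^esub> relators) F"
  using relators_closed by (rule F.A.genideal_ideal)

sublocale P: assoc_algebra R P
  unfolding presented_algebra_def
  by (rule quotient_assoc_algebra[OF F.assoc_algebra_axioms ideal_relators])

lemma cls_hom: "cls \<in> algebra_hom R F P"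
  unfolding cls_def presented_algebra_def
  by (rule quotient_class_hom[OF F.assoc_algebra_axioms ideal_relators])

lemma cls_relation:
  assumes "(u, v) \<in> Rel"
  shows "cls u = cls v"
proof -
  interpret I: ideal "Idl\<^bsub>F\<^esub> relators" F by (rule ideal_relators)
  have uv: "u \<in> carrier F" "v \<in> carrier F"
    using assms Rel_closed by auto
  have "u \<ominus>\<^bsub>F\<^esub> v \<in> Idl\<^bsub>F\<^esub> relators"
    using F.A.genideal_self[OF relators_closed] assms by blast
  then show ?thesis
    unfolding cls_def using uv F.A.quotient_eq_iff_same_a_r_cos[OF ideal_relators] by blast
qed

text \<open>\<open>cls\<close> is onto, so the statement is inherited from the free algebra by
  composing with it.\<close>

lemma P_hom_eqI:
  assumes B: "assoc_algebra R B" and h: "h \<in> algebra_hom R P B" and k: "k \<in> algebra_hom R P B"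
    and gen: "\<And>x. x \<in> Gen \<Longrightarrow> h (cls (free_gen R x)) = k (cls (free_gen R x))"
    and C: "C \<in> carrier P"
  shows "h C = k C"
proof -
  obtain p where p: "p \<in> carrier F" "C = cls p"
    using C unfolding presented_algebra_def cls_def
    by (rule quotient_carrierE[OF F.assoc_algebra_axioms ideal_relators])
  have "(h \<circ> cls) p = (k \<circ> cls) p"
    using R.free_algebra_hom_eqI[OF B algebra_hom_comp[OF cls_hom h] algebra_hom_comp[OF cls_hom k]]
      gen p(1) by simp
  then show ?thesis
    using p(2) by simp
qed

text \<open>The kernel of \<open>h\<close> is an ideal that contains all relators, hence the ideal
  they generate, so \<open>h\<close> factors through the quotient.\<close>

lemma P_lift:
  assumes B: "assoc_algebra R B" and h: "h \<in> algebra_hom R F B"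
    and rel: "\<And>u v. (u, v) \<in> Rel \<Longrightarrow> h u = h v"
  obtains H where "H \<in> algebra_hom R P B" and "\<And>p. p \<in> carrier F \<Longrightarrow> H (cls p) = h p"
proof -
  interpret B: assoc_algebra R B by (rule B)
  interpret h: ring_hom_ring F B h
    by (rule algebra_hom_ring_hom[OF F.assoc_algebra_axioms B h])
  have "relators \<subseteq> a_kernel F B h"
  proof
    fix x
    assume "x \<in> relators"
    then obtain u v where uv: "(u, v) \<in> Rel" "x = u \<ominus>\<^bsub>F\<^esub> v"
      by blast
    then have mem: "u \<in> carrier F" "v \<in> carrier F"
      using Rel_closed by auto
    have "h x = h v \<ominus>\<^bsub>B\<^esub> h v"
      unfolding uv(2) algebra_hom_minus[OF F.assoc_algebra_axioms B h mem] rel[OF uv(1)] ..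
    also have "\<dots> = \<zero>\<^bsub>B\<^esub>"
      using algebra_homD(2)[OF h mem(2)] unfolding a_minus_def by (rule B.M.r_neg)
    finally show "x \<in> a_kernel F B h"
      unfolding a_kernel_def' using F.M.minus_closed[OF mem] uv(2) by blast
  qed
  then have "Idl\<^bsub>F\<^esub> relators \<subseteq> a_kernel F B h"
    by (rule F.A.genideal_minimal[OF h.kernel_is_ideal])
  then have ker: "h x = \<zero>\<^bsub>B\<^esub>" if "x \<in> Idl\<^bsub>F\<^esub> relators" for x
    using that unfolding a_kernel_def' by blast
  obtain H where "H \<in> algebra_hom R (quotient_algebra F (Idl\<^bsub>F\<^esub> relators)) B"
    and "\<And>p. p \<in> carrier F \<Longrightarrow> H (Idl\<^bsub>F\<^esub> relators +>\<^bsub>F\<^esub> p) = h p"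
    using quotient_lift[OF F.assoc_algebra_axioms ideal_relators B h ker] by blast
  then show thesis
    by (intro that[of H]) (simp_all only: presented_algebra_def cls_def)
qed

end

section \<open>Joint eigenspaces of commuting roots of unity\<close>

text \<open>Exponents are natural numbers, so \<open>r - k\<close> stands for -k throughout. The sum
  lies strictly between 0 and 2r, which leaves \<open>r\<close> as its only possible multiple of
  \<open>r\<close>.\<close>

lemma dvd_add_diff_iff:
  fixes k l r :: nat
  assumes "l < r" "k < r"
  shows "r dvd l + (r - k) \<longleftrightarrow> l = k"
proof
  assume "r dvd l + (r - k)"
  then obtain c where c: "l + (r - k) = r * c" ..
  then have "r * c < r * 2"
    using assms by linarith
  then have "c = 0 \<or> c = 1"
    by auto
  then show "l = k"
    using assms c by auto
qed (use assms in simp)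

lemma (in abelian_monoid) finsum_swap:
  assumes "finite I" "finite J" "\<And>i j. i \<in> I \<Longrightarrow> j \<in> J \<Longrightarrow> f i j \<in> carrier G"
  shows "(\<Oplus>i\<in>I. \<Oplus>j\<in>J. f i j) = (\<Oplus>j\<in>J. \<Oplus>i\<in>I. f i j)"
  using assms(1,3)
proof (induction I rule: finite_induct)
  case empty
  then show ?case by (simp add: finsum_zero)
next
  case (insert i I)
  have fin: "(\<Oplus>i\<in>I. f i j) \<in> carrier G" if "j \<in> J" for j
    using insert that by (intro finsum_closed) auto
  have "(\<Oplus>i\<in>insert i I. \<Oplus>j\<in>J. f i j) = (\<Oplus>j\<in>J. f i j) \<oplus> (\<Oplus>i\<in>I. \<Oplus>j\<in>J. f i j)"
    using insert by (intro finsum_insert) (auto intro!: finsum_closed)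
  also have "\<dots> = (\<Oplus>j\<in>J. f i j \<oplus> (\<Oplus>i\<in>I. f i j))"
    using insert fin by (subst finsum_addf) auto
  also have "\<dots> = (\<Oplus>j\<in>J. \<Oplus>i\<in>insert i I. f i j)"
    using insert fin by (intro finsum_cong') (auto intro!: finsum_closed)
  finally show ?case .
qed

lemma (in monoid) commute_nat_pow:
  assumes "t \<in> carrier G" "x \<in> carrier G" "x \<otimes> t = t \<otimes> x"
  shows "x \<otimes> t [^] (a::nat) = t [^] a \<otimes> x"
proof (induction a)
  case 0
  then show ?case using assms by simp
next
  case (Suc a)
  have "x \<otimes> t [^] Suc a = (x \<otimes> t [^] a) \<otimes> t"
    using assms by (simp add: m_assoc)
  also have "\<dots> = t [^] a \<otimes> (t \<otimes> x)"
    using assms by (simp add: Suc m_assoc)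
  also have "\<dots> = t [^] Suc a \<otimes> x"
    using assms by (simp add: m_assoc)
  finally show ?case .
qed

lemma (in assoc_algebra) finsum_smult_rdistr:
  "\<lbrakk>finite I; \<And>i. i \<in> I \<Longrightarrow> c i \<in> carrier R; x \<in> carrier A\<rbrakk> \<Longrightarrow>
    (\<Oplus>\<^bsub>R\<^esub>i\<in>I. c i) \<odot>\<^bsub>A\<^esub> x = (\<Oplus>\<^bsub>A\<^esub>i\<in>I. c i \<odot>\<^bsub>A\<^esub> x)"
  by (induction I rule: finite_induct) (simp_all add: Pi_iff smult_l_distr)

text \<open>\<open>\<rho>\<close> is the inverse of \<open>r\<close>, as
  \<open>orthogonality\<close> at \<open>m = 0\<close> shows; for other \<open>m\<close> the axiom
  expresses that \<open>\<zeta>\<close> is primitive. The averaged character sum is the form in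
  which both facts are applied.\<close>

locale root_of_unity = cring R for R (structure) +
  fixes r :: nat and \<zeta> \<rho>
  assumes r_pos: "r > 0"
    and \<zeta>_closed [simp, intro]: "\<zeta> \<in> carrier R"
    and \<rho>_closed [simp, intro]: "\<rho> \<in> carrier R"
    and \<zeta>_pow_r: "\<zeta> [^] r = \<one>"
    and orthogonality: "\<rho> \<otimes> (\<Oplus>a\<in>{..<r}. \<zeta> [^] (m * a)) = (if r dvd m then \<one> else \<zero>)"
begin

lemma \<zeta>_pow_add_mult: "\<zeta> [^] (a + r * b) = \<zeta> [^] (a :: nat)"
proof -
  have "\<zeta> [^] (a + r * b) = \<zeta> [^] a \<otimes> (\<zeta> [^] r) [^] b"
    by (simp add: nat_pow_mult nat_pow_pow)
  then show ?thesis
    by (simp add: \<zeta>_pow_r)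
qed

text \<open>Both sides are \<open>\<zeta>\<close> to the power -ka, represented with nonnegative
  exponents. The exchange decides which of the two variables is a factor of the exponent, as
  \<open>orthogonality\<close> requires of the summation index.\<close>

lemma \<zeta>_pow_diff_swap:
  assumes "a \<le> r" "k \<le> r"
  shows "\<zeta> [^] ((r - k) * a) = \<zeta> [^] ((r - a) * k)"
proof -
  have "(r - k) * a + r * k = (r - a) * k + r * a"
    using assms by (simp add: diff_mult_distrib algebra_simps)
  then show ?thesis
    by (metis \<zeta>_pow_add_mult)
qed

end

locale spectral_algebra = root_of_unity R r \<zeta> \<rho> + A: assoc_algebra R A
  for R (structure) and A (structure) and r \<zeta> \<rho>
begin

lemma eigen_orthogonal:
  assumes x: "x \<in> carrier A" and y: "y \<in> carrier A" and t: "t \<in> carrier A"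
    and kl: "k < r" "l < r" "k \<noteq> l"
    and xt: "x \<otimes>\<^bsub>A\<^esub> t = \<zeta> [^] k \<odot>\<^bsub>A\<^esub> x" and ty: "t \<otimes>\<^bsub>A\<^esub> y = \<zeta> [^] l \<odot>\<^bsub>A\<^esub> y"
  shows "x \<otimes>\<^bsub>A\<^esub> y = \<zero>\<^bsub>A\<^esub>"
proof -
  let ?z = "x \<otimes>\<^bsub>A\<^esub> y"
  define m where "m = l + (r - k)"
  have z: "?z \<in> carrier A"
    using x y by simp
  have "\<zeta> [^] k \<odot>\<^bsub>A\<^esub> ?z = (x \<otimes>\<^bsub>A\<^esub> t) \<otimes>\<^bsub>A\<^esub> y"
    using x y xt by (simp add: A.smult_mult_left)
  also have "\<dots> = x \<otimes>\<^bsub>A\<^esub> (\<zeta> [^] l \<odot>\<^bsub>A\<^esub> y)"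
    using x y t ty by (simp add: A.A.m_assoc)
  also have "\<dots> = \<zeta> [^] l \<odot>\<^bsub>A\<^esub> ?z"
    using x y by (simp add: A.smult_mult_right)
  \<comment> \<open>Multiplication by \<open>\<zeta> [^] (r - k)\<close> undoes
    \<open>\<zeta> [^] k\<close>, because the exponents add up to \<open>r\<close>.\<close>
  finally have "\<zeta> [^] (r - k) \<odot>\<^bsub>A\<^esub> (\<zeta> [^] k \<odot>\<^bsub>A\<^esub> ?z) = \<zeta> [^] (r - k) \<odot>\<^bsub>A\<^esub> (\<zeta> [^] l \<odot>\<^bsub>A\<^esub> ?z)"
    by simp
  then have step: "?z = \<zeta> [^] m \<odot>\<^bsub>A\<^esub> ?z"
    using z kl by (simp add: A.smult_assoc1[symmetric] nat_pow_mult m_def \<zeta>_pow_r add.commute)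
  have pow: "?z = \<zeta> [^] (m * a) \<odot>\<^bsub>A\<^esub> ?z" for a :: nat
  proof (induction a)
    case 0
    then show ?case using z by simp
  next
    case (Suc a)
    have "\<zeta> [^] (m * Suc a) \<odot>\<^bsub>A\<^esub> ?z = \<zeta> [^] m \<odot>\<^bsub>A\<^esub> (\<zeta> [^] (m * a) \<odot>\<^bsub>A\<^esub> ?z)"
      using z by (simp add: A.smult_assoc1[symmetric] nat_pow_mult)
    then show ?case
      using Suc step by simp
  qed
  have "\<not> r dvd m"
    unfolding m_def dvd_add_diff_iff[OF kl(2,1)] using kl(3) by simp
  \<comment> \<open>\<open>?z\<close> is the average of \<open>r\<close> copies of itself, by
    \<open>orthogonality\<close> at exponent 0. Replacing the a-th copy by its equal multiple with
    \<open>\<zeta> [^] (m * a)\<close> turns the coefficient into a character sum that vanishes.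
    This takes the place of cancelling \<open>\<one> \<ominus> \<zeta> [^] m\<close>.\<close>
  have "?z = (\<rho> \<otimes> (\<Oplus>a\<in>{..<r}. \<zeta> [^] (0 * a))) \<odot>\<^bsub>A\<^esub> ?z"
    unfolding orthogonality using z by simp
  also have "\<dots> = \<rho> \<odot>\<^bsub>A\<^esub> (\<Oplus>\<^bsub>A\<^esub>a\<in>{..<r}. ?z)"
    using z by (simp add: A.smult_assoc1 A.finsum_smult_rdistr)
  also have "(\<Oplus>\<^bsub>A\<^esub>a\<in>{..<r}. ?z) = (\<Oplus>\<^bsub>A\<^esub>a\<in>{..<r}. \<zeta> [^] (m * a) \<odot>\<^bsub>A\<^esub> ?z)"
    using pow by simp
  also have "\<rho> \<odot>\<^bsub>A\<^esub> \<dots> = (\<rho> \<otimes> (\<Oplus>a\<in>{..<r}. \<zeta> [^] (m * a))) \<odot>\<^bsub>A\<^esub> ?z"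
    using z by (simp add: A.smult_assoc1 A.finsum_smult_rdistr)
  also have "\<dots> = \<zero>\<^bsub>A\<^esub>"
    unfolding orthogonality using \<open>\<not> r dvd m\<close> z by simp
  finally show ?thesis .
qed

definition eigenprojection :: "_ \<Rightarrow> nat \<Rightarrow> _" where
  "eigenprojection t k = (\<Oplus>\<^bsub>A\<^esub>a\<in>{..<r}. (\<rho> \<otimes> \<zeta> [^] ((r - k) * a)) \<odot>\<^bsub>A\<^esub> (t [^]\<^bsub>A\<^esub> a))"

lemma eigenprojection_closed: "t \<in> carrier A \<Longrightarrow> eigenprojection t k \<in> carrier A"
  unfolding eigenprojection_def by (intro A.M.finsum_closed) auto

lemma eigenprojection_commute:
  assumes "t \<in> carrier A" "x \<in> carrier A" "x \<otimes>\<^bsub>A\<^esub> t = t \<otimes>\<^bsub>A\<^esub> x"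
  shows "x \<otimes>\<^bsub>A\<^esub> eigenprojection t k = eigenprojection t k \<otimes>\<^bsub>A\<^esub> x"
proof -
  let ?c = "\<lambda>a. \<rho> \<otimes> \<zeta> [^] ((r - k) * a)"
  have "x \<otimes>\<^bsub>A\<^esub> eigenprojection t k = (\<Oplus>\<^bsub>A\<^esub>a\<in>{..<r}. x \<otimes>\<^bsub>A\<^esub> (?c a \<odot>\<^bsub>A\<^esub> t [^]\<^bsub>A\<^esub> a))"
    unfolding eigenprojection_def using assms by (intro A.A.finsum_rdistr) auto
  also have "\<dots> = (\<Oplus>\<^bsub>A\<^esub>a\<in>{..<r}. (?c a \<odot>\<^bsub>A\<^esub> t [^]\<^bsub>A\<^esub> a) \<otimes>\<^bsub>A\<^esub> x)"
    using assms by (intro A.M.finsum_cong')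
      (simp_all add: A.smult_mult_left A.smult_mult_right A.A.commute_nat_pow)
  also have "\<dots> = eigenprojection t k \<otimes>\<^bsub>A\<^esub> x"
    unfolding eigenprojection_def using assms by (intro A.A.finsum_ldistr[symmetric]) auto
  finally show ?thesis .
qed

text \<open>Multiplication by \<open>t\<close> sends the a-th summand to
  \<open>\<zeta> [^] k\<close> times the next one. The summands at \<open>r\<close> and at 0
  coincide, so this shift only permutes the sum cyclically.\<close>

lemma eigenprojection_eigen:
  assumes t: "t \<in> carrier A" "t [^]\<^bsub>A\<^esub> r = \<one>\<^bsub>A\<^esub>" and k: "k < r"
  shows "t \<otimes>\<^bsub>A\<^esub> eigenprojection t k = \<zeta> [^] k \<odot>\<^bsub>A\<^esub> eigenprojection t k"
proof -
  define h where "h a = (\<rho> \<otimes> \<zeta> [^] ((r - k) * a)) \<odot>\<^bsub>A\<^esub> (t [^]\<^bsub>A\<^esub> a)" for a :: nat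
  have h: "h a \<in> carrier A" for a
    using t by (simp add: h_def)
  have shift: "t \<otimes>\<^bsub>A\<^esub> h a = \<zeta> [^] k \<odot>\<^bsub>A\<^esub> h (Suc a)" for a
  proof -
    have "\<zeta> [^] k \<otimes> (\<rho> \<otimes> \<zeta> [^] ((r - k) * Suc a)) = \<rho> \<otimes> (\<zeta> [^] k \<otimes> \<zeta> [^] ((r - k) * Suc a))"
      by (rule m_lcomm) auto
    also have "\<zeta> [^] k \<otimes> \<zeta> [^] ((r - k) * Suc a) = \<zeta> [^] (k + (r - k) * Suc a)"
      by (simp only: nat_pow_mult \<zeta>_closed)
    also have "k + (r - k) * Suc a = (r - k) * a + r * 1"
      using k by simp
    also have "\<zeta> [^] ((r - k) * a + r * 1) = \<zeta> [^] ((r - k) * a)"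
      by (rule \<zeta>_pow_add_mult)
    finally have coeff: "\<zeta> [^] k \<otimes> (\<rho> \<otimes> \<zeta> [^] ((r - k) * Suc a)) = \<rho> \<otimes> \<zeta> [^] ((r - k) * a)" .
    have "t \<otimes>\<^bsub>A\<^esub> h a = (\<rho> \<otimes> \<zeta> [^] ((r - k) * a)) \<odot>\<^bsub>A\<^esub> (t [^]\<^bsub>A\<^esub> Suc a)"
      using t A.A.commute_nat_pow[of t t a] by (simp add: h_def A.smult_mult_right)
    also have "\<dots> = \<zeta> [^] k \<odot>\<^bsub>A\<^esub> h (Suc a)"
      unfolding h_def coeff[symmetric] using t by (intro A.smult_assoc1) auto
    finally show ?thesis .
  qed
  have "h r = h 0"
    using t \<zeta>_pow_add_mult[of 0 "r - k"] by (simp add: h_def mult.commute)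
  then have "(\<Oplus>\<^bsub>A\<^esub>a\<in>{..<r}. h (Suc a)) = (\<Oplus>\<^bsub>A\<^esub>a\<in>{..<r}. h a)"
  proof -
    have "r = Suc (r - 1)"
      using r_pos by simp
    then obtain r' where r': "r = Suc r'" ..
    have "(\<Oplus>\<^bsub>A\<^esub>a\<in>{..<r}. h (Suc a)) = (\<Oplus>\<^bsub>A\<^esub>a\<in>{..<r'}. h (Suc a)) \<oplus>\<^bsub>A\<^esub> h r"
      using h by (simp add: r' lessThan_Suc A.M.a_comm)
    also have "\<dots> = (\<Oplus>\<^bsub>A\<^esub>a\<in>Suc ` {..<r'}. h a) \<oplus>\<^bsub>A\<^esub> h 0"
      using h \<open>h r = h 0\<close> by (simp add: A.M.finsum_reindex)
    also have "\<dots> = (\<Oplus>\<^bsub>A\<^esub>a\<in>insert 0 (Suc ` {..<r'}). h a)"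
      using h by (simp add: A.M.a_comm)
    also have "insert 0 (Suc ` {..<r'}) = {..<r}"
      unfolding r' by (rule lessThan_Suc_eq_insert_0[symmetric])
    finally show ?thesis .
  qed
  then have "\<zeta> [^] k \<odot>\<^bsub>A\<^esub> eigenprojection t k = \<zeta> [^] k \<odot>\<^bsub>A\<^esub> (\<Oplus>\<^bsub>A\<^esub>a\<in>{..<r}. h (Suc a))"
    by (simp add: eigenprojection_def h_def[symmetric])
  also have "\<dots> = (\<Oplus>\<^bsub>A\<^esub>a\<in>{..<r}. \<zeta> [^] k \<odot>\<^bsub>A\<^esub> h (Suc a))"
    using h by (intro A.finsum_smult_ldistr) auto
  also have "\<dots> = t \<otimes>\<^bsub>A\<^esub> eigenprojection t k"
    unfolding eigenprojection_def h_def[symmetric] shift[symmetric]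
    using h t by (intro A.A.finsum_rdistr[symmetric]) auto
  finally show ?thesis ..
qed

text \<open>After exchanging the sums, the coefficient of the a-th power of \<open>t\<close> is the
  average over \<open>k\<close> of \<open>\<zeta>\<close> to the power -ka. This is
  \<open>orthogonality\<close> with \<open>m = r - a\<close>, nonzero for \<open>a = 0\<close>
  only.\<close>

lemma eigenprojection_sum:
  assumes t: "t \<in> carrier A"
  shows "(\<Oplus>\<^bsub>A\<^esub>k\<in>{..<r}. eigenprojection t k) = \<one>\<^bsub>A\<^esub>"
proof -
  have "(\<Oplus>\<^bsub>A\<^esub>k\<in>{..<r}. eigenprojection t k) =
      (\<Oplus>\<^bsub>A\<^esub>a\<in>{..<r}. \<Oplus>\<^bsub>A\<^esub>k\<in>{..<r}. (\<rho> \<otimes> \<zeta> [^] ((r - k) * a)) \<odot>\<^bsub>A\<^esub> (t [^]\<^bsub>A\<^esub> a))"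
    unfolding eigenprojection_def using t by (intro A.M.finsum_swap) auto
  also have "\<dots> = (\<Oplus>\<^bsub>A\<^esub>a\<in>{..<r}. if 0 = a then \<one>\<^bsub>A\<^esub> else \<zero>\<^bsub>A\<^esub>)"
  proof (intro A.M.finsum_cong')
    fix a
    assume a: "a \<in> {..<r}"
    have "(\<Oplus>\<^bsub>A\<^esub>k\<in>{..<r}. (\<rho> \<otimes> \<zeta> [^] ((r - k) * a)) \<odot>\<^bsub>A\<^esub> (t [^]\<^bsub>A\<^esub> a)) =
        (\<Oplus>k\<in>{..<r}. \<rho> \<otimes> \<zeta> [^] ((r - k) * a)) \<odot>\<^bsub>A\<^esub> (t [^]\<^bsub>A\<^esub> a)"
      using t by (intro A.finsum_smult_rdistr[symmetric]) auto
    also have "(\<Oplus>k\<in>{..<r}. \<rho> \<otimes> \<zeta> [^] ((r - k) * a)) = (\<Oplus>k\<in>{..<r}. \<rho> \<otimes> \<zeta> [^] ((r - a) * k))"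
      using a by (intro finsum_cong') (auto simp: \<zeta>_pow_diff_swap)
    also have "\<dots> = \<rho> \<otimes> (\<Oplus>k\<in>{..<r}. \<zeta> [^] ((r - a) * k))"
      by (intro finsum_rdistr[symmetric]) auto
    also have "\<dots> = (if 0 = a then \<one> else \<zero>)"
      unfolding orthogonality using a r_pos by (auto dest: dvd_imp_le)
    finally show "(\<Oplus>\<^bsub>A\<^esub>k\<in>{..<r}. (\<rho> \<otimes> \<zeta> [^] ((r - k) * a)) \<odot>\<^bsub>A\<^esub> (t [^]\<^bsub>A\<^esub> a)) =
        (if 0 = a then \<one>\<^bsub>A\<^esub> else \<zero>\<^bsub>A\<^esub>)"
      using t by auto
  qed auto
  also have "\<dots> = \<one>\<^bsub>A\<^esub>"
    using r_pos A.M.finsum_singleton[of 0 "{..<r}" "\<lambda>_. \<one>\<^bsub>A\<^esub>"] by simp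
  finally show ?thesis .
qed

text \<open>
  The induction multiplies a joint eigenprojection for \<open>J'\<close>, extended to a new index \<open>i\<close>, by an
  eigenprojection of \<open>t i\<close>. Commutation with all of \<open>J\<close> is carried along for this purpose.
\<close>
lemma joint_eigenprojections:
  assumes J: "finite J" and t: "\<And>j. j \<in> J \<Longrightarrow> t j \<in> carrier A"
    and pow: "\<And>j. j \<in> J \<Longrightarrow> t j [^]\<^bsub>A\<^esub> r = \<one>\<^bsub>A\<^esub>"
    and comm: "\<And>i j. i \<in> J \<Longrightarrow> j \<in> J \<Longrightarrow> t i \<otimes>\<^bsub>A\<^esub> t j = t j \<otimes>\<^bsub>A\<^esub> t i"
    and J': "J' \<subseteq> J"
  shows "\<exists>F. (\<forall>p\<in>PiE J' (\<lambda>_. {..<r}). F p \<in> carrier A \<and>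
        (\<forall>j\<in>J. F p \<otimes>\<^bsub>A\<^esub> t j = t j \<otimes>\<^bsub>A\<^esub> F p) \<and> (\<forall>j\<in>J'. t j \<otimes>\<^bsub>A\<^esub> F p = \<zeta> [^] p j \<odot>\<^bsub>A\<^esub> F p)) \<and>
      (\<Oplus>\<^bsub>A\<^esub>p\<in>PiE J' (\<lambda>_. {..<r}). F p) = \<one>\<^bsub>A\<^esub>"
  using finite_subset[OF J' J] J'
proof (induction J' rule: finite_induct)
  case empty
  then show ?case
    using t by (intro exI[of _ "\<lambda>_. \<one>\<^bsub>A\<^esub>"]) auto
next
  case (insert i J')
  let ?P = "PiE J' (\<lambda>_. {..<r})" and ?P' = "PiE (insert i J') (\<lambda>_. {..<r})"
  let ?u = "eigenprojection (t i)"
  have "J' \<subseteq> J"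
    using insert.prems by simp
  from insert.IH[OF this] obtain F where
    IH: "\<forall>p\<in>?P. F p \<in> carrier A \<and> (\<forall>j\<in>J. F p \<otimes>\<^bsub>A\<^esub> t j = t j \<otimes>\<^bsub>A\<^esub> F p) \<and>
      (\<forall>j\<in>J'. t j \<otimes>\<^bsub>A\<^esub> F p = \<zeta> [^] p j \<odot>\<^bsub>A\<^esub> F p)"
    and F_sum: "(\<Oplus>\<^bsub>A\<^esub>p\<in>?P. F p) = \<one>\<^bsub>A\<^esub>"
    by (elim exE conjE)
  have F: "F p \<in> carrier A" if "p \<in> ?P" for p
    using IH that by blast
  have F_comm: "F p \<otimes>\<^bsub>A\<^esub> t j = t j \<otimes>\<^bsub>A\<^esub> F p" if "p \<in> ?P" "j \<in> J" for p j
    using IH that by blast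
  have F_eigen: "t j \<otimes>\<^bsub>A\<^esub> F p = \<zeta> [^] p j \<odot>\<^bsub>A\<^esub> F p" if "p \<in> ?P" "j \<in> J'" for p j
    using IH that by blast
  have i: "i \<in> J" "i \<notin> J'" and finP: "finite ?P"
    using insert by (auto intro: finite_PiE)
  have u: "?u k \<in> carrier A" for k
    using i t by (intro eigenprojection_closed)
  have u_comm: "t j \<otimes>\<^bsub>A\<^esub> ?u k = ?u k \<otimes>\<^bsub>A\<^esub> t j" if "j \<in> J" for j k
    using i t that comm by (intro eigenprojection_commute)
  \<comment> \<open>Members of \<open>PiE\<close> are \<open>undefined\<close> outside their domain,
    so resetting the value at \<open>i\<close> restricts \<open>p\<close> to
    \<open>J'\<close>.\<close>
  define F' where "F' p = F (p(i := undefined)) \<otimes>\<^bsub>A\<^esub> ?u (p i)" for p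
  have restr: "p(i := undefined) \<in> ?P" if "p \<in> ?P'" for p
    using that i by (auto simp: PiE_def Pi_def extensional_def)
  have update: "(p(i := k))(i := undefined) = p" if "p \<in> ?P" for p k
    using that i by (auto simp: PiE_def extensional_def)
  have F'_closed: "F' p \<in> carrier A" if "p \<in> ?P'" for p
    unfolding F'_def using F[OF restr[OF that]] u by simp
  have F'_comm: "F' p \<otimes>\<^bsub>A\<^esub> t j = t j \<otimes>\<^bsub>A\<^esub> F' p" if p: "p \<in> ?P'" and j: "j \<in> J" for p j
  proof -
    let ?x = "F (p(i := undefined))"
    have "(?x \<otimes>\<^bsub>A\<^esub> ?u (p i)) \<otimes>\<^bsub>A\<^esub> t j = ?x \<otimes>\<^bsub>A\<^esub> (t j \<otimes>\<^bsub>A\<^esub> ?u (p i))"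
      using F[OF restr[OF p]] u t j by (simp add: u_comm A.A.m_assoc)
    also have "\<dots> = (?x \<otimes>\<^bsub>A\<^esub> t j) \<otimes>\<^bsub>A\<^esub> ?u (p i)"
      using F[OF restr[OF p]] u t j by (simp add: A.A.m_assoc)
    also have "\<dots> = t j \<otimes>\<^bsub>A\<^esub> (?x \<otimes>\<^bsub>A\<^esub> ?u (p i))"
      using F[OF restr[OF p]] u t j by (simp add: F_comm restr p A.A.m_assoc)
    finally show ?thesis
      unfolding F'_def .
  qed
  have F'_eigen: "t j \<otimes>\<^bsub>A\<^esub> F' p = \<zeta> [^] p j \<odot>\<^bsub>A\<^esub> F' p" if p: "p \<in> ?P'" and j: "j \<in> insert i J'" for p j
  proof -
    define x where "x = F (p(i := undefined))"
    have F'_p: "F' p = x \<otimes>\<^bsub>A\<^esub> ?u (p i)"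
      by (simp only: F'_def x_def)
    have jJ: "j \<in> J"
      using j insert.prems by auto
    have x: "x \<in> carrier A" and tj: "t j \<in> carrier A"
      using F[OF restr[OF p]] t[OF jJ] by (simp_all only: x_def)
    have x_comm: "x \<otimes>\<^bsub>A\<^esub> t j = t j \<otimes>\<^bsub>A\<^esub> x"
      unfolding x_def by (rule F_comm[OF restr[OF p] jJ])
    show ?thesis
    proof (cases "j = i")
      case True
      have "t j \<otimes>\<^bsub>A\<^esub> F' p = (x \<otimes>\<^bsub>A\<^esub> t j) \<otimes>\<^bsub>A\<^esub> ?u (p i)"
        using x u tj by (simp add: F'_p x_comm A.A.m_assoc)
      also have "\<dots> = x \<otimes>\<^bsub>A\<^esub> (t i \<otimes>\<^bsub>A\<^esub> ?u (p i))"
        using x u tj True by (simp add: A.A.m_assoc)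
      also have "t i \<otimes>\<^bsub>A\<^esub> ?u (p i) = \<zeta> [^] p i \<odot>\<^bsub>A\<^esub> ?u (p i)"
        using p i t pow by (intro eigenprojection_eigen) auto
      finally show ?thesis
        using x u True by (simp add: F'_p A.smult_mult_right)
    next
      case False
      have "t j \<otimes>\<^bsub>A\<^esub> F' p = (t j \<otimes>\<^bsub>A\<^esub> x) \<otimes>\<^bsub>A\<^esub> ?u (p i)"
        using x u tj by (simp add: F'_p A.A.m_assoc)
      also have "t j \<otimes>\<^bsub>A\<^esub> x = \<zeta> [^] p j \<odot>\<^bsub>A\<^esub> x"
        unfolding x_def using F_eigen[OF restr[OF p], of j] j False by simp
      finally show ?thesis
        using x u by (simp add: F'_p A.smult_mult_left)
    qed
  qed
  \<comment> \<open>Split the index functions by their value \<open>k\<close> at \<open>i\<close>.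
    By the induction hypothesis the inner sum collapses to the k-th eigenprojection of
    \<open>t i\<close>, and these add up to one.\<close>
  have "?P' = (\<Union>k\<in>{..<r}. (\<lambda>p. p(i := k)) ` ?P)"
    unfolding PiE_insert_eq by auto
  then have "(\<Oplus>\<^bsub>A\<^esub>p\<in>?P'. F' p) = finsum A F' (\<Union>k\<in>{..<r}. (\<lambda>p. p(i := k)) ` ?P)"
    by simp
  also have "\<dots> = (\<Oplus>\<^bsub>A\<^esub>k\<in>{..<r}. \<Oplus>\<^bsub>A\<^esub>p\<in>(\<lambda>p. p(i := k)) ` ?P. F' p)"
  proof (intro A.M.add.finprod_UN_disjoint)
    show "pairwise (\<lambda>k l. disjnt ((\<lambda>p. p(i := k)) ` ?P) ((\<lambda>p. p(i := l)) ` ?P)) {..<r}"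
      by (intro pairwiseI) (auto simp: disjnt_iff dest!: fun_cong[where x = i])
    show "F' q \<in> carrier A" if "k \<in> {..<r}" "q \<in> (\<lambda>p. p(i := k)) ` ?P" for k q
      using that by (intro F'_closed) (auto simp: PiE_insert_eq)
  qed (use finP in auto)
  also have "\<dots> = (\<Oplus>\<^bsub>A\<^esub>k\<in>{..<r}. ?u k)"
  proof (intro A.M.finsum_cong')
    fix k
    assume k: "k \<in> {..<r}"
    have inj: "inj_on (\<lambda>p. p(i := k)) ?P"
      using update by (metis (mono_tags, lifting) inj_onI)
    have sub: "(\<lambda>p. p(i := k)) ` ?P \<subseteq> ?P'"
      using k by (auto simp: PiE_insert_eq)
    have "(\<Oplus>\<^bsub>A\<^esub>p\<in>(\<lambda>p. p(i := k)) ` ?P. F' p) = (\<Oplus>\<^bsub>A\<^esub>p\<in>?P. F' (p(i := k)))"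
      by (rule A.M.finsum_reindex[OF funcsetI inj], rule F'_closed, erule subsetD[OF sub])
    also have "\<dots> = (\<Oplus>\<^bsub>A\<^esub>p\<in>?P. F p \<otimes>\<^bsub>A\<^esub> ?u k)"
      using F u by (intro A.M.finsum_cong') (simp_all only: F'_def update fun_upd_same, simp_all)
    also have "\<dots> = \<one>\<^bsub>A\<^esub> \<otimes>\<^bsub>A\<^esub> ?u k"
      unfolding F_sum[symmetric] using F u finP by (intro A.A.finsum_ldistr[symmetric]) auto
    finally show "(\<Oplus>\<^bsub>A\<^esub>p\<in>(\<lambda>p. p(i := k)) ` ?P. F' p) = ?u k"
      using u by simp
  qed (use u in auto)
  also have "\<dots> = \<one>\<^bsub>A\<^esub>"
    using i t by (intro eigenprojection_sum)
  finally show ?case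
    using F'_closed F'_comm F'_eigen by (intro exI[of _ F'] conjI ballI)
qed

end

text \<open>The structure shared by both algebras: a partition of unity into joint left and right
  eigenvectors. Idempotency and orthogonality are derived. Eigenvalues are recorded as exponents
  below \<open>r\<close>, so \<open>p_inj\<close> separates indices even if some \<open>f s\<close>
  vanish.\<close>

locale spectral_family = spectral_algebra R A r \<zeta> \<rho>
  for R (structure) and A (structure) and r \<zeta> \<rho> +
  fixes S :: "'s set" and J :: "'j set" and p :: "'s \<Rightarrow> 'j \<Rightarrow> nat" and f and t
  assumes finite_S: "finite S"
    and f_closed: "s \<in> S \<Longrightarrow> f s \<in> carrier A"
    and t_closed: "j \<in> J \<Longrightarrow> t j \<in> carrier A"
    and f_sum: "(\<Oplus>\<^bsub>A\<^esub>s\<in>S. f s) = \<one>\<^bsub>A\<^esub>"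
    and t_f: "s \<in> S \<Longrightarrow> j \<in> J \<Longrightarrow> t j \<otimes>\<^bsub>A\<^esub> f s = \<zeta> [^] p s j \<odot>\<^bsub>A\<^esub> f s"
    and f_t: "s \<in> S \<Longrightarrow> j \<in> J \<Longrightarrow> f s \<otimes>\<^bsub>A\<^esub> t j = \<zeta> [^] p s j \<odot>\<^bsub>A\<^esub> f s"
    and p_less: "s \<in> S \<Longrightarrow> j \<in> J \<Longrightarrow> p s j < r"
    and p_inj: "s \<in> S \<Longrightarrow> s' \<in> S \<Longrightarrow> (\<And>j. j \<in> J \<Longrightarrow> p s j = p s' j) \<Longrightarrow> s = s'"
begin

lemma decompose_right: "x \<in> carrier A \<Longrightarrow> x = (\<Oplus>\<^bsub>A\<^esub>s\<in>S. x \<otimes>\<^bsub>A\<^esub> f s)"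
  using A.A.finsum_rdistr[of S x f] finite_S f_closed by (simp add: f_sum Pi_iff)

lemma decompose_left: "x \<in> carrier A \<Longrightarrow> x = (\<Oplus>\<^bsub>A\<^esub>s\<in>S. f s \<otimes>\<^bsub>A\<^esub> x)"
  using A.A.finsum_ldistr[of S x f] finite_S f_closed by (simp add: f_sum Pi_iff)

text \<open>The \<open>f s\<close> sum to one, so it suffices to test on each of them. There the
  \<open>t j\<close> act by scalars, which reduces identities between the \<open>t j\<close> to
  identities in \<open>R\<close>.\<close>

lemma eqI:
  assumes "x \<in> carrier A" "y \<in> carrier A" "\<And>s. s \<in> S \<Longrightarrow> x \<otimes>\<^bsub>A\<^esub> f s = y \<otimes>\<^bsub>A\<^esub> f s"
  shows "x = y"
proof -
  have "x = (\<Oplus>\<^bsub>A\<^esub>s\<in>S. x \<otimes>\<^bsub>A\<^esub> f s)"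
    using assms(1) by (rule decompose_right)
  also have "\<dots> = (\<Oplus>\<^bsub>A\<^esub>s\<in>S. y \<otimes>\<^bsub>A\<^esub> f s)"
    using assms f_closed by (intro A.M.finsum_cong') auto
  also have "\<dots> = y"
    using assms(2) by (rule decompose_right[symmetric])
  finally show ?thesis .
qed

lemma finsum_only:
  assumes "s \<in> S" "\<And>s. s \<in> S \<Longrightarrow> h s \<in> carrier A" "\<And>s'. s' \<in> S \<Longrightarrow> s' \<noteq> s \<Longrightarrow> h s' = \<zero>\<^bsub>A\<^esub>"
  shows "(\<Oplus>\<^bsub>A\<^esub>s\<in>S. h s) = h s"
proof -
  have "(\<Oplus>\<^bsub>A\<^esub>s\<in>S. h s) = (\<Oplus>\<^bsub>A\<^esub>s'\<in>S. if s = s' then h s' else \<zero>\<^bsub>A\<^esub>)"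
    using assms by (intro A.M.finsum_cong') auto
  also have "\<dots> = h s"
    using assms finite_S by (intro A.M.finsum_singleton) auto
  finally show ?thesis .
qed

text \<open>
  \<open>y\<close> need not be a member of the family: this also compares two families with the same eigenvalues.
\<close>
lemma f_orthogonal:
  assumes s: "s \<in> S" "s' \<in> S" "s \<noteq> s'" and y: "y \<in> carrier A"
    and ty: "\<And>j. j \<in> J \<Longrightarrow> t j \<otimes>\<^bsub>A\<^esub> y = \<zeta> [^] p s' j \<odot>\<^bsub>A\<^esub> y"
  shows "f s \<otimes>\<^bsub>A\<^esub> y = \<zero>\<^bsub>A\<^esub>"
proof -
  obtain j where "j \<in> J" "p s j \<noteq> p s' j"
    using p_inj s by blast
  then show ?thesis
    using s y ty by (intro eigen_orthogonal[of _ _ "t j" "p s j" "p s' j"])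
      (auto simp: f_closed t_closed p_less f_t)
qed

text \<open>Idempotency comes from orthogonality: expanding the unit in \<open>f s\<close> times one
  leaves only the diagonal term.\<close>

lemma f_mult_f:
  assumes "s \<in> S" "s' \<in> S"
  shows "f s \<otimes>\<^bsub>A\<^esub> f s' = (if s = s' then f s else \<zero>\<^bsub>A\<^esub>)"
proof -
  have zero: "f s \<otimes>\<^bsub>A\<^esub> f s' = \<zero>\<^bsub>A\<^esub>" if "s \<in> S" "s' \<in> S" "s \<noteq> s'" for s s'
    using that by (intro f_orthogonal[of s s']) (auto simp: f_closed t_f)
  have "f s = (\<Oplus>\<^bsub>A\<^esub>s'\<in>S. f s \<otimes>\<^bsub>A\<^esub> f s')"
    using assms by (intro decompose_right f_closed)
  also have "\<dots> = f s \<otimes>\<^bsub>A\<^esub> f s"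
    using assms zero by (intro finsum_only) (auto simp: f_closed)
  finally show ?thesis
    using zero assms by auto
qed

lemma t_eq_sum:
  assumes j: "j \<in> J"
  shows "t j = (\<Oplus>\<^bsub>A\<^esub>s\<in>S. \<zeta> [^] p s j \<odot>\<^bsub>A\<^esub> f s)"
proof -
  have "t j = (\<Oplus>\<^bsub>A\<^esub>s\<in>S. t j \<otimes>\<^bsub>A\<^esub> f s)"
    using j by (intro decompose_right t_closed)
  also have "\<dots> = (\<Oplus>\<^bsub>A\<^esub>s\<in>S. \<zeta> [^] p s j \<odot>\<^bsub>A\<^esub> f s)"
    using j by (intro A.M.finsum_cong') (auto simp: f_closed t_f)
  finally show ?thesis .
qed

lemma t_pow_f:
  assumes "s \<in> S" "j \<in> J"
  shows "t j [^]\<^bsub>A\<^esub> (a::nat) \<otimes>\<^bsub>A\<^esub> f s = \<zeta> [^] (p s j * a) \<odot>\<^bsub>A\<^esub> f s"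
proof (induction a)
  case 0
  then show ?case using assms by (simp add: f_closed)
next
  case (Suc a)
  have "t j [^]\<^bsub>A\<^esub> Suc a \<otimes>\<^bsub>A\<^esub> f s = t j [^]\<^bsub>A\<^esub> a \<otimes>\<^bsub>A\<^esub> (t j \<otimes>\<^bsub>A\<^esub> f s)"
    using assms by (simp add: f_closed t_closed A.A.m_assoc)
  also have "\<dots> = \<zeta> [^] p s j \<odot>\<^bsub>A\<^esub> (\<zeta> [^] (p s j * a) \<odot>\<^bsub>A\<^esub> f s)"
    using assms by (simp add: t_f A.smult_mult_right f_closed t_closed Suc)
  also have "\<dots> = \<zeta> [^] (p s j * Suc a) \<odot>\<^bsub>A\<^esub> f s"
    using assms by (simp add: A.smult_assoc1[symmetric] f_closed nat_pow_mult)
  finally show ?case .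
qed

lemma t_pow_r:
  assumes "j \<in> J"
  shows "t j [^]\<^bsub>A\<^esub> r = \<one>\<^bsub>A\<^esub>"
proof (rule eqI)
  fix s
  assume "s \<in> S"
  then show "t j [^]\<^bsub>A\<^esub> r \<otimes>\<^bsub>A\<^esub> f s = \<one>\<^bsub>A\<^esub> \<otimes>\<^bsub>A\<^esub> f s"
    using assms \<zeta>_pow_add_mult[of 0 "p s j"] by (simp add: t_pow_f f_closed mult.commute)
qed (use assms t_closed in auto)

lemma t_commute:
  assumes "i \<in> J" "j \<in> J"
  shows "t i \<otimes>\<^bsub>A\<^esub> t j = t j \<otimes>\<^bsub>A\<^esub> t i"
proof (rule eqI)
  fix s
  assume "s \<in> S"
  then show "(t i \<otimes>\<^bsub>A\<^esub> t j) \<otimes>\<^bsub>A\<^esub> f s = (t j \<otimes>\<^bsub>A\<^esub> t i) \<otimes>\<^bsub>A\<^esub> f s"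
    using assms by (simp add: t_closed f_closed A.A.m_assoc t_f A.smult_mult_right
        A.smult_assoc1[symmetric] m_comm)
qed (use assms t_closed in auto)

text \<open>For \<open>j = i + 1\<close> the left side is \<open>e_i\<close>. On \<open>f s\<close>
  it acts by the average of the powers of \<open>\<zeta>\<close> to the difference of the two
  exponents, which is one if they agree and zero otherwise. This is the link between the quadratic
  relations.\<close>

lemma average_eq_sum:
  assumes i: "i \<in> J" and j: "j \<in> J"
  shows "\<rho> \<odot>\<^bsub>A\<^esub> (\<Oplus>\<^bsub>A\<^esub>a\<in>{..<r}. t i [^]\<^bsub>A\<^esub> a \<otimes>\<^bsub>A\<^esub> t j [^]\<^bsub>A\<^esub> (r - a)) =
    (\<Oplus>\<^bsub>A\<^esub>s\<in>S. if p s i = p s j then f s else \<zero>\<^bsub>A\<^esub>)"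
proof -
  let ?E = "\<Oplus>\<^bsub>A\<^esub>a\<in>{..<r}. t i [^]\<^bsub>A\<^esub> a \<otimes>\<^bsub>A\<^esub> t j [^]\<^bsub>A\<^esub> (r - a)"
  have E: "?E \<in> carrier A"
    using assms by (intro A.M.finsum_closed) (auto simp: t_closed)
  have "(\<rho> \<odot>\<^bsub>A\<^esub> ?E) \<otimes>\<^bsub>A\<^esub> f s = (if p s i = p s j then f s else \<zero>\<^bsub>A\<^esub>)" if s: "s \<in> S" for s
  proof -
    define m where "m = p s i + (r - p s j)"
    have less: "p s i < r" "p s j < r"
      using s i j by (auto simp: p_less)
    have summand: "(t i [^]\<^bsub>A\<^esub> a \<otimes>\<^bsub>A\<^esub> t j [^]\<^bsub>A\<^esub> (r - a)) \<otimes>\<^bsub>A\<^esub> f s = \<zeta> [^] (m * a) \<odot>\<^bsub>A\<^esub> f s"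
      if "a < r" for a
    proof -
      have "(t i [^]\<^bsub>A\<^esub> a \<otimes>\<^bsub>A\<^esub> t j [^]\<^bsub>A\<^esub> (r - a)) \<otimes>\<^bsub>A\<^esub> f s =
          (\<zeta> [^] ((r - a) * p s j) \<otimes> \<zeta> [^] (p s i * a)) \<odot>\<^bsub>A\<^esub> f s"
        using assms s by (simp add: t_closed f_closed A.A.m_assoc t_pow_f A.smult_mult_right
            A.smult_assoc1 mult.commute)
      \<comment> \<open>The summation index \<open>a\<close> becomes a factor of the exponent, so
        that both powers combine to a multiple of \<open>a\<close>.\<close>
      also have "\<zeta> [^] ((r - a) * p s j) = \<zeta> [^] ((r - p s j) * a)"
        using less that by (intro \<zeta>_pow_diff_swap[symmetric]) auto
      also have "\<zeta> [^] ((r - p s j) * a) \<otimes> \<zeta> [^] (p s i * a) = \<zeta> [^] (m * a)"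
        by (simp add: nat_pow_mult m_def add_mult_distrib add.commute)
      finally show ?thesis .
    qed
    have "(\<rho> \<odot>\<^bsub>A\<^esub> ?E) \<otimes>\<^bsub>A\<^esub> f s = \<rho> \<odot>\<^bsub>A\<^esub> (?E \<otimes>\<^bsub>A\<^esub> f s)"
      using E s by (intro A.smult_mult_left) (auto simp: f_closed)
    also have "?E \<otimes>\<^bsub>A\<^esub> f s = (\<Oplus>\<^bsub>A\<^esub>a\<in>{..<r}. (t i [^]\<^bsub>A\<^esub> a \<otimes>\<^bsub>A\<^esub> t j [^]\<^bsub>A\<^esub> (r - a)) \<otimes>\<^bsub>A\<^esub> f s)"
      using assms s by (intro A.A.finsum_ldistr) (auto simp: t_closed f_closed)
    also have "\<dots> = (\<Oplus>\<^bsub>A\<^esub>a\<in>{..<r}. \<zeta> [^] (m * a) \<odot>\<^bsub>A\<^esub> f s)"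
      using s by (intro A.M.finsum_cong') (auto simp: summand f_closed)
    also have "\<rho> \<odot>\<^bsub>A\<^esub> \<dots> = (\<rho> \<otimes> (\<Oplus>a\<in>{..<r}. \<zeta> [^] (m * a))) \<odot>\<^bsub>A\<^esub> f s"
      using s by (simp add: f_closed A.smult_assoc1 A.finsum_smult_rdistr)
    also have "\<dots> = (if r dvd m then f s else \<zero>\<^bsub>A\<^esub>)"
      unfolding orthogonality using s by (simp add: f_closed)
    also have "r dvd m \<longleftrightarrow> p s i = p s j"
      unfolding m_def using less by (rule dvd_add_diff_iff)
    finally show ?thesis .
  qed
  then have "(\<Oplus>\<^bsub>A\<^esub>s\<in>S. (\<rho> \<odot>\<^bsub>A\<^esub> ?E) \<otimes>\<^bsub>A\<^esub> f s) = (\<Oplus>\<^bsub>A\<^esub>s\<in>S. if p s i = p s j then f s else \<zero>\<^bsub>A\<^esub>)"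
    by (intro A.M.finsum_cong') (auto simp: f_closed)
  then show ?thesis
    using decompose_right[of "\<rho> \<odot>\<^bsub>A\<^esub> ?E"] E by simp
qed

section \<open>Moving the eigenvectors and the eigenvalues past an element g\<close>

context
  fixes \<tau> \<sigma> g
  assumes g: "g \<in> carrier A"
    and \<tau>: "\<And>s. s \<in> S \<Longrightarrow> \<tau> s \<in> S" and \<sigma>: "\<And>j. j \<in> J \<Longrightarrow> \<sigma> j \<in> J"
    and \<sigma>_\<sigma>: "\<And>j. j \<in> J \<Longrightarrow> \<sigma> (\<sigma> j) = j"
    and p_\<tau>: "\<And>s j. s \<in> S \<Longrightarrow> j \<in> J \<Longrightarrow> p (\<tau> s) j = p s (\<sigma> j)"
begin

text \<open>Only \<open>\<sigma>\<close> is assumed to be involutive; \<open>\<tau>\<close> inherits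
  this because exponents separate the indices.\<close>

lemma \<tau>_\<tau>: "s \<in> S \<Longrightarrow> \<tau> (\<tau> s) = s"
  by (rule p_inj) (simp_all add: \<tau> \<sigma> p_\<tau> \<sigma>_\<sigma>)

text \<open>Tested on \<open>f s\<close>: moving \<open>f s\<close> to the left of \<open>g\<close>
  turns it into \<open>f (\<tau> s)\<close>, on which \<open>t j\<close> has the eigenvalue that
  \<open>t (\<sigma> j)\<close> has on \<open>f s\<close>.\<close>

lemma t_intertwine:
  assumes fg: "\<And>s. s \<in> S \<Longrightarrow> f s \<otimes>\<^bsub>A\<^esub> g = g \<otimes>\<^bsub>A\<^esub> f (\<tau> s)" and j: "j \<in> J"
  shows "t j \<otimes>\<^bsub>A\<^esub> g = g \<otimes>\<^bsub>A\<^esub> t (\<sigma> j)"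
proof (rule eqI)
  fix s
  assume s: "s \<in> S"
  have "(t j \<otimes>\<^bsub>A\<^esub> g) \<otimes>\<^bsub>A\<^esub> f s = t j \<otimes>\<^bsub>A\<^esub> (f (\<tau> s) \<otimes>\<^bsub>A\<^esub> g)"
    using s j g fg[of "\<tau> s"] by (simp add: t_closed f_closed \<tau> \<tau>_\<tau> A.A.m_assoc)
  also have "\<dots> = (t j \<otimes>\<^bsub>A\<^esub> f (\<tau> s)) \<otimes>\<^bsub>A\<^esub> g"
    using s j g by (simp add: t_closed f_closed \<tau> A.A.m_assoc)
  also have "\<dots> = \<zeta> [^] p s (\<sigma> j) \<odot>\<^bsub>A\<^esub> (f (\<tau> s) \<otimes>\<^bsub>A\<^esub> g)"
    using s j g by (simp add: t_f \<tau> p_\<tau> A.smult_mult_left f_closed)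
  also have "f (\<tau> s) \<otimes>\<^bsub>A\<^esub> g = g \<otimes>\<^bsub>A\<^esub> f s"
    using s fg[of "\<tau> s"] by (simp add: \<tau> \<tau>_\<tau>)
  also have "\<zeta> [^] p s (\<sigma> j) \<odot>\<^bsub>A\<^esub> (g \<otimes>\<^bsub>A\<^esub> f s) = (g \<otimes>\<^bsub>A\<^esub> t (\<sigma> j)) \<otimes>\<^bsub>A\<^esub> f s"
    using s j g by (simp add: A.A.m_assoc t_f \<sigma> t_closed f_closed A.smult_mult_right)
  finally show "(t j \<otimes>\<^bsub>A\<^esub> g) \<otimes>\<^bsub>A\<^esub> f s = (g \<otimes>\<^bsub>A\<^esub> t (\<sigma> j)) \<otimes>\<^bsub>A\<^esub> f s" .
qed (use g j in \<open>auto simp: t_closed \<sigma>\<close>)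

text \<open>By the relation for the \<open>t j\<close>, the element \<open>g\<close> times
  \<open>f s'\<close> is a joint eigenvector with the eigenvalues of \<open>\<tau> s'\<close>. Hence
  \<open>f s\<close> annihilates it unless \<open>s = \<tau> s'\<close>, and both sides collapse to
  the product of \<open>f s\<close>, \<open>g\<close> and \<open>f (\<tau> s)\<close>.\<close>

lemma f_intertwine:
  assumes tg: "\<And>j. j \<in> J \<Longrightarrow> t j \<otimes>\<^bsub>A\<^esub> g = g \<otimes>\<^bsub>A\<^esub> t (\<sigma> j)" and s: "s \<in> S"
  shows "f s \<otimes>\<^bsub>A\<^esub> g = g \<otimes>\<^bsub>A\<^esub> f (\<tau> s)"
proof -
  have zero: "f s \<otimes>\<^bsub>A\<^esub> (g \<otimes>\<^bsub>A\<^esub> f s') = \<zero>\<^bsub>A\<^esub>" if s: "s \<in> S" "s' \<in> S" "s \<noteq> \<tau> s'" for s s'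
  proof (rule f_orthogonal[of s "\<tau> s'"])
    fix j
    assume j: "j \<in> J"
    have "t j \<otimes>\<^bsub>A\<^esub> (g \<otimes>\<^bsub>A\<^esub> f s') = (t j \<otimes>\<^bsub>A\<^esub> g) \<otimes>\<^bsub>A\<^esub> f s'"
      using j g s by (simp add: A.A.m_assoc t_closed f_closed)
    also have "\<dots> = g \<otimes>\<^bsub>A\<^esub> (t (\<sigma> j) \<otimes>\<^bsub>A\<^esub> f s')"
      unfolding tg[OF j] using j g s by (simp add: A.A.m_assoc t_closed f_closed \<sigma>)
    also have "\<dots> = \<zeta> [^] p (\<tau> s') j \<odot>\<^bsub>A\<^esub> (g \<otimes>\<^bsub>A\<^esub> f s')"
      using j g s by (simp add: t_f \<sigma> p_\<tau> A.smult_mult_right f_closed)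
    finally show "t j \<otimes>\<^bsub>A\<^esub> (g \<otimes>\<^bsub>A\<^esub> f s') = \<zeta> [^] p (\<tau> s') j \<odot>\<^bsub>A\<^esub> (g \<otimes>\<^bsub>A\<^esub> f s')" .
  qed (use s g \<tau> f_closed in auto)
  have closed: "f s \<otimes>\<^bsub>A\<^esub> (g \<otimes>\<^bsub>A\<^esub> f s') \<in> carrier A" if "s \<in> S" "s' \<in> S" for s s'
    using that g f_closed by simp
  have "f s \<otimes>\<^bsub>A\<^esub> g = (\<Oplus>\<^bsub>A\<^esub>s'\<in>S. (f s \<otimes>\<^bsub>A\<^esub> g) \<otimes>\<^bsub>A\<^esub> f s')"
    using s g by (intro decompose_right) (simp add: f_closed)
  also have "\<dots> = (\<Oplus>\<^bsub>A\<^esub>s'\<in>S. f s \<otimes>\<^bsub>A\<^esub> (g \<otimes>\<^bsub>A\<^esub> f s'))"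
    using s g closed by (intro A.M.finsum_cong') (auto simp: f_closed A.A.m_assoc)
  also have "\<dots> = f s \<otimes>\<^bsub>A\<^esub> (g \<otimes>\<^bsub>A\<^esub> f (\<tau> s))"
    using s \<tau> closed \<tau>_\<tau> by (intro finsum_only zero) auto
  also have "\<dots> = (\<Oplus>\<^bsub>A\<^esub>s'\<in>S. f s' \<otimes>\<^bsub>A\<^esub> (g \<otimes>\<^bsub>A\<^esub> f (\<tau> s)))"
    using s \<tau> closed by (intro finsum_only[symmetric] zero) (auto simp: \<tau>_\<tau>)
  also have "\<dots> = g \<otimes>\<^bsub>A\<^esub> f (\<tau> s)"
    using s g \<tau> by (intro decompose_left[symmetric]) (simp add: f_closed)
  finally show ?thesis .
qed

end

text \<open>Mixed products of the two families vanish off the diagonal, so expanding the unit by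
  either family shows that \<open>f s\<close> and \<open>f' s\<close> both equal \<open>f s\<close>
  times \<open>f' s\<close>.\<close>

lemma f_unique:
  assumes f': "spectral_family R A r \<zeta> \<rho> S J p f' t" and s: "s \<in> S"
  shows "f' s = f s"
proof -
  interpret f': spectral_family R A r \<zeta> \<rho> S J p f' t by (rule f')
  have zero: "f s \<otimes>\<^bsub>A\<^esub> f' s' = \<zero>\<^bsub>A\<^esub>" if "s \<in> S" "s' \<in> S" "s \<noteq> s'" for s s'
    using that by (intro f_orthogonal[of s s']) (auto simp: f'.f_closed f'.t_f)
  have "f s = (\<Oplus>\<^bsub>A\<^esub>s'\<in>S. f s \<otimes>\<^bsub>A\<^esub> f' s')"
    using s by (intro f'.decompose_right f_closed)
  also have "\<dots> = f s \<otimes>\<^bsub>A\<^esub> f' s"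
    using s zero by (intro finsum_only) (auto simp: f_closed f'.f_closed)
  also have "\<dots> = (\<Oplus>\<^bsub>A\<^esub>s'\<in>S. f s' \<otimes>\<^bsub>A\<^esub> f' s)"
    using s zero by (intro finsum_only[symmetric]) (auto simp: f_closed f'.f_closed)
  also have "\<dots> = f' s"
    using s by (intro decompose_left[symmetric] f'.f_closed)
  finally show ?thesis ..
qed

end

section \<open>One-column tableaux as colourings\<close>

text \<open>
  A standard one-column multitableau is determined by the map sending each entry to the index,
  counted from \<open>0\<close>, of its column.
\<close>
definition column :: "multitableau \<Rightarrow> nat \<Rightarrow> nat" where
  "column s j = (THE k. k < length s \<and> j \<in> set (s ! k))"

definition tableau_of :: "nat \<Rightarrow> nat \<Rightarrow> (nat \<Rightarrow> nat) \<Rightarrow> multitableau" where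
  "tableau_of n r p = map (\<lambda>k. filter (\<lambda>j. p j = k) [1..<Suc n]) [0..<r]"

lemma Std1_iff: "s \<in> Std1 n r \<longleftrightarrow>
    length s = r \<and> distinct (concat s) \<and> set (concat s) = {1..n} \<and> (\<forall>c\<in>set s. sorted_wrt (<) c)"
proof -
  have "sum_list (map length s) = n" if "distinct (concat s)" "set (concat s) = {1..n}"
    using distinct_card[OF that(1)] that(2) by (simp add: length_concat)
  then show ?thesis
    unfolding Std1_def one_column_multipartitions_def by auto
qed

lemma distinct_concat_nth:
  assumes "distinct (concat s)" "k < length s" "l < length s" "j \<in> set (s ! k)" "j \<in> set (s ! l)"
  shows "k = l"
proof -
  have le: "k = l"
    if kl: "k \<le> l" "l < length s" and j: "j \<in> set (s ! k)" "j \<in> set (s ! l)" for k l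
  proof (rule ccontr)
    assume "k \<noteq> l"
    with kl have "k < l" by simp
    then have "s ! k \<in> set (take l s)"
      using kl by (auto simp: in_set_conv_nth)
    moreover have "s = take l s @ s ! l # drop (Suc l) s"
      using kl by (intro id_take_nth_drop)
    then have "distinct (concat (take l s) @ s ! l @ concat (drop (Suc l) s))"
      using assms(1) by (metis concat.simps(2) concat_append)
    ultimately show False
      using j by auto
  qed
  then show ?thesis
    using assms(2-5) le nat_le_linear by metis
qed

lemma column_eqI:
  assumes "s \<in> Std1 n r" "k < r" "j \<in> set (s ! k)"
  shows "column s j = k"
  unfolding column_def using assms distinct_concat_nth[of s]
  by (intro the_equality) (auto simp: Std1_iff)

lemma column_less:
  assumes s: "s \<in> Std1 n r" and j: "j \<in> {1..n}"
  shows "column s j < r" and "j \<in> set (s ! column s j)"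
proof -
  have "j \<in> set (concat s)"
    using s j unfolding Std1_iff by blast
  then obtain c where "c \<in> set s" "j \<in> set c"
    by auto
  then obtain k where "k < r" "j \<in> set (s ! k)"
    using s unfolding Std1_iff by (metis in_set_conv_nth)
  then show "column s j < r" "j \<in> set (s ! column s j)"
    using column_eqI[OF s] by auto
qed

lemma mem_column_iff:
  assumes s: "s \<in> Std1 n r" and k: "k < r"
  shows "j \<in> set (s ! k) \<longleftrightarrow> j \<in> {1..n} \<and> column s j = k"
proof
  assume j: "j \<in> set (s ! k)"
  then have "j \<in> set (concat s)"
    using k s unfolding Std1_iff by auto
  then have "j \<in> {1..n}"
    using s unfolding Std1_iff by blast
  then show "j \<in> {1..n} \<and> column s j = k"
    using column_eqI[OF s k j] by blast
qed (use column_less[OF s] in blast)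

text \<open>A strictly increasing list is determined by its set of entries. Agreement is asked on
  \<open>{1..n}\<close> only, so that restricted colourings and the colouring of another tableau can
  be inserted.\<close>

lemma tableau_of_column:
  assumes s: "s \<in> Std1 n r" and p: "\<And>j. j \<in> {1..n} \<Longrightarrow> p j = column s j"
  shows "tableau_of n r p = s"
proof (rule nth_equalityI)
  show "length (tableau_of n r p) = length s"
    using s by (simp add: tableau_of_def Std1_iff)
  fix k
  assume "k < length (tableau_of n r p)"
  then have k: "k < r"
    by (simp add: tableau_of_def)
  have "sorted_wrt (<) (filter (\<lambda>j. p j = k) [1..<Suc n])"
    by (intro sorted_wrt_filter) (simp only: sorted_wrt_upt)
  moreover have "sorted_wrt (<) (s ! k)"
    using s k by (simp add: Std1_iff)
  moreover have "j \<in> set (s ! k) \<longleftrightarrow> j \<in> set (filter (\<lambda>j. p j = k) [1..<Suc n])" for j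
    unfolding mem_column_iff[OF s k] using p[of j] by (auto simp del: upt_Suc)
  then have "set (s ! k) = set (filter (\<lambda>j. p j = k) [1..<Suc n])"
    by blast
  ultimately have "filter (\<lambda>j. p j = k) [1..<Suc n] = s ! k"
    by (metis strict_sorted_equal)
  then show "tableau_of n r p ! k = s ! k"
    using k by (simp add: tableau_of_def)
qed

lemma Std1_eqI:
  assumes "s \<in> Std1 n r" "s' \<in> Std1 n r" "\<And>j. j \<in> {1..n} \<Longrightarrow> column s j = column s' j"
  shows "s = s'"
  using tableau_of_column[OF assms(1) refl] tableau_of_column[OF assms(2,3)] by simp

lemma tableau_of_in_Std1:
  assumes p: "\<And>j. j \<in> {1..n} \<Longrightarrow> p j < r"
  shows "tableau_of n r p \<in> Std1 n r"
  unfolding Std1_iff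
proof (intro conjI ballI)
  have "distinct (concat (map (\<lambda>k. filter (\<lambda>j. p j = k) [1..<Suc n]) ks))" if "distinct ks" for ks
    using that by (induction ks) (auto simp del: upt_Suc)
  then show "distinct (concat (tableau_of n r p))"
    unfolding tableau_of_def by simp
  show "set (concat (tableau_of n r p)) = {1..n}"
    using p by (auto simp: tableau_of_def simp del: upt_Suc)
  fix c
  assume "c \<in> set (tableau_of n r p)"
  then obtain k where c: "c = filter (\<lambda>j. p j = k) [1..<Suc n]"
    unfolding tableau_of_def by auto
  show "sorted_wrt (<) c"
    unfolding c by (intro sorted_wrt_filter) (simp only: sorted_wrt_upt)
qed (simp add: tableau_of_def)

lemma column_tableau_of:
  assumes p: "\<And>j. j \<in> {1..n} \<Longrightarrow> p j < r" and j: "j \<in> {1..n}"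
  shows "column (tableau_of n r p) j = p j"
proof (rule column_eqI[OF tableau_of_in_Std1[OF p]])
  show "p j < r" "j \<in> set (tableau_of n r p ! p j)"
    using p j by (auto simp: tableau_of_def simp del: upt_Suc)
qed

text \<open>Translates between tableaux and the exponent functions that index
  \<open>joint_eigenprojections\<close>. Colourings are restricted to \<open>{1..n}\<close> because
  members of \<open>PiE\<close> are extensional.\<close>

lemma bij_betw_column:
  "bij_betw (\<lambda>s. restrict (column s) {1..n}) (Std1 n r) (PiE {1..n} (\<lambda>_. {..<r}))"
proof (rule bij_betwI[where g = "tableau_of n r"])
  show "(\<lambda>s. restrict (column s) {1..n}) \<in> Std1 n r \<rightarrow> PiE {1..n} (\<lambda>_. {..<r})"
    using column_less(1) by fastforce
  show "tableau_of n r \<in> PiE {1..n} (\<lambda>_. {..<r}) \<rightarrow> Std1 n r"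
    by (intro funcsetI tableau_of_in_Std1) (auto dest: PiE_mem)
  show "tableau_of n r (restrict (column s) {1..n}) = s" if "s \<in> Std1 n r" for s
    using that by (rule tableau_of_column) simp
  show "restrict (column (tableau_of n r p)) {1..n} = p" if p: "p \<in> PiE {1..n} (\<lambda>_. {..<r})" for p
  proof (rule PiE_ext[OF _ p])
    have less: "p j < r" if "j \<in> {1..n}" for j
      using PiE_mem[OF p that] by simp
    have col: "column (tableau_of n r p) j = p j" if "j \<in> {1..n}" for j
      using less that by (rule column_tableau_of)
    show "restrict (column (tableau_of n r p)) {1..n} \<in> PiE {1..n} (\<lambda>_. {..<r})"
      unfolding restrict_PiE_iff using less col by simp
    show "restrict (column (tableau_of n r p)) {1..n} j = p j" if "j \<in> {1..n}" for j
      unfolding restrict_apply using that col by simp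
  qed
qed

lemma finite_Std1: "finite (Std1 n r)"
  using bij_betw_finite[OF bij_betw_column[of n r]] by (simp add: finite_PiE)

section \<open>Adjacent transpositions acting on tableaux and colourings\<close>

abbreviation tab_act :: "nat \<Rightarrow> multitableau \<Rightarrow> multitableau" where
  "tab_act i s \<equiv> (if same_component i s then s else tab_swap i s)"

lemma generator_range:
  fixes i n :: nat
  assumes "i \<in> {1..n - 1}"
  shows "i \<in> {1..n}" "i + 1 \<in> {1..n}"
proof -
  have "1 \<le> i \<and> i + 1 \<le> n"
    using assms unfolding atLeastAtMost_iff by linarith
  then show "i \<in> {1..n}" "i + 1 \<in> {1..n}"
    by auto
qed

lemma transpose_mem:
  fixes i n :: nat
  assumes "i \<in> {1..n - 1}" "j \<in> {1..n}"
  shows "Transposition.transpose i (i + 1) j \<in> {1..n}"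
  using generator_range[OF assms(1)] assms(2) by (simp add: transpose_def)

lemma same_component_iff:
  assumes s: "s \<in> Std1 n r" and i: "i \<in> {1..n - 1}"
  shows "same_component i s \<longleftrightarrow> column s i = column s (i + 1)"
proof -
  note i' = generator_range[OF i]
  have len: "length s = r"
    using s by (simp add: Std1_iff)
  show ?thesis
  proof
    assume "same_component i s"
    then obtain k where "k < r" "i \<in> set (s ! k)" "i + 1 \<in> set (s ! k)"
      unfolding same_component_def using len by (metis in_set_conv_nth)
    then show "column s i = column s (i + 1)"
      using column_eqI[OF s] by metis
  next
    assume eq: "column s i = column s (i + 1)"
    then have "i + 1 \<in> set (s ! column s i)"
      using column_less(2)[OF s i'(2)] by simp
    then show "same_component i s"
      unfolding same_component_def using column_less[OF s i'(1)] len nth_mem by blast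
  qed
qed

text \<open>Exchanging two consecutive numbers reverses the order of that one pair only, and the
  pair lies in no common column.\<close>

lemma tab_swap_in_Std1:
  assumes s: "s \<in> Std1 n r" and i: "i \<in> {1..n - 1}" and "\<not> same_component i s"
  shows "tab_swap i s \<in> Std1 n r"
proof -
  let ?\<sigma> = "Transposition.transpose i (i + 1)"
  have concat: "concat (tab_swap i s) = map ?\<sigma> (concat s)"
    unfolding tab_swap_def by (simp add: map_concat)
  have "sorted_wrt (<) (map ?\<sigma> c)" if c: "c \<in> set s" for c
  proof -
    have "sorted_wrt (<) c"
      using s c by (simp add: Std1_iff)
    moreover have "?\<sigma> x < ?\<sigma> y" if "x \<in> set c" "y \<in> set c" "x < y" for x y
      using that c assms(3) unfolding same_component_def transpose_def by auto
    ultimately show ?thesis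
      unfolding sorted_wrt_map by (rule sorted_wrt_mono_rel[rotated])
  qed
  moreover have "?\<sigma> ` {1..n} = {1..n}"
    using generator_range[OF i] by (intro transpose_image_eq) blast
  ultimately show ?thesis
    using s unfolding Std1_iff concat
    by (auto simp: tab_swap_def distinct_map simp del: set_concat)
qed

lemma tab_act_in_Std1: "s \<in> Std1 n r \<Longrightarrow> i \<in> {1..n - 1} \<Longrightarrow> tab_act i s \<in> Std1 n r"
  by (simp add: tab_swap_in_Std1)

text \<open>This justifies the convention for a common column: leaving the tableau fixed there
  agrees with permuting its colouring, since the two colours are equal. One formula then covers both
  cases.\<close>

lemma column_tab_act:
  assumes s: "s \<in> Std1 n r" and i: "i \<in> {1..n - 1}" and j: "j \<in> {1..n}"
  shows "column (tab_act i s) j = column s (Transposition.transpose i (i + 1) j)"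
proof (cases "same_component i s")
  case True
  then show ?thesis
    using same_component_iff[OF s i] by (simp add: transpose_def)
next
  case False
  let ?\<sigma> = "Transposition.transpose i (i + 1)"
  have \<sigma>j: "?\<sigma> j \<in> {1..n}"
    using i j by (rule transpose_mem)
  have "column (tab_swap i s) j = column s (?\<sigma> j)"
  proof (rule column_eqI[OF tab_swap_in_Std1[OF s i False]])
    show less: "column s (?\<sigma> j) < r"
      by (rule column_less(1)[OF s \<sigma>j])
    have "?\<sigma> (?\<sigma> j) \<in> ?\<sigma> ` set (s ! column s (?\<sigma> j))"
      by (rule imageI, rule column_less(2)[OF s \<sigma>j])
    then show "j \<in> set (tab_swap i s ! column s (?\<sigma> j))"
      using less s by (simp add: tab_swap_def Std1_iff)
  qed
  then show ?thesis
    using False by simp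
qed

section \<open>The base ring\<close>

lemma base_ring_simps [simp]:
  "a \<otimes>\<^bsub>base_ring r\<^esub> b = a * b"
  "a \<oplus>\<^bsub>base_ring r\<^esub> b = a + b"
  "\<one>\<^bsub>base_ring r\<^esub> = 1"
  "\<zero>\<^bsub>base_ring r\<^esub> = 0"
  by (simp_all add: base_ring_def ring_of_type_algebra_def)

lemma base_ring_cring: "cring (base_ring r)"
proof -
  interpret K: ring "ring_of_type_algebra :: ratfun ring"
    by (rule ring_from_type_algebra)
  interpret R: ring "base_ring r"
    unfolding base_ring_def
    by (rule K.generate_ring_is_ring) (simp add: ring_of_type_algebra_def)
  show ?thesis
    by unfold_locales simp
qed

lemma base_ring_closed:
  "q_var \<in> carrier (base_ring r)"
  "inverse q_var \<in> carrier (base_ring r)"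
  "ratfun_const (root_xi r) \<in> carrier (base_ring r)"
  "inverse (of_nat r) \<in> carrier (base_ring r)"
  unfolding base_ring_def by (auto intro: generate_ring.incl)

lemma base_ring_q_closed: "q_var - inverse q_var \<in> carrier (base_ring r)"
proof -
  interpret cring "base_ring r" by (rule base_ring_cring)
  let ?q' = "\<ominus>\<^bsub>base_ring r\<^esub> inverse q_var"
  have q': "?q' \<in> carrier (base_ring r)"
    by (intro a_inv_closed base_ring_closed)
  \<comment> \<open>The additive inverse taken in the subring is identified with negation in the
    field by its defining equation.\<close>
  have "?q' + inverse q_var = 0"
    using l_neg[OF base_ring_closed(2)] by simp
  then have "?q' = - inverse q_var"
    by (simp add: eq_neg_iff_add_eq_0)
  then show ?thesis
    using a_closed[OF base_ring_closed(1) q'] by simp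
qed

lemma base_ring_nat_pow: "a [^]\<^bsub>base_ring r\<^esub> (m :: nat) = a ^ m"
proof -
  interpret cring "base_ring r" by (rule base_ring_cring)
  show ?thesis
    by (induction m) simp_all
qed

lemma base_ring_finsum:
  assumes "finite I" "\<And>i. i \<in> I \<Longrightarrow> f i \<in> carrier (base_ring r)"
  shows "(\<Oplus>\<^bsub>base_ring r\<^esub>i\<in>I. f i) = (\<Sum>i\<in>I. f i)"
proof -
  interpret cring "base_ring r" by (rule base_ring_cring)
  show ?thesis
    using assms by (induction I rule: finite_induct) (simp_all add: Pi_iff)
qed

lemma ratfun_const_power: "ratfun_const c ^ m = ratfun_const (c ^ m)"
  by (induction m) (simp_all add: ratfun_const_def One_fract_def one_pCons mult.commute)

lemma ratfun_const_eq_1_iff: "ratfun_const c = 1 \<longleftrightarrow> c = 1"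
  by (simp add: ratfun_const_def One_fract_def eq_fract one_pCons)

text \<open>The first \<open>r\<close> powers are distinct points of the unit circle, so after
  reducing the exponent modulo \<open>r\<close> only exponent 0 gives one.\<close>

lemma root_xi_power_eq_1_iff:
  assumes "r \<ge> 1"
  shows "root_xi r ^ m = 1 \<longleftrightarrow> r dvd m"
proof -
  have cis: "root_xi r ^ k = cis (2 * pi * real k / real r)" for k
    by (simp add: root_xi_def cis_conv_exp flip: exp_of_nat_mult) (simp add: mult_ac)
  have one: "root_xi r ^ r = 1"
    using assms by (simp add: cis)
  have "root_xi r ^ m = root_xi r ^ (m mod r + r * (m div r))"
    by simp
  also have "\<dots> = root_xi r ^ (m mod r)"
    unfolding power_add power_mult one by simp
  also have "\<dots> = 1 \<longleftrightarrow> m mod r = 0"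
  proof
    have inj: "inj_on (\<lambda>k. cis (2 * pi * real k / real r)) {..<r}"
      using bij_betw_roots_unity[of r] assms by (simp add: bij_betw_def)
    assume "root_xi r ^ (m mod r) = 1"
    then have "cis (2 * pi * real (m mod r) / real r) = cis (2 * pi * real 0 / real r)"
      by (simp add: cis)
    then show "m mod r = 0"
      using assms by (intro inj_onD[OF inj]) auto
  qed simp
  finally show ?thesis
    by (simp add: mod_eq_0_iff_dvd)
qed

lemma base_root_of_unity:
  assumes r: "r \<ge> 1"
  shows "root_of_unity (base_ring r) r (ratfun_const (root_xi r)) (inverse (of_nat r))"
proof -
  interpret cring "base_ring r" by (rule base_ring_cring)
  let ?\<zeta> = "ratfun_const (root_xi r)"
  have \<zeta>_pow: "?\<zeta> ^ m = 1 \<longleftrightarrow> r dvd m" for m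
    unfolding ratfun_const_power ratfun_const_eq_1_iff using r by (rule root_xi_power_eq_1_iff)
  have nz: "(of_nat r :: ratfun) \<noteq> 0"
    using r by (simp add: of_nat_fract Zero_fract_def eq_fract)
  have "inverse (of_nat r) * (\<Sum>a<r. ?\<zeta> ^ (m * a)) = (if r dvd m then 1 else 0)" for m
  proof (cases "r dvd m")
    case True
    then have "?\<zeta> ^ (m * a) = 1" for a
      by (simp add: \<zeta>_pow)
    then show ?thesis
      using True nz by simp
  next
    case False
    then have "?\<zeta> ^ m \<noteq> 1"
      by (simp add: \<zeta>_pow)
    \<comment> \<open>The sum is evaluated in the field of rational functions, where the nonzero
      \<open>?\<zeta> ^ m - 1\<close> may be divided by; the numerator then vanishes.\<close>
    then have "(\<Sum>a<r. (?\<zeta> ^ m) ^ a) = ((?\<zeta> ^ m) ^ r - 1) / (?\<zeta> ^ m - 1)"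
      by (rule geometric_sum)
    also have "(?\<zeta> ^ m) ^ r = 1"
      by (simp add: \<zeta>_pow flip: power_mult)
    finally show ?thesis
      using False by (simp add: power_mult)
  qed
  moreover have "?\<zeta> ^ m \<in> carrier (base_ring r)" for m
    using nat_pow_closed[OF base_ring_closed(3)] by (simp add: base_ring_nat_pow)
  ultimately show ?thesis
    using r by unfold_locales
      (auto simp: base_ring_closed base_ring_nat_pow base_ring_finsum \<zeta>_pow)
qed

section \<open>The two presentations\<close>

text \<open>The defining relations as a property of elements of any algebra, so that the relations
  of either presentation can be tested in either algebra.\<close>

definition yh_relations ::
    "nat \<Rightarrow> nat \<Rightarrow> (ratfun, 'b, 'k) module_scheme \<Rightarrow> (nat \<Rightarrow> 'b) \<Rightarrow> (nat \<Rightarrow> 'b) \<Rightarrow> bool" where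
  "yh_relations r n B g t \<longleftrightarrow>
    (\<forall>i\<in>{1..n}. t i [^]\<^bsub>B\<^esub> r = \<one>\<^bsub>B\<^esub>) \<and>
    (\<forall>i\<in>{1..n}. \<forall>j\<in>{1..n}. t i \<otimes>\<^bsub>B\<^esub> t j = t j \<otimes>\<^bsub>B\<^esub> t i) \<and>
    (\<forall>i\<in>{1..n - 1}. \<forall>j\<in>{1..n}.
      t j \<otimes>\<^bsub>B\<^esub> g i = g i \<otimes>\<^bsub>B\<^esub> t (Transposition.transpose i (i + 1) j)) \<and>
    (\<forall>i\<in>{1..n - 1}. \<forall>j\<in>{1..n - 1}. \<bar>int i - int j\<bar> > 1 \<longrightarrow> g i \<otimes>\<^bsub>B\<^esub> g j = g j \<otimes>\<^bsub>B\<^esub> g i) \<and>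
    (\<forall>i\<in>{1..n - 2}. g i \<otimes>\<^bsub>B\<^esub> g (i + 1) \<otimes>\<^bsub>B\<^esub> g i = g (i + 1) \<otimes>\<^bsub>B\<^esub> g i \<otimes>\<^bsub>B\<^esub> g (i + 1)) \<and>
    (\<forall>i\<in>{1..n - 1}. g i [^]\<^bsub>B\<^esub> (2 :: nat) = \<one>\<^bsub>B\<^esub> \<oplus>\<^bsub>B\<^esub> (q_var - inverse q_var) \<odot>\<^bsub>B\<^esub>
      ((inverse (of_nat r) \<odot>\<^bsub>B\<^esub>
        (\<Oplus>\<^bsub>B\<^esub>s\<in>{..<r}. t i [^]\<^bsub>B\<^esub> s \<otimes>\<^bsub>B\<^esub> t (i + 1) [^]\<^bsub>B\<^esub> (r - s))) \<otimes>\<^bsub>B\<^esub> g i))"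

definition tab_relations ::
    "nat \<Rightarrow> nat \<Rightarrow> (ratfun, 'b, 'k) module_scheme \<Rightarrow> (nat \<Rightarrow> 'b) \<Rightarrow> (multitableau \<Rightarrow> 'b) \<Rightarrow> bool"
  where
  "tab_relations r n B g f \<longleftrightarrow>
    (\<forall>i\<in>{1..n - 1}. \<forall>j\<in>{1..n - 1}. \<bar>int i - int j\<bar> > 1 \<longrightarrow> g i \<otimes>\<^bsub>B\<^esub> g j = g j \<otimes>\<^bsub>B\<^esub> g i) \<and>
    (\<forall>i\<in>{1..n - 2}. g i \<otimes>\<^bsub>B\<^esub> g (i + 1) \<otimes>\<^bsub>B\<^esub> g i = g (i + 1) \<otimes>\<^bsub>B\<^esub> g i \<otimes>\<^bsub>B\<^esub> g (i + 1)) \<and>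
    (\<forall>s\<in>Std1 n r. \<forall>i\<in>{1..n - 1}. f s \<otimes>\<^bsub>B\<^esub> g i = g i \<otimes>\<^bsub>B\<^esub> f (tab_act i s)) \<and>
    (\<forall>i\<in>{1..n - 1}. g i [^]\<^bsub>B\<^esub> (2 :: nat) = \<one>\<^bsub>B\<^esub> \<oplus>\<^bsub>B\<^esub> (q_var - inverse q_var) \<odot>\<^bsub>B\<^esub>
      (\<Oplus>\<^bsub>B\<^esub>s\<in>Std1 n r. of_bool (same_component i s) \<odot>\<^bsub>B\<^esub> (f s \<otimes>\<^bsub>B\<^esub> g i))) \<and>
    (\<Oplus>\<^bsub>B\<^esub>s\<in>Std1 n r. f s) = \<one>\<^bsub>B\<^esub> \<and>
    (\<forall>s\<in>Std1 n r. \<forall>s'\<in>Std1 n r. f s \<otimes>\<^bsub>B\<^esub> f s' = of_bool (s = s') \<odot>\<^bsub>B\<^esub> f s)"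

lemma ball_setcompr: "(\<forall>x\<in>{F i |i. P i}. Q x) \<longleftrightarrow> (\<forall>i. P i \<longrightarrow> Q (F i))"
  by auto

lemma ball_setcompr2: "(\<forall>x\<in>{F i j |i j. P i j}. Q x) \<longleftrightarrow> (\<forall>i j. P i j \<longrightarrow> Q (F i j))"
  by auto

lemma of_bool_closed: "of_bool P \<in> carrier (base_ring r)"
proof -
  interpret cring "base_ring r" by (rule base_ring_cring)
  show ?thesis
    using one_closed zero_closed by (cases P) simp_all
qed

section \<open>Membership of the relations in the free algebras, and their images\<close>

context
  fixes n r :: nat
begin

interpretation R: cring "base_ring r" by (rule base_ring_cring)

interpretation YF: assoc_algebra "base_ring r" "yh_free r n"
  unfolding yh_free_def by (rule R.free_algebra_assoc_algebra)

interpretation TF: assoc_algebra "base_ring r" "tab_free r n"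
  unfolding tab_free_def by (rule R.free_algebra_assoc_algebra)

lemma yh_g_closed: "i \<in> {1..n - 1} \<Longrightarrow> yh_g r i \<in> carrier (yh_free r n)"
  and yh_t_closed: "j \<in> {1..n} \<Longrightarrow> yh_t r j \<in> carrier (yh_free r n)"
  unfolding yh_free_def by (intro R.free_gen_closed; simp add: yh_gens_def)+

lemma tab_g_closed: "i \<in> {1..n - 1} \<Longrightarrow> tab_g r i \<in> carrier (tab_free r n)"
  and tab_f_closed: "s \<in> Std1 n r \<Longrightarrow> tab_f r s \<in> carrier (tab_free r n)"
  unfolding tab_free_def by (intro R.free_gen_closed; simp add: tab_gens_def)+

lemma braid_range:
  assumes "i \<in> {1..n - 2}"
  shows "i \<in> {1..n - 1}" "i + 1 \<in> {1..n - 1}"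
proof -
  have "1 \<le> i \<and> i + 1 \<le> n - 1"
    using assms unfolding atLeastAtMost_iff by linarith
  then show "i \<in> {1..n - 1}" "i + 1 \<in> {1..n - 1}"
    by auto
qed

lemma yh_average_closed:
  assumes "i \<in> {1..n - 1}"
  shows "(\<Oplus>\<^bsub>yh_free r n\<^esub>s\<in>{..<r}. yh_t r i [^]\<^bsub>yh_free r n\<^esub> s \<otimes>\<^bsub>yh_free r n\<^esub>
      yh_t r (i + 1) [^]\<^bsub>yh_free r n\<^esub> (r - s)) \<in> carrier (yh_free r n)"
  using generator_range[OF assms]
  by (intro YF.M.finsum_closed funcsetI YF.A.m_closed YF.A.nat_pow_closed yh_t_closed)

lemma yh_e_closed: "i \<in> {1..n - 1} \<Longrightarrow> yh_e r n i \<in> carrier (yh_free r n)"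
  unfolding yh_e_def by (intro YF.smult_closed base_ring_closed yh_average_closed)

lemma yh_rels_closed: "yh_rels r n \<subseteq> carrier (yh_free r n) \<times> carrier (yh_free r n)"
  unfolding yh_rels_def Let_def
  by (intro Un_least subsetI; elim CollectE exE conjE; hypsubst;
      intro SigmaI YF.A.m_closed YF.A.one_closed YF.A.nat_pow_closed YF.M.a_closed YF.smult_closed
        yh_g_closed yh_t_closed yh_e_closed base_ring_q_closed transpose_mem;
      (assumption | erule braid_range))

lemma tab_rels_closed: "tab_rels r n \<subseteq> carrier (tab_free r n) \<times> carrier (tab_free r n)"
  unfolding tab_rels_def Let_def
  by (intro Un_least subsetI; (elim CollectE exE conjE | simp only: singleton_iff); hypsubst?;
      intro SigmaI TF.A.m_closed TF.A.one_closed TF.A.nat_pow_closed TF.M.a_closed TF.smult_closed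
        TF.M.finsum_closed funcsetI tab_g_closed tab_f_closed base_ring_q_closed of_bool_closed
        tab_act_in_Std1;
      (assumption | erule braid_range))

text \<open>Read forwards with \<open>h\<close> the class map, it yields the relations in the
  presented algebra; read backwards, it verifies that a homomorphism of the free algebra
  descends.\<close>

lemma yh_rels_iff:
  assumes B: "assoc_algebra (base_ring r) B" and h: "h \<in> algebra_hom (base_ring r) (yh_free r n) B"
    and g: "\<And>i. i \<in> {1..n - 1} \<Longrightarrow> h (yh_g r i) = g i"
    and t: "\<And>j. j \<in> {1..n} \<Longrightarrow> h (yh_t r j) = t j"
  shows "(\<forall>x\<in>yh_rels r n. h (fst x) = h (snd x)) \<longleftrightarrow> yh_relations r n B g t"
proof -
  interpret B: assoc_algebra "base_ring r" B by (rule B)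
  let ?F = "yh_free r n"
  note homs = algebra_homD(3-6)[OF h] algebra_hom_nat_pow[OF YF.assoc_algebra_axioms B h]
  note closed = yh_g_closed yh_t_closed yh_e_closed
  have tt: "h (yh_t r i \<otimes>\<^bsub>?F\<^esub> yh_t r j) = t i \<otimes>\<^bsub>B\<^esub> t j" if "i \<in> {1..n}" "j \<in> {1..n}" for i j
    using that by (simp only: homs closed t)
  have tg: "h (yh_t r j \<otimes>\<^bsub>?F\<^esub> yh_g r i) = t j \<otimes>\<^bsub>B\<^esub> g i" if "i \<in> {1..n - 1}" "j \<in> {1..n}" for i j
    using that by (simp only: homs closed g t)
  have gt: "h (yh_g r i \<otimes>\<^bsub>?F\<^esub> yh_t r (Transposition.transpose i (i + 1) j)) =
      g i \<otimes>\<^bsub>B\<^esub> t (Transposition.transpose i (i + 1) j)" if "i \<in> {1..n - 1}" "j \<in> {1..n}" for i j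
    using that transpose_mem[OF that] by (simp only: homs closed g t)
  have gg: "h (yh_g r i \<otimes>\<^bsub>?F\<^esub> yh_g r j) = g i \<otimes>\<^bsub>B\<^esub> g j" if "i \<in> {1..n - 1}" "j \<in> {1..n - 1}" for i j
    using that by (simp only: homs closed g)
  have ggg: "h (yh_g r i \<otimes>\<^bsub>?F\<^esub> yh_g r j \<otimes>\<^bsub>?F\<^esub> yh_g r i) = g i \<otimes>\<^bsub>B\<^esub> g j \<otimes>\<^bsub>B\<^esub> g i"
    if "i \<in> {1..n - 1}" "j \<in> {1..n - 1}" for i j
    using that by (simp only: homs closed g YF.A.m_closed)
  have e: "h (yh_e r n i) = inverse (of_nat r) \<odot>\<^bsub>B\<^esub>
      (\<Oplus>\<^bsub>B\<^esub>s\<in>{..<r}. t i [^]\<^bsub>B\<^esub> s \<otimes>\<^bsub>B\<^esub> t (i + 1) [^]\<^bsub>B\<^esub> (r - s))" if "i \<in> {1..n - 1}" for i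
    unfolding yh_e_def using generator_range[OF that]
    by (simp only: homs base_ring_closed yh_average_closed[OF that] t closed YF.A.nat_pow_closed
        YF.A.m_closed algebra_hom_finsum[OF YF.assoc_algebra_axioms B h])
  have quadratic: "h (\<one>\<^bsub>?F\<^esub> \<oplus>\<^bsub>?F\<^esub> (q_var - inverse q_var) \<odot>\<^bsub>?F\<^esub> (yh_e r n i \<otimes>\<^bsub>?F\<^esub> yh_g r i)) =
      \<one>\<^bsub>B\<^esub> \<oplus>\<^bsub>B\<^esub> (q_var - inverse q_var) \<odot>\<^bsub>B\<^esub> (h (yh_e r n i) \<otimes>\<^bsub>B\<^esub> g i)" if "i \<in> {1..n - 1}" for i
    using that by (simp only: homs closed g base_ring_q_closed YF.A.m_closed YF.smult_closed
        YF.A.one_closed)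
  show ?thesis
    unfolding yh_rels_def Let_def yh_relations_def ball_Un ball_setcompr ball_setcompr2 conj_assoc
    by (simp only: Ball_def imp_conjL all_simps fst_conv snd_conv
        tt tg gt gg ggg quadratic e homs closed g t braid_range cong: imp_cong)
qed

lemma tab_rels_iff:
  assumes B: "assoc_algebra (base_ring r) B" and h: "h \<in> algebra_hom (base_ring r) (tab_free r n) B"
    and g: "\<And>i. i \<in> {1..n - 1} \<Longrightarrow> h (tab_g r i) = g i"
    and f: "\<And>s. s \<in> Std1 n r \<Longrightarrow> h (tab_f r s) = f s"
  shows "(\<forall>x\<in>tab_rels r n. h (fst x) = h (snd x)) \<longleftrightarrow> tab_relations r n B g f"
proof -
  interpret B: assoc_algebra "base_ring r" B by (rule B)
  let ?F = "tab_free r n"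
  note homs = algebra_homD(3-6)[OF h] algebra_hom_nat_pow[OF TF.assoc_algebra_axioms B h]
    algebra_hom_finsum[OF TF.assoc_algebra_axioms B h]
  note closed = tab_g_closed tab_f_closed of_bool_closed base_ring_q_closed TF.A.m_closed
    TF.smult_closed TF.A.one_closed
  have fin: "(\<Oplus>\<^bsub>?F\<^esub>s\<in>Std1 n r. of_bool (same_component i s) \<odot>\<^bsub>?F\<^esub> (tab_f r s \<otimes>\<^bsub>?F\<^esub> tab_g r i))
      \<in> carrier ?F" if "i \<in> {1..n - 1}" for i
    using that by (intro TF.M.finsum_closed funcsetI closed)
  have fg: "h (tab_f r s \<otimes>\<^bsub>?F\<^esub> tab_g r i) = f s \<otimes>\<^bsub>B\<^esub> g i" if "s \<in> Std1 n r" "i \<in> {1..n - 1}" for s i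
    using that by (simp only: homs closed g f)
  have gf: "h (tab_g r i \<otimes>\<^bsub>?F\<^esub> tab_f r (tab_act i s)) = g i \<otimes>\<^bsub>B\<^esub> f (tab_act i s)"
    if "s \<in> Std1 n r" "i \<in> {1..n - 1}" for s i
    using that tab_act_in_Std1[OF that] by (simp only: homs closed g f)
  have gg: "h (tab_g r i \<otimes>\<^bsub>?F\<^esub> tab_g r j) = g i \<otimes>\<^bsub>B\<^esub> g j" if "i \<in> {1..n - 1}" "j \<in> {1..n - 1}" for i j
    using that by (simp only: homs closed g)
  have ggg: "h (tab_g r i \<otimes>\<^bsub>?F\<^esub> tab_g r j \<otimes>\<^bsub>?F\<^esub> tab_g r i) = g i \<otimes>\<^bsub>B\<^esub> g j \<otimes>\<^bsub>B\<^esub> g i"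
    if "i \<in> {1..n - 1}" "j \<in> {1..n - 1}" for i j
    using that by (simp only: homs closed g)
  have ff: "h (tab_f r s \<otimes>\<^bsub>?F\<^esub> tab_f r s') = f s \<otimes>\<^bsub>B\<^esub> f s'" if "s \<in> Std1 n r" "s' \<in> Std1 n r" for s s'
    using that by (simp only: homs closed f)
  have bf: "h (of_bool b \<odot>\<^bsub>?F\<^esub> tab_f r s) = of_bool b \<odot>\<^bsub>B\<^esub> f s" if "s \<in> Std1 n r" for b s
    using that by (simp only: homs closed f)
  have g_closed: "g i \<in> carrier B" if "i \<in> {1..n - 1}" for i
    using algebra_homD(2)[OF h tab_g_closed[OF that]] that by (simp only: g)
  have f_closed: "f s \<in> carrier B" if "s \<in> Std1 n r" for s
    using algebra_homD(2)[OF h tab_f_closed[OF that]] that by (simp only: f)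
  have sum: "h (\<Oplus>\<^bsub>?F\<^esub>s\<in>Std1 n r. tab_f r s) = (\<Oplus>\<^bsub>B\<^esub>s\<in>Std1 n r. f s)"
  proof -
    have "h (\<Oplus>\<^bsub>?F\<^esub>s\<in>Std1 n r. tab_f r s) = (\<Oplus>\<^bsub>B\<^esub>s\<in>Std1 n r. h (tab_f r s))"
      by (intro algebra_hom_finsum[OF TF.assoc_algebra_axioms B h] closed)
    also have "\<dots> = (\<Oplus>\<^bsub>B\<^esub>s\<in>Std1 n r. f s)"
      by (rule B.M.finsum_cong') (auto simp: f f_closed)
    finally show ?thesis .
  qed
  have quadratic: "h (\<one>\<^bsub>?F\<^esub> \<oplus>\<^bsub>?F\<^esub> (q_var - inverse q_var) \<odot>\<^bsub>?F\<^esub>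
      (\<Oplus>\<^bsub>?F\<^esub>s\<in>Std1 n r. of_bool (same_component i s) \<odot>\<^bsub>?F\<^esub> (tab_f r s \<otimes>\<^bsub>?F\<^esub> tab_g r i))) =
      \<one>\<^bsub>B\<^esub> \<oplus>\<^bsub>B\<^esub> (q_var - inverse q_var) \<odot>\<^bsub>B\<^esub>
      (\<Oplus>\<^bsub>B\<^esub>s\<in>Std1 n r. of_bool (same_component i s) \<odot>\<^bsub>B\<^esub> (f s \<otimes>\<^bsub>B\<^esub> g i))"
    if i: "i \<in> {1..n - 1}" for i
  proof -
    have "h (\<Oplus>\<^bsub>?F\<^esub>s\<in>Std1 n r. of_bool (same_component i s) \<odot>\<^bsub>?F\<^esub> (tab_f r s \<otimes>\<^bsub>?F\<^esub> tab_g r i)) =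
        (\<Oplus>\<^bsub>B\<^esub>s\<in>Std1 n r. h (of_bool (same_component i s) \<odot>\<^bsub>?F\<^esub> (tab_f r s \<otimes>\<^bsub>?F\<^esub> tab_g r i)))"
      using i by (intro algebra_hom_finsum[OF TF.assoc_algebra_axioms B h] closed)
    also have "\<dots> = (\<Oplus>\<^bsub>B\<^esub>s\<in>Std1 n r. of_bool (same_component i s) \<odot>\<^bsub>B\<^esub> (f s \<otimes>\<^bsub>B\<^esub> g i))"
    proof (rule B.M.finsum_cong')
      show "(\<lambda>s. of_bool (same_component i s) \<odot>\<^bsub>B\<^esub> (f s \<otimes>\<^bsub>B\<^esub> g i)) \<in> Std1 n r \<rightarrow> carrier B"
        using i by (intro funcsetI B.smult_closed B.A.m_closed of_bool_closed f_closed g_closed)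
      show "h (of_bool (same_component i s) \<odot>\<^bsub>?F\<^esub> (tab_f r s \<otimes>\<^bsub>?F\<^esub> tab_g r i)) =
          of_bool (same_component i s) \<odot>\<^bsub>B\<^esub> (f s \<otimes>\<^bsub>B\<^esub> g i)" if "s \<in> Std1 n r" for s
        using i that by (simp only: algebra_homD(6)[OF h] closed fg)
    qed simp
    finally show ?thesis
      using fin[OF i] by (simp only: homs closed)
  qed
  show ?thesis
    unfolding tab_rels_def Let_def tab_relations_def ball_Un ball_setcompr ball_setcompr2 conj_assoc
    by (simp only: Ball_def singleton_iff simp_thms imp_conjL all_simps fst_conv snd_conv
        fg gf gg ggg ff bf sum
        quadratic algebra_homD(5)[OF h] algebra_hom_nat_pow[OF TF.assoc_algebra_axioms B h] closed
        g f braid_range cong: imp_cong)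
qed

end

section \<open>Sources of spectral families, and their images under homomorphisms\<close>

context spectral_algebra
begin

text \<open>Applies to the tableau algebra, where the idempotents are generators and the
  \<open>t j\<close> have to be built. Orthogonality leaves one summand in each product, with the
  prescribed eigenvalue.\<close>

lemma spectral_family_of_idempotents:
  assumes S: "finite S" and f: "\<And>s. s \<in> S \<Longrightarrow> f s \<in> carrier A"
    and sum: "(\<Oplus>\<^bsub>A\<^esub>s\<in>S. f s) = \<one>\<^bsub>A\<^esub>"
    and orth: "\<And>s s'. s \<in> S \<Longrightarrow> s' \<in> S \<Longrightarrow> f s \<otimes>\<^bsub>A\<^esub> f s' = (if s = s' then f s else \<zero>\<^bsub>A\<^esub>)"
    and less: "\<And>s j. s \<in> S \<Longrightarrow> j \<in> J \<Longrightarrow> p s j < r"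
    and inj: "\<And>s s'. s \<in> S \<Longrightarrow> s' \<in> S \<Longrightarrow> (\<And>j. j \<in> J \<Longrightarrow> p s j = p s' j) \<Longrightarrow> s = s'"
  shows "spectral_family R A r \<zeta> \<rho> S J p f (\<lambda>j. \<Oplus>\<^bsub>A\<^esub>s\<in>S. \<zeta> [^] p s j \<odot>\<^bsub>A\<^esub> f s)"
proof -
  let ?t = "\<lambda>j. \<Oplus>\<^bsub>A\<^esub>s\<in>S. \<zeta> [^] p s j \<odot>\<^bsub>A\<^esub> f s"
  have single: "(\<Oplus>\<^bsub>A\<^esub>s'\<in>S. if s = s' then \<zeta> [^] p s' j \<odot>\<^bsub>A\<^esub> f s' else \<zero>\<^bsub>A\<^esub>) = \<zeta> [^] p s j \<odot>\<^bsub>A\<^esub> f s"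
    if "s \<in> S" for s j
    using that S f by (intro A.M.finsum_singleton) auto
  have tf: "?t j \<otimes>\<^bsub>A\<^esub> f s = \<zeta> [^] p s j \<odot>\<^bsub>A\<^esub> f s" if s: "s \<in> S" for s j
  proof -
    have "?t j \<otimes>\<^bsub>A\<^esub> f s = (\<Oplus>\<^bsub>A\<^esub>s'\<in>S. (\<zeta> [^] p s' j \<odot>\<^bsub>A\<^esub> f s') \<otimes>\<^bsub>A\<^esub> f s)"
      using s S f by (intro A.A.finsum_ldistr) auto
    also have "\<dots> = (\<Oplus>\<^bsub>A\<^esub>s'\<in>S. if s = s' then \<zeta> [^] p s' j \<odot>\<^bsub>A\<^esub> f s' else \<zero>\<^bsub>A\<^esub>)"
      using s f orth by (intro A.M.finsum_cong') (auto simp: A.smult_mult_left)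
    finally show ?thesis
      using single[OF s] by simp
  qed
  have ft: "f s \<otimes>\<^bsub>A\<^esub> ?t j = \<zeta> [^] p s j \<odot>\<^bsub>A\<^esub> f s" if s: "s \<in> S" for s j
  proof -
    have "f s \<otimes>\<^bsub>A\<^esub> ?t j = (\<Oplus>\<^bsub>A\<^esub>s'\<in>S. f s \<otimes>\<^bsub>A\<^esub> (\<zeta> [^] p s' j \<odot>\<^bsub>A\<^esub> f s'))"
      using s S f by (intro A.A.finsum_rdistr) auto
    also have "\<dots> = (\<Oplus>\<^bsub>A\<^esub>s'\<in>S. if s = s' then \<zeta> [^] p s' j \<odot>\<^bsub>A\<^esub> f s' else \<zero>\<^bsub>A\<^esub>)"
      using s f orth by (intro A.M.finsum_cong') (auto simp: A.smult_mult_right)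
    finally show ?thesis
      using single[OF s] by simp
  qed
  have "?t j \<in> carrier A" for j
    using f by (intro A.M.finsum_closed) auto
  then show ?thesis
    using S f sum tf ft less inj by unfold_locales auto
qed

text \<open>Applies to the Yokonuma-Hecke algebra, where the \<open>t j\<close> are generators. The
  joint eigenprojections are reindexed along the bijection between indices and exponent
  functions.\<close>

lemma exists_spectral_family:
  assumes J: "finite J" and t: "\<And>j. j \<in> J \<Longrightarrow> t j \<in> carrier A"
    and pow: "\<And>j. j \<in> J \<Longrightarrow> t j [^]\<^bsub>A\<^esub> r = \<one>\<^bsub>A\<^esub>"
    and comm: "\<And>i j. i \<in> J \<Longrightarrow> j \<in> J \<Longrightarrow> t i \<otimes>\<^bsub>A\<^esub> t j = t j \<otimes>\<^bsub>A\<^esub> t i"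
    and bij: "bij_betw (\<lambda>s. restrict (p s) J) S (PiE J (\<lambda>_. {..<r}))"
  shows "\<exists>f. spectral_family R A r \<zeta> \<rho> S J p f t"
proof -
  let ?P = "PiE J (\<lambda>_. {..<r})" and ?c = "\<lambda>s. restrict (p s) J"
  have "\<exists>F. (\<forall>p\<in>?P. F p \<in> carrier A \<and> (\<forall>j\<in>J. F p \<otimes>\<^bsub>A\<^esub> t j = t j \<otimes>\<^bsub>A\<^esub> F p) \<and>
      (\<forall>j\<in>J. t j \<otimes>\<^bsub>A\<^esub> F p = \<zeta> [^] p j \<odot>\<^bsub>A\<^esub> F p)) \<and> (\<Oplus>\<^bsub>A\<^esub>p\<in>?P. F p) = \<one>\<^bsub>A\<^esub>"
    by (rule joint_eigenprojections) (fact J t pow comm subset_refl)+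
  then obtain F where
    F: "\<forall>p\<in>?P. F p \<in> carrier A \<and> (\<forall>j\<in>J. F p \<otimes>\<^bsub>A\<^esub> t j = t j \<otimes>\<^bsub>A\<^esub> F p) \<and>
      (\<forall>j\<in>J. t j \<otimes>\<^bsub>A\<^esub> F p = \<zeta> [^] p j \<odot>\<^bsub>A\<^esub> F p)"
    and F_sum: "(\<Oplus>\<^bsub>A\<^esub>p\<in>?P. F p) = \<one>\<^bsub>A\<^esub>"
    by (elim exE conjE)
  have c: "?c s \<in> ?P" if "s \<in> S" for s
    by (rule bspec[OF bij_betwE[OF bij] that])
  have inj: "inj_on ?c S" and image: "?c ` S = ?P"
    using bij by (simp_all add: bij_betw_def)
  have "finite S"
    using bij_betw_finite[OF bij] J by (simp add: finite_PiE)
  have "(\<Oplus>\<^bsub>A\<^esub>s\<in>S. F (?c s)) = (\<Oplus>\<^bsub>A\<^esub>p\<in>?c ` S. F p)"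
    using F c by (intro A.M.finsum_reindex[symmetric] inj) blast
  then have sum: "(\<Oplus>\<^bsub>A\<^esub>s\<in>S. F (?c s)) = \<one>\<^bsub>A\<^esub>"
    unfolding image F_sum .
  have tF: "t j \<otimes>\<^bsub>A\<^esub> F (?c s) = \<zeta> [^] p s j \<odot>\<^bsub>A\<^esub> F (?c s)"
    and Ft: "F (?c s) \<otimes>\<^bsub>A\<^esub> t j = \<zeta> [^] p s j \<odot>\<^bsub>A\<^esub> F (?c s)" if "s \<in> S" "j \<in> J" for s j
    using F[rule_format, OF c[OF that(1)]] that(2) by simp_all
  have less: "p s j < r" if "s \<in> S" "j \<in> J" for s j
    using PiE_mem[OF c[OF that(1)] that(2)] that(2) by simp
  have inj': "s = s'" if "s \<in> S" "s' \<in> S" "\<And>j. j \<in> J \<Longrightarrow> p s j = p s' j" for s s'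
    using that(1,2) by (intro inj_onD[OF inj]) (auto intro!: restrict_ext that(3))
  have "spectral_family R A r \<zeta> \<rho> S J p (\<lambda>s. F (?c s)) t"
  proof unfold_locales
    show "F (?c s) \<in> carrier A" if "s \<in> S" for s
      using F c[OF that] by blast
  qed (fact \<open>finite S\<close> t sum tF Ft less inj')+
  then show ?thesis
    by (rule exI[of _ "\<lambda>s. F (?c s)"])
qed

end

text \<open>Eigenvector equations and the sum survive any homomorphism, and the separation of
  indices concerns exponents, which do not change. The image family can then be compared with
  another one by \<open>f_unique\<close>.\<close>

lemma (in spectral_family) spectral_family_hom:
  assumes B: "assoc_algebra R B" and h: "h \<in> algebra_hom R A B"
    and t': "\<And>j. j \<in> J \<Longrightarrow> h (t j) = t' j"
  shows "spectral_family R B r \<zeta> \<rho> S J p (\<lambda>s. h (f s)) t'"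
proof -
  interpret B: assoc_algebra R B by (rule B)
  note hom = algebra_homD[OF h]
  show ?thesis
  proof unfold_locales
    show "(\<Oplus>\<^bsub>B\<^esub>s\<in>S. h (f s)) = \<one>\<^bsub>B\<^esub>"
      unfolding hom(5)[symmetric] f_sum[symmetric]
      by (rule algebra_hom_finsum[OF A.assoc_algebra_axioms B h, symmetric]) (rule f_closed)
    show "t' j \<otimes>\<^bsub>B\<^esub> h (f s) = \<zeta> [^] p s j \<odot>\<^bsub>B\<^esub> h (f s)" if "s \<in> S" "j \<in> J" for s j
      using that hom(3)[of "t j" "f s"] by (simp add: t' t_f hom(6) t_closed f_closed)
    show "h (f s) \<otimes>\<^bsub>B\<^esub> t' j = \<zeta> [^] p s j \<odot>\<^bsub>B\<^esub> h (f s)" if "s \<in> S" "j \<in> J" for s j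
      using that hom(3)[of "f s" "t j"] by (simp add: t' f_t hom(6) t_closed f_closed)
    show "t' j \<in> carrier B" if "j \<in> J" for j
      using hom(2)[OF t_closed[OF that]] t'[OF that] by simp
  qed (use finite_S f_closed hom(2) p_less p_inj in auto)
qed

section \<open>The isomorphism\<close>

text \<open>Relative to a spectral family, \<open>average_eq_sum\<close> matches the quadratic
  relations, and the intertwining lemmas match the mixed ones, with \<open>tab_act\<close> acting on
  tableaux and the transposition on entries.\<close>

lemma yh_relations_iff_tab_relations:
  assumes spec: "spectral_family (base_ring r) A r (ratfun_const (root_xi r)) (inverse (of_nat r))
      (Std1 n r) {1..n} column f t"
    and g: "\<And>i. i \<in> {1..n - 1} \<Longrightarrow> g i \<in> carrier A"
  shows "yh_relations r n A g t \<longleftrightarrow> tab_relations r n A g f"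
proof -
  interpret spectral_family "base_ring r" A r "ratfun_const (root_xi r)" "inverse (of_nat r)"
      "Std1 n r" "{1..n}" column f t
    by (rule spec)
  have quadratic: "(inverse (of_nat r) \<odot>\<^bsub>A\<^esub>
        (\<Oplus>\<^bsub>A\<^esub>s\<in>{..<r}. t i [^]\<^bsub>A\<^esub> s \<otimes>\<^bsub>A\<^esub> t (i + 1) [^]\<^bsub>A\<^esub> (r - s))) \<otimes>\<^bsub>A\<^esub> g i =
      (\<Oplus>\<^bsub>A\<^esub>s\<in>Std1 n r. of_bool (same_component i s) \<odot>\<^bsub>A\<^esub> (f s \<otimes>\<^bsub>A\<^esub> g i))"
    if i: "i \<in> {1..n - 1}" for i
  proof -
    let ?e = "\<lambda>s. if column s i = column s (i + 1) then f s else \<zero>\<^bsub>A\<^esub>"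
    have "(inverse (of_nat r) \<odot>\<^bsub>A\<^esub>
        (\<Oplus>\<^bsub>A\<^esub>s\<in>{..<r}. t i [^]\<^bsub>A\<^esub> s \<otimes>\<^bsub>A\<^esub> t (i + 1) [^]\<^bsub>A\<^esub> (r - s))) \<otimes>\<^bsub>A\<^esub> g i =
        (\<Oplus>\<^bsub>A\<^esub>s\<in>Std1 n r. ?e s) \<otimes>\<^bsub>A\<^esub> g i"
      using average_eq_sum[OF generator_range[OF i]] by simp
    also have "\<dots> = (\<Oplus>\<^bsub>A\<^esub>s\<in>Std1 n r. ?e s \<otimes>\<^bsub>A\<^esub> g i)"
      using g[OF i] finite_S f_closed by (intro A.A.finsum_ldistr) auto
    also have "\<dots> = (\<Oplus>\<^bsub>A\<^esub>s\<in>Std1 n r. of_bool (same_component i s) \<odot>\<^bsub>A\<^esub> (f s \<otimes>\<^bsub>A\<^esub> g i))"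
    proof (rule A.M.finsum_cong')
      show "(\<lambda>s. of_bool (same_component i s) \<odot>\<^bsub>A\<^esub> (f s \<otimes>\<^bsub>A\<^esub> g i)) \<in> Std1 n r \<rightarrow> carrier A"
        using g[OF i] f_closed by (intro funcsetI A.smult_closed A.A.m_closed of_bool_closed)
      fix s
      assume s: "s \<in> Std1 n r"
      have x: "f s \<otimes>\<^bsub>A\<^esub> g i \<in> carrier A"
        using g[OF i] f_closed[OF s] by simp
      show "?e s \<otimes>\<^bsub>A\<^esub> g i = of_bool (same_component i s) \<odot>\<^bsub>A\<^esub> (f s \<otimes>\<^bsub>A\<^esub> g i)"
        unfolding same_component_iff[OF s i]
        using g[OF i] A.smult_one[OF x] A.smult_l_null[OF x] by simp
    qed simp
    finally show ?thesis .
  qed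
  have f_t_intertwine: "(\<forall>s\<in>Std1 n r. f s \<otimes>\<^bsub>A\<^esub> g i = g i \<otimes>\<^bsub>A\<^esub> f (tab_act i s)) \<longleftrightarrow>
      (\<forall>j\<in>{1..n}. t j \<otimes>\<^bsub>A\<^esub> g i = g i \<otimes>\<^bsub>A\<^esub> t (Transposition.transpose i (i + 1) j))"
    if i: "i \<in> {1..n - 1}" for i
  proof -
    note facts = g[OF i] tab_act_in_Std1[OF _ i] transpose_mem[OF i]
      column_tab_act[OF _ i]
    show ?thesis
    proof (intro iffI ballI)
      fix j
      assume fg: "\<forall>s\<in>Std1 n r. f s \<otimes>\<^bsub>A\<^esub> g i = g i \<otimes>\<^bsub>A\<^esub> f (tab_act i s)" and j: "j \<in> {1..n}"
      show "t j \<otimes>\<^bsub>A\<^esub> g i = g i \<otimes>\<^bsub>A\<^esub> t (Transposition.transpose i (i + 1) j)"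
        by (rule t_intertwine[where \<tau> = "tab_act i"]) (rule transpose_involutory | fact facts bspec[OF fg] j)+
    next
      fix s
      assume tg: "\<forall>j\<in>{1..n}. t j \<otimes>\<^bsub>A\<^esub> g i = g i \<otimes>\<^bsub>A\<^esub> t (Transposition.transpose i (i + 1) j)"
        and s: "s \<in> Std1 n r"
      show "f s \<otimes>\<^bsub>A\<^esub> g i = g i \<otimes>\<^bsub>A\<^esub> f (tab_act i s)"
        by (rule f_intertwine[where \<sigma> = "Transposition.transpose i (i + 1)"])
          (rule transpose_involutory | fact facts bspec[OF tg] s)+
    qed
  qed
  then have intertwine: "(\<forall>i\<in>{1..n - 1}. \<forall>j\<in>{1..n}.
        t j \<otimes>\<^bsub>A\<^esub> g i = g i \<otimes>\<^bsub>A\<^esub> t (Transposition.transpose i (i + 1) j)) \<longleftrightarrow>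
      (\<forall>s\<in>Std1 n r. \<forall>i\<in>{1..n - 1}. f s \<otimes>\<^bsub>A\<^esub> g i = g i \<otimes>\<^bsub>A\<^esub> f (tab_act i s))"
    by blast
  have f_orth: "\<forall>s\<in>Std1 n r. \<forall>s'\<in>Std1 n r. f s \<otimes>\<^bsub>A\<^esub> f s' = of_bool (s = s') \<odot>\<^bsub>A\<^esub> f s"
    using f_mult_f f_closed A.smult_one A.smult_l_null by simp
  \<comment> \<open>The relations among the \<open>t j\<close> alone and among the
    \<open>f s\<close> alone hold in every spectral family, and those among the \<open>g i\<close>
    without quadratic term are literally shared.\<close>
  show ?thesis
    unfolding yh_relations_def tab_relations_def using f_sum f_orth t_pow_r t_commute
    by (simp only: intertwine quadratic cong: ball_cong) blast
qed

theorem proposition34: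
  fixes n r :: nat
  assumes "n \<ge> 1" and "r \<ge> 1"
  shows "algebra_isomorphic (base_ring r) (yokonuma_hecke r n) (tableau_algebra r n)"
proof -
  let ?R = "base_ring r" and ?Y = "yokonuma_hecke r n" and ?T = "tableau_algebra r n"
  let ?\<zeta> = "ratfun_const (root_xi r)" and ?\<rho> = "inverse (of_nat r) :: ratfun"
  interpret R: cring ?R by (rule base_ring_cring)
  interpret Y: presentation ?R "yh_gens r n" "yh_rels r n"
    using yh_rels_closed[of r n] by unfold_locales (simp add: yh_free_def)
  interpret T: presentation ?R "tab_gens r n" "tab_rels r n"
    using tab_rels_closed[of r n] by unfold_locales (simp add: tab_free_def)
  note folds = yh_free_def[symmetric] tab_free_def[symmetric] yokonuma_hecke_def[symmetric]
    tableau_algebra_def[symmetric]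
  note Y_algebra = Y.P.assoc_algebra_axioms[unfolded folds]
  note T_algebra = T.P.assoc_algebra_axioms[unfolded folds]
  note Y_cls = Y.cls_hom[unfolded folds] and T_cls = T.cls_hom[unfolded folds]
  interpret YS: spectral_algebra ?R ?Y r ?\<zeta> ?\<rho>
    using base_root_of_unity[OF assms(2)] Y_algebra by (rule spectral_algebra.intro)
  interpret TS: spectral_algebra ?R ?T r ?\<zeta> ?\<rho>
    using base_root_of_unity[OF assms(2)] T_algebra by (rule spectral_algebra.intro)

  define yg where "yg i = Y.cls (yh_g r i)" for i
  define yt where "yt j = Y.cls (yh_t r j)" for j
  define tg where "tg i = T.cls (tab_g r i)" for i
  define tf where "tf s = T.cls (tab_f r s)" for s
  have yg: "yg i \<in> carrier ?Y" if "i \<in> {1..n - 1}" for i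
    unfolding yg_def by (rule algebra_homD(2)[OF Y_cls yh_g_closed[OF that]])
  have yt: "yt j \<in> carrier ?Y" if "j \<in> {1..n}" for j
    unfolding yt_def by (rule algebra_homD(2)[OF Y_cls yh_t_closed[OF that]])
  have tg: "tg i \<in> carrier ?T" if "i \<in> {1..n - 1}" for i
    unfolding tg_def by (rule algebra_homD(2)[OF T_cls tab_g_closed[OF that]])
  have tf: "tf s \<in> carrier ?T" if "s \<in> Std1 n r" for s
    unfolding tf_def by (rule algebra_homD(2)[OF T_cls tab_f_closed[OF that]])

  have Y_rel: "yh_relations r n ?Y yg yt"
    using yh_rels_iff[OF Y_algebra Y_cls yg_def[symmetric] yt_def[symmetric]] Y.cls_relation by simp
  have T_rel: "tab_relations r n ?T tg tf"
    using tab_rels_iff[OF T_algebra T_cls tg_def[symmetric] tf_def[symmetric]] T.cls_relation by simp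

  \<comment> \<open>By \<open>t_eq_sum\<close>, elements that have the \<open>tf s\<close> as
    eigenvectors with these exponents must be of this form.\<close>
  define tt where "tt j = (\<Oplus>\<^bsub>?T\<^esub>s\<in>Std1 n r. ?\<zeta> [^]\<^bsub>?R\<^esub> column s j \<odot>\<^bsub>?T\<^esub> tf s)" for j
  have T_spec: "spectral_family ?R ?T r ?\<zeta> ?\<rho> (Std1 n r) {1..n} column tf tt"
    unfolding tt_def
  proof (rule TS.spectral_family_of_idempotents)
    show "tf s \<otimes>\<^bsub>?T\<^esub> tf s' = (if s = s' then tf s else \<zero>\<^bsub>?T\<^esub>)" if "s \<in> Std1 n r" "s' \<in> Std1 n r" for s s'
    proof -
      have "tf s \<otimes>\<^bsub>?T\<^esub> tf s' = of_bool (s = s') \<odot>\<^bsub>?T\<^esub> tf s"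
        using T_rel that unfolding tab_relations_def by blast
      then show ?thesis
        using TS.A.smult_one[OF tf[OF that(2)]] TS.A.smult_l_null[OF tf[OF that(1)]] by auto
    qed
    show "(\<Oplus>\<^bsub>?T\<^esub>s\<in>Std1 n r. tf s) = \<one>\<^bsub>?T\<^esub>"
      using T_rel unfolding tab_relations_def by blast
  qed (fact finite_Std1 tf column_less(1) Std1_eqI)+
  interpret T_spec: spectral_family ?R ?T r ?\<zeta> ?\<rho> "Std1 n r" "{1..n}" column tf tt
    by (rule T_spec)

  have "\<exists>f. spectral_family ?R ?Y r ?\<zeta> ?\<rho> (Std1 n r) {1..n} column f yt"
  proof (rule YS.exists_spectral_family[of "{1..n}" yt column "Std1 n r"])
    show "yt j [^]\<^bsub>?Y\<^esub> r = \<one>\<^bsub>?Y\<^esub>" if "j \<in> {1..n}" for j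
      using Y_rel that unfolding yh_relations_def by blast
    show "yt i \<otimes>\<^bsub>?Y\<^esub> yt j = yt j \<otimes>\<^bsub>?Y\<^esub> yt i" if "i \<in> {1..n}" "j \<in> {1..n}" for i j
      using Y_rel that unfolding yh_relations_def by blast
  qed (fact finite_atLeastAtMost yt bij_betw_column)+
  then obtain yf where Y_spec: "spectral_family ?R ?Y r ?\<zeta> ?\<rho> (Std1 n r) {1..n} column yf yt" ..
  interpret Y_spec: spectral_family ?R ?Y r ?\<zeta> ?\<rho> "Std1 n r" "{1..n}" column yf yt
    by (rule Y_spec)

  have "case_yh_gen tg tt x \<in> carrier ?T" if "x \<in> yh_gens r n" for x
    using that unfolding yh_gens_def
    by (auto simp del: atLeastAtMost_iff One_nat_def intro: tg T_spec.t_closed)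
  then obtain \<phi>0 where \<phi>0: "\<phi>0 \<in> algebra_hom ?R (yh_free r n) ?T"
    and \<phi>0_gen: "\<And>x. x \<in> yh_gens r n \<Longrightarrow> \<phi>0 (free_gen ?R x) = case_yh_gen tg tt x"
    unfolding yh_free_def
    using R.free_algebra_lift[OF T_algebra] by blast
  \<comment> \<open>Here the equivalence carries the known relations from the \<open>tf s\<close> to
    the \<open>tt j\<close>; for \<open>\<psi>0\<close> it is read in the other direction.\<close>
  have "yh_relations r n ?T tg tt \<longleftrightarrow> tab_relations r n ?T tg tf"
    using T_spec tg by (rule yh_relations_iff_tab_relations)
  then have "\<forall>x\<in>yh_rels r n. \<phi>0 (fst x) = \<phi>0 (snd x)"
    using T_rel by (subst yh_rels_iff[OF T_algebra \<phi>0]) (auto simp: \<phi>0_gen yh_gens_def)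
  then obtain \<phi> where \<phi>: "\<phi> \<in> algebra_hom ?R ?Y ?T"
    and \<phi>_cls: "\<And>x. x \<in> carrier (yh_free r n) \<Longrightarrow> \<phi> (Y.cls x) = \<phi>0 x"
    using Y.P_lift[OF T_algebra \<phi>0[unfolded yh_free_def], unfolded folds] by (metis fst_conv snd_conv)
  have \<phi>_g: "\<phi> (yg i) = tg i" if "i \<in> {1..n - 1}" for i
    unfolding yg_def \<phi>_cls[OF yh_g_closed[OF that]] using that by (subst \<phi>0_gen) (auto simp: yh_gens_def)
  have \<phi>_t: "\<phi> (yt j) = tt j" if "j \<in> {1..n}" for j
    unfolding yt_def \<phi>_cls[OF yh_t_closed[OF that]] using that by (subst \<phi>0_gen) (auto simp: yh_gens_def)

  have "case_tab_gen yg yf x \<in> carrier ?Y" if "x \<in> tab_gens r n" for x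
    using that unfolding tab_gens_def
    by (auto simp del: atLeastAtMost_iff One_nat_def intro: yg Y_spec.f_closed)
  then obtain \<psi>0 where \<psi>0: "\<psi>0 \<in> algebra_hom ?R (tab_free r n) ?Y"
    and \<psi>0_gen: "\<And>x. x \<in> tab_gens r n \<Longrightarrow> \<psi>0 (free_gen ?R x) = case_tab_gen yg yf x"
    unfolding tab_free_def
    using R.free_algebra_lift[OF Y_algebra] by blast
  have "yh_relations r n ?Y yg yt \<longleftrightarrow> tab_relations r n ?Y yg yf"
    using Y_spec yg by (rule yh_relations_iff_tab_relations)
  then have "\<forall>x\<in>tab_rels r n. \<psi>0 (fst x) = \<psi>0 (snd x)"
    using Y_rel by (subst tab_rels_iff[OF Y_algebra \<psi>0]) (auto simp: \<psi>0_gen tab_gens_def)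
  then obtain \<psi> where \<psi>: "\<psi> \<in> algebra_hom ?R ?T ?Y"
    and \<psi>_cls: "\<And>x. x \<in> carrier (tab_free r n) \<Longrightarrow> \<psi> (T.cls x) = \<psi>0 x"
    using T.P_lift[OF Y_algebra \<psi>0[unfolded tab_free_def], unfolded folds] by (metis fst_conv snd_conv)
  have \<psi>_g: "\<psi> (tg i) = yg i" if "i \<in> {1..n - 1}" for i
    unfolding tg_def \<psi>_cls[OF tab_g_closed[OF that]] using that by (subst \<psi>0_gen) (auto simp: tab_gens_def)
  have \<psi>_f: "\<psi> (tf s) = yf s" if "s \<in> Std1 n r" for s
    unfolding tf_def \<psi>_cls[OF tab_f_closed[OF that]] using that by (subst \<psi>0_gen) (auto simp: tab_gens_def)

  \<comment> \<open>The images of the \<open>yf s\<close> and the generators \<open>tf s\<close> are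
    spectral families for the same elements \<open>tt j\<close>, so uniqueness identifies them
    without a formula for \<open>yf\<close>.\<close>
  have \<phi>_f: "\<phi> (yf s) = tf s" if "s \<in> Std1 n r" for s
    using Y_spec.spectral_family_hom[OF T_algebra \<phi> \<phi>_t] that by (rule T_spec.f_unique)
  \<comment> \<open>By linearity the image of \<open>tt j\<close> is the combination of the
    \<open>yf s\<close> with the same coefficients, which is the spectral decomposition of
    \<open>yt j\<close>.\<close>
  have \<psi>_t: "\<psi> (tt j) = yt j" if j: "j \<in> {1..n}" for j
  proof -
    have "\<psi> (tt j) = (\<Oplus>\<^bsub>?Y\<^esub>s\<in>Std1 n r. \<psi> (?\<zeta> [^]\<^bsub>?R\<^esub> column s j \<odot>\<^bsub>?T\<^esub> tf s))"
      unfolding tt_def by (intro algebra_hom_finsum[OF T_algebra Y_algebra \<psi>]) (auto intro: tf)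
    also have "\<dots> = (\<Oplus>\<^bsub>?Y\<^esub>s\<in>Std1 n r. ?\<zeta> [^]\<^bsub>?R\<^esub> column s j \<odot>\<^bsub>?Y\<^esub> yf s)"
      by (intro YS.A.M.finsum_cong') (auto simp: algebra_homD(6)[OF \<psi>] tf \<psi>_f Y_spec.f_closed)
    also have "\<dots> = yt j"
      using j by (rule Y_spec.t_eq_sum[symmetric])
    finally show ?thesis .
  qed

  have "\<psi> (\<phi> x) = x" if "x \<in> carrier ?Y" for x
  proof -
    have "(\<psi> \<circ> \<phi>) (Y.cls (free_gen ?R y)) = Y.cls (free_gen ?R y)" if y: "y \<in> yh_gens r n" for y
    proof -
      consider i where "i \<in> {1..n - 1}" "y = YG i" | j where "j \<in> {1..n}" "y = YT j"
        using y unfolding yh_gens_def by blast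
      then show ?thesis
        by cases (simp_all only: comp_apply yg_def[symmetric] yt_def[symmetric] \<phi>_g \<phi>_t \<psi>_g \<psi>_t)
    qed
    then show ?thesis
      using Y.P_hom_eqI[unfolded folds, OF Y_algebra algebra_hom_comp[OF \<phi> \<psi>] algebra_hom_id] that
      by simp
  qed
  moreover have "\<phi> (\<psi> x) = x" if "x \<in> carrier ?T" for x
  proof -
    have "(\<phi> \<circ> \<psi>) (T.cls (free_gen ?R y)) = T.cls (free_gen ?R y)" if y: "y \<in> tab_gens r n" for y
    proof -
      consider i where "i \<in> {1..n - 1}" "y = TG i" | s where "s \<in> Std1 n r" "y = TF s"
        using y unfolding tab_gens_def by blast
      then show ?thesis
        by cases (simp_all only: comp_apply tg_def[symmetric] tf_def[symmetric] \<phi>_g \<phi>_f \<psi>_g \<psi>_f)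
    qed
    then show ?thesis
      using T.P_hom_eqI[unfolded folds, OF T_algebra algebra_hom_comp[OF \<psi> \<phi>] algebra_hom_id] that
      by simp
  qed
  ultimately have "\<phi> \<in> algebra_iso ?R ?Y ?T"
    using \<phi> \<psi> by (intro algebra_iso_of_inverse_homs)
  then show ?thesis
    unfolding algebra_isomorphic_def by blast
qed

end
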